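(* The maximal single vertex discrepancy $c_2$ between Propp machine and linear machine is a finite constant depending on the allowed rotor sequences, as follows. (i) If all vertices have the same circular rotor sequence and $c_2:=\sup |f(\mathbf{y},T)-E(\mathbf{y},T)|$, the supremum being over all even initial configurations, all $\mathbf{y}\in V$ and all $T\in\mathbb{N}_0$, then $7.832\le c_2\le 7.985$. (ii) If all vertices have the same non-circular rotor sequence and $c_2$ is defined by the same supremum, then $7.286\le c_2\le 7.439$. (iii) If different vertices may have different rotor sequences, and each vertex $\mathbf{x}$ is assigned a rotor sequence for which $\mathrm{MAXCON}(\mathbf{x})$ is maximal among all rotor sequences, then $c_2:=\sup |f(\mathbf{0},T)-E(\mathbf{0},T)|$, the supremum being over all even initial configurations and all $T\in\mathbb{N}_0$, satisfies $7.873\le c_2\le 8.026$.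
   Context: Let $V=\{(x_1,x_2)\in\mathbb{Z}^2: x_1\equiv x_2 \pmod 2\}$ and $\mathrm{DIR}=\{\nearrow,\searrow,\swarrow,\nwarrow\}$ with $\nearrow=(1,1)$, $\searrow=(1,-1)$, $\swarrow=(-1,-1)$, $\nwarrow=(-1,1)$; the neighbors of $\mathbf{x}\in V$ are $\mathbf{x}+\mathbf{A}$, $\mathbf{A}\in\mathrm{DIR}$ (this graph is isomorphic to the standard two-dimensional grid). Write $\mathbf{x}\sim t$ if $x_1\equiv x_2\equiv t \pmod 2$. A rotor sequence is a cyclic permutation (a single 4-cycle) $\mathrm{NEXT}:\mathrm{DIR}\to\mathrm{DIR}$, also written as the 4-tuple $(\nearrow,\mathrm{NEXT}(\nearrow),\mathrm{NEXT}^2(\nearrow),\mathrm{NEXT}^3(\nearrow))$. It is circular if it equals $(\nearrow,\searrow,\swarrow,\nwarrow)$ or $(\nearrow,\nwarrow,\swarrow,\searrow)$; the other four are non-circular. Propp machine: an initial configuration assigns to each $\mathbf{x}\in V$ a number $f(\mathbf{x},0)\in\mathbb{N}_0$ of chips and a rotor direction $\mathrm{ARR}(\mathbf{x},0)\in\mathrm{DIR}$. In one step each chip present makes exactly one move: the chips on a vertex leave one after another, each moving one step in the direction the rotor of that vertex currently points, after which this rotor is updated from $\mathbf{A}$ to $\mathrm{NEXT}(\mathbf{A})$ (with the rotor sequence of that vertex). $f(\mathbf{x},t)$ is the number of chips on $\mathbf{x}$ after $t$ steps. The configuration is even if $f(\mathbf{x},0)=0$ unless $\mathbf{x}\sim 0$.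 Linear machine: $E(\mathbf{x},0)=f(\mathbf{x},0)$ and $E(\mathbf{x},t)=\frac14\sum_{\mathbf{A}\in\mathrm{DIR}}E(\mathbf{x}+\mathbf{A},t-1)$ for $t\ge1$; it equals the expected number of chips on $\mathbf{x}$ after $t$ steps if all chips perform simple random walks. For $t\ge 0$ let $H(\mathbf{x},t)=4^{-t}\binom{t}{(t+x_1)/2}\binom{t}{(t+x_2)/2}$ if $\mathbf{x}\sim t$ and $\|\mathbf{x}\|_\infty\le t$, and $H(\mathbf{x},t)=0$ otherwise. For $t\ge1$ let $\mathrm{INF}(\mathbf{x},\mathbf{A},t)=H(\mathbf{x}+\mathbf{A},t-1)-H(\mathbf{x},t)$. For $i\in\mathbb{N}_0$ let $s_i(\mathbf{x})=\min\{u\ge0: i<\sum_{t=0}^{u}f(\mathbf{x},t)\}$ ($\infty$ if there is no such $u$). For an even initial configuration and a run-time $T$, $\mathrm{CON}(\mathbf{x})=\sum_{i\ge0,\ s_i(\mathbf{x})<T}\mathrm{INF}(\mathbf{x},\mathrm{NEXT}^i(\mathrm{ARR}(\mathbf{x},0)),T-s_i(\mathbf{x}))$, where $\mathrm{NEXT}$ is the rotor sequence at $\mathbf{x}$. $\mathrm{MAXCON}(\mathbf{x})$ is the supremum of $\mathrm{CON}(\mathbf{x})$ over all even initial configurations and all $T\in\mathbb{N}_0$; it depends on the rotor sequence assigned to $\mathbf{x}$. *)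

theory Defs
  imports "HOL-Analysis.Analysis" "HOL-Combinatorics.Orbits" "HOL-Number_Theory.Cong"
begin

type_synonym point = "int \<times> int"

definition V :: "point set" where
  "V = {x. [fst x = snd x] (mod 2)}"

definition same_parity :: "point \<Rightarrow> int \<Rightarrow> bool" where
  "same_parity x t \<longleftrightarrow> [fst x = t] (mod 2) \<and> [snd x = t] (mod 2)"

datatype dir = NE | SE | SW | NW

lemma UNIV_dir: "UNIV = {NE, SE, SW, NW}"
  using dir.exhaust by blast

instance dir :: finite
  by standard (simp add: UNIV_dir)

primrec dirvec :: "dir \<Rightarrow> point" where
  "dirvec NE = (1, 1)"
| "dirvec SE = (1, -1)"
| "dirvec SW = (-1, -1)"
| "dirvec NW = (-1, 1)"

definition rotor_sequence :: "(dir \<Rightarrow> dir) \<Rightarrow> bool" where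
  "rotor_sequence N \<longleftrightarrow> N permutes UNIV \<and> cyclic_on N UNIV"

definition rotor_tuple :: "(dir \<Rightarrow> dir) \<Rightarrow> dir \<times> dir \<times> dir \<times> dir" where
  "rotor_tuple N = (NE, N NE, (N ^^ 2) NE, (N ^^ 3) NE)"

definition circular_rotor :: "(dir \<Rightarrow> dir) \<Rightarrow> bool" where
  "circular_rotor N \<longleftrightarrow> rotor_tuple N \<in> {(NE, SE, SW, NW), (NE, NW, SW, SE)}"

text \<open>A global assignment of rotor sequences is a function \<open>R\<close> from points to maps on directions.
  Everything is a total function on \<open>\<int> \<times> \<int>\<close>; since even configurations
  carry no chips outside \<open>V\<close> and chips never leave \<open>V\<close>, the rotors outside
  \<open>V\<close> play no role.\<close>

text \<open>A state consists of the chip numbers and the rotor directions. The \<open>j\<close>-th chip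
  (counted from 0) to leave \<open>x\<close> in a step finds the rotor in direction
  \<open>(R x ^^ j) (a x)\<close>, and the chips arriving at \<open>y\<close> in direction \<open>A\<close> come from
  \<open>y - dirvec A\<close>.\<close>

definition propp_step ::
  "(point \<Rightarrow> dir \<Rightarrow> dir) \<Rightarrow> (point \<Rightarrow> nat) \<times> (point \<Rightarrow> dir) \<Rightarrow> (point \<Rightarrow> nat) \<times> (point \<Rightarrow> dir)"
where
  "propp_step R = (\<lambda>(f, a).
     (\<lambda>y. \<Sum>A\<in>UNIV. let x = y - dirvec A in card {j. j < f x \<and> (R x ^^ j) (a x) = A},
      \<lambda>x. (R x ^^ f x) (a x)))"

definition chips ::
  "(point \<Rightarrow> dir \<Rightarrow> dir) \<Rightarrow> (point \<Rightarrow> nat) \<Rightarrow> (point \<Rightarrow> dir) \<Rightarrow> point \<Rightarrow> nat \<Rightarrow> nat" where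
  "chips R f0 a0 x t = fst ((propp_step R ^^ t) (f0, a0)) x"

definition even_config :: "(point \<Rightarrow> nat) \<Rightarrow> bool" where
  "even_config f0 \<longleftrightarrow> (\<forall>x. \<not> same_parity x 0 \<longrightarrow> f0 x = 0)"

primrec linear_chips :: "(point \<Rightarrow> nat) \<Rightarrow> nat \<Rightarrow> point \<Rightarrow> real" where
  "linear_chips f0 0 = (\<lambda>x. real (f0 x))"
| "linear_chips f0 (Suc t) = (\<lambda>x. 1 / 4 * (\<Sum>A\<in>UNIV. linear_chips f0 t (x + dirvec A)))"

definition discrepancy ::
  "(point \<Rightarrow> dir \<Rightarrow> dir) \<Rightarrow> (point \<Rightarrow> nat) \<Rightarrow> (point \<Rightarrow> dir) \<Rightarrow> point \<Rightarrow> nat \<Rightarrow> real" where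
  "discrepancy R f0 a0 y T = \<bar>real (chips R f0 a0 y T) - linear_chips f0 T y\<bar>"

definition walk_prob :: "point \<Rightarrow> nat \<Rightarrow> real" where
  "walk_prob x t =
     (if same_parity x (int t) \<and> max \<bar>fst x\<bar> \<bar>snd x\<bar> \<le> int t
      then real (t choose nat ((int t + fst x) div 2)) *
           real (t choose nat ((int t + snd x) div 2)) / 4 ^ t
      else 0)"

text \<open>Only used for \<open>t \<ge> 1\<close>.\<close>

definition influence :: "point \<Rightarrow> dir \<Rightarrow> nat \<Rightarrow> real" where
  "influence x A t = walk_prob (x + dirvec A) (t - 1) - walk_prob x t"

definition chip_time ::
  "(point \<Rightarrow> dir \<Rightarrow> dir) \<Rightarrow> (point \<Rightarrow> nat) \<Rightarrow> (point \<Rightarrow> dir) \<Rightarrow> point \<Rightarrow> nat \<Rightarrow> enat" where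
  "chip_time R f0 a0 x i =
     (if \<exists>u. i < (\<Sum>t\<le>u. chips R f0 a0 x t)
      then enat (LEAST u. i < (\<Sum>t\<le>u. chips R f0 a0 x t)) else \<infinity>)"

text \<open>The index set of the sum is finite, as it is bounded by the number of chips seen at
  \<open>x\<close> before time \<open>T\<close>.\<close>

definition con ::
  "(point \<Rightarrow> dir \<Rightarrow> dir) \<Rightarrow> (point \<Rightarrow> nat) \<Rightarrow> (point \<Rightarrow> dir) \<Rightarrow> nat \<Rightarrow> point \<Rightarrow> real" where
  "con R f0 a0 T x =
     (\<Sum>i | chip_time R f0 a0 x i < enat T.
        influence x ((R x ^^ i) (a0 x)) (T - the_enat (chip_time R f0 a0 x i)))"

text \<open>Suprema are taken in the extended reals, so that they are meaningful without presupposing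
  boundedness.\<close>

definition maxcon :: "(point \<Rightarrow> dir \<Rightarrow> dir) \<Rightarrow> point \<Rightarrow> ereal" where
  "maxcon R x = (SUP (f0, a0, T) \<in> {f0. even_config f0} \<times> UNIV \<times> UNIV. ereal (con R f0 a0 T x))"

text \<open>The comparison changes the rotor sequence at \<open>x\<close> only. This costs no generality:
  \<open>con\<close> depends on the chip numbers at \<open>x\<close> only modulo 4, and these residues can be
  prescribed arbitrarily at the times of the parity of \<open>x\<close> by a suitable initial
  configuration, whatever the rotor sequences of the other vertices are.\<close>

definition maxcon_optimal :: "(point \<Rightarrow> dir \<Rightarrow> dir) \<Rightarrow> bool" where
  "maxcon_optimal R \<longleftrightarrow>
     (\<forall>x\<in>V. rotor_sequence (R x) \<and>
       (\<forall>N. rotor_sequence N \<longrightarrow> maxcon (R(x := N)) x \<le> maxcon R x))"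

definition sup_discrepancy :: "(point \<Rightarrow> dir \<Rightarrow> dir) \<Rightarrow> ereal" where
  "sup_discrepancy R =
     (SUP (f0, a0, y, T) \<in> {f0. even_config f0} \<times> UNIV \<times> V \<times> UNIV.
        ereal (discrepancy R f0 a0 y T))"

definition sup_discrepancy_origin :: "(point \<Rightarrow> dir \<Rightarrow> dir) \<Rightarrow> ereal" where
  "sup_discrepancy_origin R =
     (SUP (f0, a0, T) \<in> {f0. even_config f0} \<times> UNIV \<times> UNIV.
        ereal (discrepancy R f0 a0 (0, 0) T))"

end

theory Submission
  imports Defs "HOL-Real_Asymp.Real_Asymp"
begin

text \<open>The discrepancy at the origin is the sum of the contributions of all vertices. Summation by parts
  shows that the largest contribution of a vertex is the length of the path traced by three moments of its
  influence, measured in time by a sublinear support function that depends on the rotor sequence alone. Adding multiples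
  of \<open>4 ^ k\<close> chips, one can prescribe all chip numbers modulo 4, hence all arrows, so that all vertices
  reach their maximum in the same configuration, and the supremum is the sum of these path lengths. Near the
  origin they are computed in integer arithmetic: any sampling of the path bounds its length from
  below, and from above it suffices to follow the path until it returns monotonically to 0. Far away the path is
  essentially a segment traversed twice, whose length the local limit theorem gives as a multiple of
  \<open>a / (a\<^sup>2 + b\<^sup>2)\<^sup>2\<close>, and the sums over these vertices are bounded by telescoping.\<close>

section \<open>The discrepancy as a sum of contributions\<close>

text \<open>The influences of the four directions sum to zero, so along the rotor cycle they are
  differences of a potential that is linear in the moments. The chips leaving a vertex in one step
  contribute the difference of the potentials of the new and the old arrow, which leaves the arrows
  as the only freedom. A linear form added to all four potentials changes no length, because the
  path of the moments starts and ends at 0. Closedness also makes the length monotone in the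
  run-time, so that bounds found at different times for finitely many vertices hold together at a
  later one.

  The symmetries of the grid permute the six support functions, transitively within the two circular
  and within the four non-circular ones. Over an orbit of vertices the total therefore depends only
  on the type of the rotor sequence; with free choice the largest of the six lengths counts at each
  vertex. On the upper side the obstacle is the supremum over all times: an integer criterion
  detects the last turn of a path near the origin, and unimodality of the moments bounds their total
  variation farther out.\<close>

lemma sum_dir: "(\<Sum>A\<in>UNIV. f A) = f NE + f SE + f SW + (f NW :: 'a :: comm_monoid_add)"
  by (simp add: UNIV_dir add.assoc)

definition rotor :: "(point \<Rightarrow> dir \<Rightarrow> dir) \<Rightarrow> (point \<Rightarrow> nat) \<Rightarrow> (point \<Rightarrow> dir) \<Rightarrow> point \<Rightarrow> nat \<Rightarrow> dir" where
  "rotor R f0 a0 x t = snd ((propp_step R ^^ t) (f0, a0)) x"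

lemma chips_0 [simp]: "chips R f0 a0 x 0 = f0 x"
  by (simp add: chips_def)

lemma rotor_0 [simp]: "rotor R f0 a0 x 0 = a0 x"
  by (simp add: rotor_def)

lemma chips_Suc:
  "chips R f0 a0 y (Suc t) = (\<Sum>A\<in>UNIV. card {j. j < chips R f0 a0 (y - dirvec A) t \<and>
      (R (y - dirvec A) ^^ j) (rotor R f0 a0 (y - dirvec A) t) = A})"
  by (simp add: chips_def rotor_def propp_step_def Let_def case_prod_unfold)

lemma rotor_Suc: "rotor R f0 a0 x (Suc t) = (R x ^^ chips R f0 a0 x t) (rotor R f0 a0 x t)"
  by (simp add: chips_def rotor_def propp_step_def case_prod_unfold)

lemma rotor_eq: "rotor R f0 a0 x t = (R x ^^ (\<Sum>s<t. chips R f0 a0 x s)) (a0 x)"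
  by (induction t) (simp_all add: rotor_Suc funpow_add add.commute)

lemma same_parity_iff: "same_parity x t \<longleftrightarrow> even (fst x - t) \<and> even (snd x - t)"
  by (simp add: same_parity_def cong_iff_dvd_diff)

lemma V_iff: "x \<in> V \<longleftrightarrow> even (fst x - snd x)"
  by (simp add: V_def cong_iff_dvd_diff)

lemma chips_parity:
  assumes "even_config f0" "\<not> same_parity x (int t)"
  shows "chips R f0 a0 x t = 0"
  using assms(2)
proof (induction t arbitrary: x)
  case 0
  then show ?case using assms(1) by (metis even_config_def chips_0 of_nat_0)
next
  case (Suc t)
  have "chips R f0 a0 (x - dirvec A) t = 0" for A
    by (rule Suc.IH) (use Suc.prems in \<open>cases A; auto simp: same_parity_iff\<close>)
  then show ?case by (simp add: chips_Suc)
qed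

section \<open>One-dimensional walk probabilities\<close>

definition bin_prob :: "nat \<Rightarrow> int \<Rightarrow> real" where
  "bin_prob t k = (if even (int t + k) \<and> \<bar>k\<bar> \<le> int t
     then real (t choose nat ((int t + k) div 2)) / 2 ^ t else 0)"

text \<open>A diagonal step moves the two coordinates by independent fair signs. All later estimates
  are made for the one-dimensional factor.\<close>

lemma walk_prob_eq: "walk_prob x t = bin_prob t (fst x) * bin_prob t (snd x)"
proof -
  have "same_parity x (int t) \<longleftrightarrow> even (int t + fst x) \<and> even (int t + snd x)"
    by (auto simp: same_parity_iff)
  moreover have "(4::real) ^ t = 2 ^ t * 2 ^ t"
    by (simp flip: power_mult_distrib)
  ultimately show ?thesis by (auto simp: walk_prob_def bin_prob_def)
qed

lemma bin_prob_nonneg: "bin_prob t k \<ge> 0"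
  by (simp add: bin_prob_def)

lemma bin_prob_eq_0: "odd (int t + k) \<or> \<bar>k\<bar> > int t \<Longrightarrow> bin_prob t k = 0"
  by (auto simp: bin_prob_def)

lemma bin_prob_zero: "bin_prob 0 k = (if k = 0 then 1 else 0)"
  by (auto simp: bin_prob_def)

lemma bin_prob_choose:
  assumes "int t + k = 2 * int m"
  shows "bin_prob t k = real (t choose m) / 2 ^ t"
proof (cases "\<bar>k\<bar> \<le> int t")
  case True
  then show ?thesis using assms by (simp add: bin_prob_def)
next
  case False
  then have "m > t" using assms by auto
  then show ?thesis using False by (simp add: bin_prob_def binomial_eq_0)
qed

lemma bin_prob_uminus: "bin_prob t (- k) = bin_prob t k"
proof (cases "even (int t + k) \<and> \<bar>k\<bar> \<le> int t")
  case True
  then have m: "int t + k = 2 * int (nat ((int t + k) div 2))"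
    by (auto elim!: evenE)
  define m where "m = nat ((int t + k) div 2)"
  note m = m[folded m_def]
  have "m \<le> t" using True m by auto
  then have "int t + (- k) = 2 * int (t - m)" using m by auto
  from bin_prob_choose[OF this] bin_prob_choose[OF m] \<open>m \<le> t\<close> show ?thesis
    by (simp add: binomial_symmetric[OF \<open>m \<le> t\<close>])
next
  case False
  then show ?thesis by (auto simp: bin_prob_def)
qed

text \<open>A walk that is at \<open>k\<close> after \<open>t + 1\<close> steps took its last step
  upwards with probability \<open>(1 + k / (t + 1)) / 2\<close>. Through this ratio every influence
  becomes an explicit multiple of \<open>walk_prob\<close>.\<close>

lemma bin_prob_pred:
  "real (Suc t) * bin_prob t (k - 1) = (real (Suc t) + of_int k) * bin_prob (Suc t) k"
proof (cases "even (int (Suc t) + k) \<and> \<bar>k\<bar> \<le> int (Suc t)")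
  case True
  show ?thesis
  proof (cases "k = - int (Suc t)")
    case True
    then show ?thesis by (simp add: bin_prob_eq_0)
  next
    case False
    then have "int (Suc t) + k \<ge> 2" using True by presburger
    then obtain m where m: "int (Suc t) + k = 2 * int (Suc m)"
      using True by (intro that[of "nat ((int t + k - 1) div 2)"]) (auto elim!: evenE)
    then have "int t + (k - 1) = 2 * int m" by simp
    note 1 = bin_prob_choose[OF this] and 2 = bin_prob_choose[OF m]
    have 3: "real (Suc t) + of_int k = 2 * real (Suc m)"
      using m by (metis of_int_add of_int_mult of_int_numeral of_int_of_nat_eq)
    have "real (Suc m) * real (Suc t choose Suc m) = real (Suc t) * real (t choose m)"
      using Suc_times_binomial[of m t] by (metis of_nat_mult)
    then show ?thesis unfolding 1 2 3 by (simp add: field_simps del: binomial_Suc_Suc of_nat_Suc)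
  qed
next
  case False
  then have "odd (int t + (k - 1)) \<or> \<bar>k - 1\<bar> > int t" by auto
  then show ?thesis using False by (auto simp: bin_prob_eq_0)
qed

lemma bin_prob_succ:
  "real (Suc t) * bin_prob t (k + 1) = (real (Suc t) - of_int k) * bin_prob (Suc t) k"
  using bin_prob_pred[of t "- k"] bin_prob_uminus[of t "k + 1"] bin_prob_uminus[of "Suc t" k]
  by simp

lemma bin_prob_Suc: "bin_prob (Suc t) k = (bin_prob t (k - 1) + bin_prob t (k + 1)) / 2"
proof -
  have "real (Suc t) * (2 * bin_prob (Suc t) k) = real (Suc t) * (bin_prob t (k - 1) + bin_prob t (k + 1))"
    unfolding distrib_left bin_prob_pred bin_prob_succ by (simp add: algebra_simps)
  then show ?thesis by (simp del: of_nat_Suc)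
qed

lemma walk_prob_Suc: "walk_prob x (Suc t) = (\<Sum>A\<in>UNIV. walk_prob (x + dirvec A) t) / 4"
  by (simp add: walk_prob_eq sum_dir bin_prob_Suc field_simps)

lemma walk_prob_uminus: "walk_prob (- x) t = walk_prob x t"
  by (simp add: walk_prob_eq bin_prob_uminus)

definition vbox :: "point \<Rightarrow> nat \<Rightarrow> point set" where
  "vbox y n = {fst y - int n..fst y + int n} \<times> {snd y - int n..snd y + int n}"

lemma finite_vbox [simp]: "finite (vbox y n)"
  by (simp add: vbox_def)

lemma walk_prob_outside: "x \<notin> vbox y t \<Longrightarrow> walk_prob (x - y) t = 0"
  by (cases x) (auto simp: vbox_def walk_prob_eq bin_prob_eq_0)

lemma vbox_mono: "m \<le> n \<Longrightarrow> vbox y m \<subseteq> vbox y n"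
  by (auto simp: vbox_def)

text \<open>\<open>B\<close> is not invariant under the shift. What sticks out on either side
  vanishes, since a walk of \<open>n\<close> steps reaches \<open>y\<close> only from
  \<open>vbox y n\<close>.\<close>

lemma sum_shift_dirvec:
  fixes c :: "point \<Rightarrow> real"
  assumes "finite B" "vbox y (Suc n) \<subseteq> B"
  shows "(\<Sum>z\<in>B. c (z - dirvec A) * walk_prob (z - y) n) =
         (\<Sum>x\<in>B. c x * walk_prob (x - y + dirvec A) n)"
proof (rule sum.reindex_bij_witness_not_neutral[where S' = "B - vbox y n" and
      T' = "{x\<in>B. x + dirvec A \<notin> vbox y n}" and i = "\<lambda>x. x + dirvec A" and j = "\<lambda>z. z - dirvec A"])
  show "finite (B - vbox y n)" "finite {x \<in> B. x + dirvec A \<notin> vbox y n}" using assms(1) by auto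
  show "z - dirvec A \<in> B - {x \<in> B. x + dirvec A \<notin> vbox y n}" if "z \<in> B - (B - vbox y n)" for z
  proof -
    have "z - dirvec A \<in> vbox y (Suc n)" using that by (cases A; cases z) (auto simp: vbox_def)
    then show ?thesis using that assms(2) by auto
  qed
  show "x + dirvec A \<in> B - (B - vbox y n)" if "x \<in> B - {x \<in> B. x + dirvec A \<notin> vbox y n}" for x
    using that assms(2) vbox_mono[of n "Suc n" y] by auto
  show "c (z - dirvec A) * walk_prob (z - y) n = 0" if "z \<in> B - vbox y n" for z
    using that by (simp add: walk_prob_outside)
  show "c x * walk_prob (x - y + dirvec A) n = 0" if "x \<in> {x \<in> B. x + dirvec A \<notin> vbox y n}" for x
    using that walk_prob_outside[of "x + dirvec A" y n] by (simp add: algebra_simps)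
qed (auto simp: algebra_simps)

lemma linear_chips_eq:
  assumes "finite B" "vbox y t \<subseteq> B"
  shows "linear_chips f0 t y = (\<Sum>z\<in>B. real (f0 z) * walk_prob (z - y) t)"
  using assms(2)
proof (induction t arbitrary: y)
  case 0
  then have "y \<in> B" by (auto simp: vbox_def)
  have "(\<Sum>z\<in>B. real (f0 z) * walk_prob (z - y) 0) = (\<Sum>z\<in>B. if z = y then real (f0 z) else 0)"
    by (intro sum.cong) (auto simp: walk_prob_eq bin_prob_zero prod_eq_iff)
  also have "\<dots> = real (f0 y)" using \<open>y \<in> B\<close> assms(1) by simp
  finally show ?case by simp
next
  case (Suc t)
  have sub: "vbox (y + dirvec A) t \<subseteq> B" for A
    using Suc.prems by (cases A; cases y) (fastforce simp: vbox_def)+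
  have "linear_chips f0 (Suc t) y =
      1 / 4 * (\<Sum>A\<in>UNIV. \<Sum>z\<in>B. real (f0 z) * walk_prob (z - (y + dirvec A)) t)"
    using Suc.IH[OF sub] by simp
  also have "\<dots> = (\<Sum>z\<in>B. real (f0 z) * ((\<Sum>A\<in>UNIV. walk_prob (z - (y + dirvec A)) t) / 4))"
    by (subst sum.swap) (simp add: sum_distrib_left sum_divide_distrib)
  also have "\<dots> = (\<Sum>z\<in>B. real (f0 z) * walk_prob (z - y) (Suc t))"
  proof (intro sum.cong refl arg_cong2[where f = "(*)"])
    fix z
    have "(\<Sum>A\<in>UNIV. walk_prob (z - (y + dirvec A)) t) = (\<Sum>A\<in>UNIV. walk_prob (y - z + dirvec A) t)"
      by (intro sum.cong refl) (metis minus_diff_eq walk_prob_uminus diff_add_eq)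
    then show "(\<Sum>A\<in>UNIV. walk_prob (z - (y + dirvec A)) t) / 4 = walk_prob (z - y) (Suc t)"
      using walk_prob_Suc[of "y - z" t] walk_prob_uminus[of "y - z" "Suc t"] by simp
  qed
  finally show ?case .
qed

lemma sum_card_dir:
  fixes h :: "dir \<Rightarrow> real" and n :: nat
  shows "(\<Sum>A\<in>UNIV. real (card {j. j < n \<and> d j = A}) * h A) = (\<Sum>j<n. h (d j))"
proof -
  have "(\<Sum>j<n. h (d j)) = (\<Sum>A\<in>UNIV. \<Sum>j\<in>{j \<in> {..<n}. d j = A}. h (d j))"
    by (rule sum.group[symmetric]) auto
  also have "\<dots> = (\<Sum>A\<in>UNIV. real (card {j. j < n \<and> d j = A}) * h A)"
    by (intro sum.cong) auto
  finally show ?thesis by simp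
qed

text \<open>The sum \<open>con\<close> for an arbitrary target \<open>y\<close>, with the chips
  grouped by the step in which they move. In this form it admits summation by parts in time.\<close>

definition contribution ::
  "(point \<Rightarrow> dir \<Rightarrow> dir) \<Rightarrow> (point \<Rightarrow> nat) \<Rightarrow> (point \<Rightarrow> dir) \<Rightarrow> point \<Rightarrow> nat \<Rightarrow> point \<Rightarrow> real" where
  "contribution R f0 a0 y T x =
     (\<Sum>s<T. \<Sum>j<chips R f0 a0 x s. influence (x - y) ((R x ^^ j) (rotor R f0 a0 x s)) (T - s))"

text \<open>Interpolation between the machines: \<open>G s\<close> is the expected number of chips
  on \<open>y\<close> at time \<open>T\<close> if the chips follow the rotors for \<open>s\<close>
  steps and walk at random afterwards. It runs from the linear machine at 0 to the Propp machine at
  \<open>T\<close>, and its increments are the influences of the chips moving in step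
  \<open>s\<close>.\<close>

theorem chips_minus_linear:
  assumes "finite B" "vbox y T \<subseteq> B"
  shows "real (chips R f0 a0 y T) - linear_chips f0 T y = (\<Sum>x\<in>B. contribution R f0 a0 y T x)"
proof -
  define G where "G s = (\<Sum>z\<in>B. real (chips R f0 a0 z s) * walk_prob (z - y) (T - s))" for s
  have step: "G (Suc s) - G s =
      (\<Sum>x\<in>B. \<Sum>j<chips R f0 a0 x s. influence (x - y) ((R x ^^ j) (rotor R f0 a0 x s)) (T - s))"
    if "s < T" for s
  proof -
    define n where "n = T - Suc s"
    have n: "T - s = Suc n" using that by (simp add: n_def)
    have sub: "vbox y (Suc n) \<subseteq> B" using order.trans[OF vbox_mono assms(2)] n by (metis diff_le_self)
    define c where "c A x = real (card {j. j < chips R f0 a0 x s \<and> (R x ^^ j) (rotor R f0 a0 x s) = A})" for A x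
    have "G (Suc s) = (\<Sum>z\<in>B. (\<Sum>A\<in>UNIV. c A (z - dirvec A)) * walk_prob (z - y) n)"
      by (simp add: G_def chips_Suc c_def n_def)
    also have "\<dots> = (\<Sum>A\<in>UNIV. \<Sum>z\<in>B. c A (z - dirvec A) * walk_prob (z - y) n)"
      by (subst sum.swap) (simp add: sum_distrib_right)
    also have "\<dots> = (\<Sum>A\<in>UNIV. \<Sum>x\<in>B. c A x * walk_prob (x - y + dirvec A) n)"
      by (intro sum.cong refl sum_shift_dirvec assms sub)
    also have "\<dots> = (\<Sum>x\<in>B. \<Sum>A\<in>UNIV. c A x * walk_prob (x - y + dirvec A) n)"
      by (rule sum.swap)
    also have "\<dots> = (\<Sum>x\<in>B. \<Sum>j<chips R f0 a0 x s. walk_prob (x - y + dirvec ((R x ^^ j) (rotor R f0 a0 x s))) n)"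
      unfolding c_def by (subst sum_card_dir) (rule refl)
    finally have "G (Suc s) = \<dots>" .
    moreover have "G s = (\<Sum>x\<in>B. \<Sum>j<chips R f0 a0 x s. walk_prob (x - y) (Suc n))"
      by (simp add: G_def n)
    ultimately show ?thesis by (simp add: influence_def n sum_subtractf)
  qed
  have yB: "y \<in> B" using assms(2) by (cases y) (auto simp: vbox_def)
  have "G T = (\<Sum>z\<in>B. if z = y then real (chips R f0 a0 z T) else 0)"
    unfolding G_def by (intro sum.cong) (auto simp: walk_prob_eq bin_prob_zero prod_eq_iff)
  also have "\<dots> = real (chips R f0 a0 y T)" using yB assms(1) by simp
  finally have "G T = real (chips R f0 a0 y T)" .
  moreover have "G 0 = linear_chips f0 T y"
    by (simp add: G_def linear_chips_eq[OF assms])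
  moreover have "G T - G 0 = (\<Sum>s<T. G (Suc s) - G s)"
    by (simp add: sum_lessThan_telescope)
  ultimately have "real (chips R f0 a0 y T) - linear_chips f0 T y =
      (\<Sum>s<T. \<Sum>x\<in>B. \<Sum>j<chips R f0 a0 x s. influence (x - y) ((R x ^^ j) (rotor R f0 a0 x s)) (T - s))"
    using step by simp
  then show ?thesis unfolding contribution_def by (subst (asm) sum.swap)
qed

section \<open>Prescribing the chip numbers modulo 4\<close>

lemma rotor_sequence_cases:
  assumes "rotor_sequence N"
  shows "(N NE, N SE, N SW, N NW) \<in>
    {(SE, SW, NW, NE), (NW, NE, SE, SW), (SE, NW, NE, SW),
     (SW, NE, NW, SE), (NW, SW, NE, SE), (SW, NW, SE, NE)}"
proof -
  have inj: "inj N" and cyc: "\<And>A. orbit N A = UNIV"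
    using assms by (auto simp: rotor_sequence_def permutes_inj cyclic_on_alldef)
  \<comment> \<open>A set that \<open>N\<close> maps into itself and that the orbit enters is
    everything. A fixed point or a 2-cycle would give such a set with at most two elements; what
    remains are the six 4-cycles.\<close>
  have closed: "S = UNIV" if "N A \<in> S" "\<And>B. B \<in> S \<Longrightarrow> N B \<in> S" for A S
  proof -
    have "B \<in> S" if "B \<in> orbit N A" for B
      using that by induction (use \<open>N A \<in> S\<close> \<open>\<And>B. B \<in> S \<Longrightarrow> N B \<in> S\<close> in auto)
    then show ?thesis using cyc by auto
  qed
  have fix1: "N A \<noteq> A" for A
  proof
    assume "N A = A"
    then have "{A} = UNIV" by (intro closed[of A]) auto
    then show False by (cases A) (auto simp: UNIV_dir)
  qed
  have fix2: "N (N A) \<noteq> A" for A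
  proof
    assume "N (N A) = A"
    then have "{A, N A} = UNIV" by (intro closed[of A]) auto
    then have "card (UNIV :: dir set) \<le> 2" by (metis card_2_iff card_insert_le_m1 card.empty card.insert finite.intros card_insert_if le_refl one_le_numeral insert_absorb2 is_singletonI is_singleton_altdef)
    then show False by (simp add: UNIV_dir)
  qed
  have ne: "N A \<noteq> N B" if "A \<noteq> B" for A B
    using inj that by (auto dest: injD)
  show ?thesis
    using fix1[of NE] fix1[of SE] fix1[of SW] fix1[of NW] fix2[of NE] fix2[of SE] fix2[of SW] fix2[of NW]
      ne[of NE SE] ne[of NE SW] ne[of NE NW] ne[of SE SW] ne[of SE NW] ne[of SW NW]
    by (cases "N NE"; simp?; cases "N SE"; simp?; cases "N SW"; simp?; cases "N NW"; simp?)
qed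

lemma rotor_period:
  assumes "rotor_sequence N"
  shows "(N ^^ (n + 4)) A = (N ^^ n) A"
proof -
  have "N (N (N (N A))) = A" for A
    using rotor_sequence_cases[OF assms] by (cases A) auto
  then show ?thesis
    by (simp add: funpow_add eval_nat_numeral)
qed

lemma rotor_period_mod:
  assumes "rotor_sequence N"
  shows "(N ^^ (n mod 4)) A = (N ^^ n) A"
proof (induction n rule: less_induct)
  case (less n)
  show ?case
  proof (cases "n < 4")
    case False
    then have "(N ^^ ((n - 4) mod 4)) A = (N ^^ (n - 4)) A" by (intro less) auto
    then show ?thesis
      using rotor_period[OF assms, of "n - 4" A] False by (simp add: le_mod_geq)
  qed simp
qed

lemma rotor_reach:
  assumes "rotor_sequence N"
  shows "\<exists>n. (N ^^ n) A = B"
proof -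
  have "\<exists>n\<in>{0, 1, 2, 3}. (N ^^ n) A = B"
    using rotor_sequence_cases[OF assms] by (cases A; cases B) (auto simp: eval_nat_numeral)
  then show ?thesis by blast
qed

lemma card_less_Suc: "card {j. j < Suc n \<and> P j} = card {j. j < n \<and> P j} + (if P n then 1 else 0)"
proof -
  have "{j. j < Suc n \<and> P j} = (if P n then insert n {j. j < n \<and> P j} else {j. j < n \<and> P j})"
    by (auto simp: less_Suc_eq)
  then show ?thesis by simp
qed

text \<open>Any four consecutive positions of a rotor are the four directions, each once.\<close>

lemma card_rotor_add:
  assumes "rotor_sequence N"
  shows "card {j. j < n + 4 * m \<and> (N ^^ j) d = A} = card {j. j < n \<and> (N ^^ j) d = A} + m"
proof (induction m)
  case (Suc m)
  define k where "k = n + 4 * m"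
  define e where "e = (N ^^ k) d"
  have one: "(if e = A then 1 else 0) + (if N e = A then 1 else 0) + (if N (N e) = A then 1 else 0) +
      (if N (N (N e)) = A then 1 else 0) = (1 :: nat)" for e
    using rotor_sequence_cases[OF assms] by (elim insertE; cases e; cases A; simp)
  have k: "n + 4 * Suc m = Suc (Suc (Suc (Suc k)))" by (simp add: k_def)
  have "card {j. j < Suc (Suc (Suc (Suc k))) \<and> (N ^^ j) d = A} = card {j. j < k \<and> (N ^^ j) d = A} + 1"
    unfolding card_less_Suc funpow.simps o_apply e_def[symmetric] using one[of e] by simp
  then show ?case using Suc.IH unfolding k by (simp add: k_def)
qed simp

text \<open>Every chip sends a copy in all four directions. Up to a power of 4 this is how piles
  move in the Propp machine as long as their sizes stay divisible by 4.\<close>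

primrec spread :: "(point \<Rightarrow> nat) \<Rightarrow> nat \<Rightarrow> point \<Rightarrow> nat" where
  "spread c 0 = c"
| "spread c (Suc t) = (\<lambda>x. \<Sum>A\<in>UNIV. spread c t (x - dirvec A))"

lemma spread_parity:
  assumes "even_config c" "\<not> same_parity x (int t)"
  shows "spread c t x = 0"
  using assms(2)
proof (induction t arbitrary: x)
  case 0
  then show ?case using assms(1) by (metis even_config_def of_nat_0 spread.simps(1))
next
  case (Suc t)
  have "spread c t (x - dirvec A) = 0" for A
    by (rule Suc.IH) (use Suc.prems in \<open>cases A; auto simp: same_parity_iff\<close>)
  then show ?case by simp
qed

lemma spread_add: "spread (\<lambda>x. c x + d x) t x = spread c t x + spread d t x"
  by (induction t arbitrary: x) (simp_all add: sum.distrib)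

definition pile :: "point \<Rightarrow> nat \<Rightarrow> point \<Rightarrow> nat" where
  "pile z m = (\<lambda>x. if x = z then m else 0)"

lemma spread_pile_eq_0:
  assumes "fst x - fst z > int t \<or> snd x - snd z > int t"
  shows "spread (pile z m) t x = 0"
  using assms
proof (induction t arbitrary: x)
  case (Suc t)
  have "spread (pile z m) t (x - dirvec A) = 0" for A
    by (rule Suc.IH) (use Suc.prems in \<open>cases A; auto\<close>)
  then show ?case by simp
qed (auto simp: pile_def)

text \<open>Only the path going \<open>NE\<close> all the time leads to the corner. Together with
  \<open>spread_pile_eq_0\<close> this makes the effect of piles triangular: a pile controls its
  corner and leaves everything beyond it alone.\<close>

lemma spread_pile_corner: "spread (pile z m) t (z + (int t, int t)) = m"
proof (induction t)
  case 0
  then show ?case by (cases z) (simp add: pile_def)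
next
  case (Suc t)
  have "z + (int (Suc t), int (Suc t)) - dirvec NE = z + (int t, int t)"
    by (cases z) simp
  with Suc.IH have NE: "spread (pile z m) t (z + (int (Suc t), int (Suc t)) - dirvec NE) = m"
    by (simp only:)
  have "spread (pile z m) t (z + (int (Suc t), int (Suc t)) - dirvec A) = 0" if "A \<noteq> NE" for A
    using that by (intro spread_pile_eq_0) (cases A; cases z; auto)
  then show ?case
    by (simp add: sum_dir NE del: dirvec.simps of_nat_Suc)
qed

text \<open>Adding a multiple of \<open>4 ^ k\<close> chips everywhere lets the surplus split evenly for \<open>k\<close> steps.\<close>

lemma chips_add_pow4:
  assumes R: "\<And>x. x \<in> V \<Longrightarrow> rotor_sequence (R x)"
    and f: "even_config f0" and c: "even_config c" and "t \<le> k"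
  shows "chips R (\<lambda>x. f0 x + 4 ^ k * c x) a0 x t = chips R f0 a0 x t + 4 ^ (k - t) * spread c t x \<and>
    rotor R (\<lambda>x. f0 x + 4 ^ k * c x) a0 x t = rotor R f0 a0 x t"
  using \<open>t \<le> k\<close>
proof (induction t arbitrary: x)
  case (Suc t)
  let ?f = "\<lambda>x. f0 x + 4 ^ k * c x"
  have pow: "4 ^ (k - t) = 4 * (4 :: nat) ^ (k - Suc t)"
    using Suc.prems by (metis Suc_diff_Suc Suc_le_eq power_Suc)
  have IH: "chips R ?f a0 x t = chips R f0 a0 x t + 4 * (4 ^ (k - Suc t) * spread c t x)"
    "rotor R ?f a0 x t = rotor R f0 a0 x t" for x
    using Suc by (simp_all add: pow)
  have V0: "chips R f0 a0 x t = 0" "spread c t x = 0" if "x \<notin> V" for x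
  proof -
    have "\<not> same_parity x (int t)" using that by (auto simp: same_parity_iff V_iff)
    then show "chips R f0 a0 x t = 0" "spread c t x = 0"
      using chips_parity[OF f] spread_parity[OF c] by auto
  qed
  have "card {j. j < chips R ?f a0 x t \<and> (R x ^^ j) (rotor R ?f a0 x t) = A} =
      card {j. j < chips R f0 a0 x t \<and> (R x ^^ j) (rotor R f0 a0 x t) = A} + 4 ^ (k - Suc t) * spread c t x" for x A
  proof (cases "x \<in> V")
    case True
    show ?thesis unfolding IH by (rule card_rotor_add[OF R[OF True]])
  next
    case False
    then show ?thesis unfolding IH by (simp add: V0)
  qed
  then have "chips R ?f a0 x (Suc t) = chips R f0 a0 x (Suc t) + 4 ^ (k - Suc t) * spread c (Suc t) x" for x
    by (simp add: chips_Suc sum.distrib sum_distrib_left)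
  moreover have "rotor R ?f a0 x (Suc t) = rotor R f0 a0 x (Suc t)"
  proof (cases "x \<in> V")
    case True
    have "(R x ^^ (n + 4 * m)) d = (R x ^^ n) d" for n m d
      by (metis rotor_period_mod[OF R[OF True]] mod_mult_self2)
    then show ?thesis unfolding rotor_Suc IH by simp
  next
    case False
    then show ?thesis unfolding rotor_Suc IH by (simp add: V0)
  qed
  ultimately show ?case by blast
qed simp

text \<open>A triangular system modulo 4. The ranking inserts the vertices by decreasing coordinate
  sum; the pile that corrects \<open>x\<close> has its corner at \<open>x\<close>, and a settled
  vertex, having at least the same coordinate sum, exceeds that corner in one coordinate.\<close>

lemma spread_residues:
  assumes "finite B" "\<And>x. x \<in> B \<Longrightarrow> same_parity x (int k)"
  shows "\<exists>c. even_config c \<and> (\<forall>x\<in>B. (b x + spread c k x) mod 4 = p x mod (4 :: nat))"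
  using assms
proof (induction B rule: finite_ranking_induct[where f = "\<lambda>x. - (fst x + snd x)"])
  case empty
  then show ?case by (intro exI[of _ "\<lambda>_. 0"]) (simp add: even_config_def)
next
  case (insert x S)
  then obtain c where c: "even_config c" "\<And>x. x \<in> S \<Longrightarrow> (b x + spread c k x) mod 4 = p x mod 4"
    by auto
  define z where "z = x - (int k, int k)"
  \<comment> \<open>As 3 is -1 modulo 4, this is the missing amount
    \<open>p x - (b x + spread c k x)\<close> without leaving the natural numbers.\<close>
  define m where "m = (p x + 3 * (b x + spread c k x)) mod 4"
  have x: "x = z + (int k, int k)" by (simp add: z_def)
  have "same_parity z 0"
    using insert.prems[of x] by (auto simp: z_def same_parity_iff)
  then have "even_config (\<lambda>x. c x + pile z m x)"
    using c(1) by (auto simp: even_config_def pile_def)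
  moreover have "(b y + spread (\<lambda>x. c x + pile z m x) k y) mod 4 = p y mod 4" if "y \<in> insert x S" for y
  proof (cases "y = x")
    case True
    have "spread (\<lambda>x. c x + pile z m x) k x = spread c k x + m"
      using spread_pile_corner[of z m k] by (simp add: spread_add flip: x)
    moreover have "(u + (v + (w + 3 * (u + v)) mod 4)) mod 4 = w mod 4" for u v w :: nat
    proof -
      have "(u + (v + (w + 3 * (u + v)) mod 4)) mod 4 = (w + 4 * (u + v)) mod 4"
        unfolding add.assoc[symmetric] mod_add_right_eq by (simp add: algebra_simps)
      then show ?thesis by (metis mod_mult_self2)
    qed
    ultimately show ?thesis using True by (simp add: m_def)
  next
    case False
    then have y: "y \<in> S" using that by auto
    then have "- (fst y + snd y) \<le> - (fst x + snd x)" using insert.hyps by blast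
    have "fst y - fst z > int k \<or> snd y - snd z > int k"
      using False \<open>- (fst y + snd y) \<le> _\<close> by (cases x; cases y) (auto simp: z_def)
    then show ?thesis using c(2)[OF y] by (simp add: spread_add spread_pile_eq_0)
  qed
  ultimately show ?case by blast
qed

text \<open>Induction on the number of prescribed times. Adding \<open>4 ^ T * c x\<close> chips
  changes the numbers before time \<open>T\<close> by multiples of 4 and the number at time
  \<open>T\<close> by exactly \<open>spread c T x\<close>, so the earlier residues survive while
  those at time \<open>T\<close> become free.\<close>

lemma chips_residues:
  assumes R: "\<And>x. x \<in> V \<Longrightarrow> rotor_sequence (R x)" and "finite B"
  shows "\<exists>f0. even_config f0 \<and>
    (\<forall>t<T. \<forall>x\<in>B. same_parity x (int t) \<longrightarrow> chips R f0 a0 x t mod 4 = p x t mod 4)"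
proof (induction T)
  case 0
  then show ?case by (intro exI[of _ "\<lambda>_. 0"]) (simp add: even_config_def)
next
  case (Suc T)
  then obtain f0 where f0: "even_config f0"
    "\<And>t x. t < T \<Longrightarrow> x \<in> B \<Longrightarrow> same_parity x (int t) \<Longrightarrow> chips R f0 a0 x t mod 4 = p x t mod 4"
    by blast
  have "\<exists>c. even_config c \<and> (\<forall>x\<in>{x\<in>B. same_parity x (int T)}.
      (chips R f0 a0 x T + spread c T x) mod 4 = p x T mod 4)"
    by (rule spread_residues) (use \<open>finite B\<close> in simp_all)
  then obtain c where c: "even_config c"
    "\<And>x. x \<in> B \<Longrightarrow> same_parity x (int T) \<Longrightarrow> (chips R f0 a0 x T + spread c T x) mod 4 = p x T mod 4"
    by blast
  let ?f = "\<lambda>x. f0 x + 4 ^ T * c x"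
  have "even_config ?f" using f0(1) c(1) by (auto simp: even_config_def)
  moreover have "chips R ?f a0 x t mod 4 = p x t mod 4"
    if "t < Suc T" "x \<in> B" "same_parity x (int t)" for t x
  proof (cases "t = T")
    case True
    then show ?thesis
      using chips_add_pow4[OF R f0(1) c(1), where t = T and k = T and x = x] c(2)[of x] that by simp
  next
    case False
    then have "t < T" using that by simp
    then have "(4 :: nat) ^ (T - t) = 4 * 4 ^ (T - Suc t)"
      by (metis Suc_diff_Suc power_Suc)
    then have "chips R ?f a0 x t = chips R f0 a0 x t + 4 * (4 ^ (T - Suc t) * spread c t x)"
      using chips_add_pow4[OF R f0(1) c(1), where t = t and k = T and x = x] \<open>t < T\<close> by simp
    then show ?thesis using f0(2)[OF \<open>t < T\<close>] that by simp
  qed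
  ultimately show ?case by blast
qed

text \<open>An arrow turns according to the number of departing chips modulo 4, so a prescribed
  course of the arrows is a prescription of residues. The hypothesis on \<open>e\<close> lets an
  arrow change only at times when its vertex can hold chips.\<close>

theorem arrow_forcing:
  assumes R: "\<And>x. x \<in> V \<Longrightarrow> rotor_sequence (R x)" and "finite B" "B \<subseteq> V"
    and e: "\<And>x t. x \<in> B \<Longrightarrow> \<not> same_parity x (int t) \<Longrightarrow> e x (Suc t) = e x t"
  shows "\<exists>f0. even_config f0 \<and> (\<forall>x\<in>B. \<forall>t\<le>T. rotor R f0 (\<lambda>x. e x 0) x t = e x t)"
proof -
  define p where "p x t = (SOME n. (R x ^^ n) (e x t) = e x (Suc t))" for x t
  have p: "(R x ^^ p x t) (e x t) = e x (Suc t)" if "x \<in> B" for x t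
    unfolding p_def by (rule someI_ex) (use rotor_reach R that \<open>B \<subseteq> V\<close> in blast)
  obtain f0 where f0: "even_config f0" "\<And>t x. t < T \<Longrightarrow> x \<in> B \<Longrightarrow> same_parity x (int t) \<Longrightarrow>
      chips R f0 (\<lambda>x. e x 0) x t mod 4 = p x t mod 4"
    using chips_residues[where R = R and B = B, OF R \<open>finite B\<close>, where T = T and ?a0.0 = "\<lambda>x. e x 0" and p = p] by blast
  have "rotor R f0 (\<lambda>x. e x 0) x t = e x t" if "x \<in> B" "t \<le> T" for x t
    using that(2)
  proof (induction t)
    case (Suc t)
    then have IH: "rotor R f0 (\<lambda>x. e x 0) x t = e x t" by simp
    have Rx: "rotor_sequence (R x)" using R that(1) \<open>B \<subseteq> V\<close> by blast
    show ?case
    proof (cases "same_parity x (int t)")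
      case True
      then have "chips R f0 (\<lambda>x. e x 0) x t mod 4 = p x t mod 4" using f0(2) Suc.prems that(1) by simp
      then show ?thesis unfolding rotor_Suc IH
        by (metis rotor_period_mod[OF Rx] p[OF that(1)])
    next
      case False
      then show ?thesis using chips_parity[OF f0(1) False] e[OF that(1) False]
        by (simp add: rotor_Suc IH)
    qed
  qed simp
  then show ?thesis using f0(1) by blast
qed

section \<open>Contributions as path lengths\<close>

text \<open>An antiderivative of the influence along the rotor cycle, as a function of the arrow and
  linear in the three moments. \<open>N NE\<close> and \<open>N SE\<close> together tell the six
  4-cycles apart; the last branch is the sixth. The antiderivative is fixed only up to a common
  linear form, which is immaterial along a closed path.\<close>

definition potential :: "(dir \<Rightarrow> dir) \<Rightarrow> dir \<Rightarrow> real \<times> real \<times> real \<Rightarrow> real" where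
  "potential N A = (\<lambda>(x, y, z).
     if N NE = SE \<and> N SE = SW then (case A of NE \<Rightarrow> x - z / 2 | SE \<Rightarrow> - y + z / 2 | SW \<Rightarrow> - x - z / 2 | NW \<Rightarrow> y + z / 2)
     else if N NE = NW \<and> N SE = NE then (case A of SE \<Rightarrow> x + z / 2 | NE \<Rightarrow> y - z / 2 | NW \<Rightarrow> - x + z / 2 | SW \<Rightarrow> - y - z / 2)
     else if N NE = SE \<and> N SE = NW then (case A of NE \<Rightarrow> x | SE \<Rightarrow> - y + z | NW \<Rightarrow> - x | SW \<Rightarrow> - y - z)
     else if N NE = SW \<and> N SE = NE then (case A of SE \<Rightarrow> x | NE \<Rightarrow> y - z | SW \<Rightarrow> - x | NW \<Rightarrow> y + z)
     else if N NE = NW \<and> N SE = SW then (case A of NE \<Rightarrow> y | NW \<Rightarrow> - x + z | SE \<Rightarrow> - y | SW \<Rightarrow> - x - z)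
     else (case A of NW \<Rightarrow> y | NE \<Rightarrow> x - z | SW \<Rightarrow> - y | SE \<Rightarrow> x + z))"

definition potential_max :: "(dir \<Rightarrow> dir) \<Rightarrow> real \<times> real \<times> real \<Rightarrow> real" where
  "potential_max N v = Max ((\<lambda>A. potential N A v) ` UNIV)"

lemma potential_le_max: "potential N A v \<le> potential_max N v"
  by (simp add: potential_max_def)

lemma potential_max_attained: "\<exists>A. potential N A v = potential_max N v"
proof -
  have "potential_max N v \<in> (\<lambda>A. potential N A v) ` UNIV"
    unfolding potential_max_def by (rule Max_in) auto
  then show ?thesis by auto
qed

lemma potential_add: "potential N A (u + v) = potential N A u + potential N A v"
  by (cases u; cases v; cases A) (simp_all add: potential_def add_divide_distrib)

lemma potential_uminus: "potential N A (- v) = - potential N A v"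
  by (cases v; cases A) (simp_all add: potential_def)

lemma potential_diff: "potential N A (u - v) = potential N A u - potential N A v"
  using potential_add[of N A u "- v"] by (simp add: potential_uminus)

lemma potential_0 [simp]: "potential N A 0 = 0"
  using potential_add[of N A 0 0] by simp

lemma potential_max_0 [simp]: "potential_max N 0 = 0"
  by (simp add: potential_max_def image_constant_conv)

lemma potential_max_add: "potential_max N (u + v) \<le> potential_max N u + potential_max N v"
proof -
  obtain A where "potential N A (u + v) = potential_max N (u + v)"
    using potential_max_attained by blast
  then show ?thesis using potential_le_max[of N A u] potential_le_max[of N A v] by (simp add: potential_add)
qed

definition influence_vec :: "point \<Rightarrow> nat \<Rightarrow> real \<times> real \<times> real" where
  "influence_vec x t = (of_int (fst x) * (walk_prob x t / t), of_int (snd x) * (walk_prob x t / t),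
     of_int (fst x * snd x) * (walk_prob x t / t\<^sup>2))"

text \<open>Division by zero makes the vector vanish at time 0. Thus the path starts at 0, and
  summation by parts leaves no boundary term there.\<close>

lemma influence_vec_0 [simp]: "influence_vec x 0 = 0"
  by (simp add: influence_vec_def zero_prod_def)

text \<open>Undoing one step multiplies each one-dimensional factor by \<open>1\<close> plus or
  minus coordinate over \<open>t\<close>. For the direction with signs \<open>d1\<close>,
  \<open>d2\<close> the product expands to \<open>H - d1 * xi - d2 * eta + d1 * d2 * zeta\<close>,
  and the three last terms sum to zero over the four directions, so they have an antiderivative
  along any 4-cycle.\<close>

lemma influence_potential:
  assumes "rotor_sequence N" "t > 0"
  shows "influence x A t = potential N (N A) (influence_vec x t) - potential N A (influence_vec x t)"
proof -
  define u where "u = real t"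
  have u: "u \<noteq> 0" using assms(2) by (simp add: u_def)
  have bp: "bin_prob (t - 1) (k - 1) = (1 + of_int k / u) * bin_prob t k"
    "bin_prob (t - 1) (k + 1) = (1 - of_int k / u) * bin_prob t k" for k
    using bin_prob_pred[of "t - 1" k] bin_prob_succ[of "t - 1" k] assms(2) u
    by (simp_all add: field_simps flip: u_def)
  define p q where "p = bin_prob t (fst x)" and "q = bin_prob t (snd x)"
  define H where "H = walk_prob x t"
  have H: "H = p * q" by (simp add: H_def p_def q_def walk_prob_eq)
  define a b :: real where "a = of_int (fst x)" and "b = of_int (snd x)"
  define xi eta zeta where "xi = a * (H / u)" and "eta = b * (H / u)" and "zeta = a * b * (H / u\<^sup>2)"
  have "influence x A t = (case A of NE \<Rightarrow> (1 - a / u) * p * ((1 - b / u) * q) - H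
      | SE \<Rightarrow> (1 - a / u) * p * ((1 + b / u) * q) - H
      | SW \<Rightarrow> (1 + a / u) * p * ((1 + b / u) * q) - H | NW \<Rightarrow> (1 + a / u) * p * ((1 - b / u) * q) - H)"
    using bp(1)[of "fst x"] bp(1)[of "snd x"] bp(2)[of "fst x"] bp(2)[of "snd x"]
    by (cases A) (simp_all add: influence_def H walk_prob_eq flip: p_def q_def a_def b_def)
  also have "\<dots> = (case A of NE \<Rightarrow> - xi - eta + zeta | SE \<Rightarrow> - xi + eta - zeta
      | SW \<Rightarrow> xi + eta + zeta | NW \<Rightarrow> xi - eta - zeta)"
    using u by (cases A) (simp_all add: H xi_def eta_def zeta_def field_simps power2_eq_square)
  finally have "influence x A t = (case A of NE \<Rightarrow> - xi - eta + zeta | SE \<Rightarrow> - xi + eta - zeta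
      | SW \<Rightarrow> xi + eta + zeta | NW \<Rightarrow> xi - eta - zeta)" .
  moreover have "influence_vec x t = (xi, eta, zeta)"
    by (simp add: influence_vec_def xi_def eta_def zeta_def H_def u_def a_def b_def)
  ultimately show ?thesis
    using rotor_sequence_cases[OF assms(1)] by (elim insertE; cases A; simp add: potential_def)
qed

lemma sum_influence:
  assumes "rotor_sequence N" "t > 0"
  shows "(\<Sum>j<n. influence x ((N ^^ j) d) t) =
    potential N ((N ^^ n) d) (influence_vec x t) - potential N d (influence_vec x t)"
  by (induction n) (simp_all add: influence_potential[OF assms])

text \<open>At times of the wrong parity the vector keeps its previous value, so that its increments
  vanish there; the rotor does not move at these times either.\<close>

definition path_vec :: "point \<Rightarrow> nat \<Rightarrow> real \<times> real \<times> real" where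
  "path_vec x t = (if same_parity x (int t) then influence_vec x t else influence_vec x (t - 1))"

lemma path_vec_0 [simp]: "path_vec x 0 = 0"
  by (simp add: path_vec_def)

lemma path_vec_Suc:
  assumes "x \<in> V" "\<not> same_parity x (int (Suc t))"
  shows "path_vec x (Suc t) = path_vec x t"
proof -
  have "same_parity x (int t)" using assms by (auto simp: same_parity_iff V_iff)
  then show ?thesis using assms by (simp add: path_vec_def)
qed

text \<open>The last summand closes the path at 0; it is the share of the initial arrow.\<close>

definition path_length :: "(dir \<Rightarrow> dir) \<Rightarrow> point \<Rightarrow> nat \<Rightarrow> real" where
  "path_length N x T = (\<Sum>t<T. potential_max N (path_vec x (Suc t) - path_vec x t)) + potential_max N (- path_vec x T)"

text \<open>The influence depends on the remaining time, so the sum over steps is reversed: the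
  difference in the arrow \<open>d\<close> becomes a difference in the time argument of
  \<open>P\<close>, each taken at a single arrow.\<close>

lemma sum_by_parts:
  fixes P :: "nat \<Rightarrow> 'a \<Rightarrow> real"
  assumes "\<And>A. P 0 A = 0"
  shows "(\<Sum>s<T. P (T - s) (d (Suc s)) - P (T - s) (d s)) =
    (\<Sum>t<T. P (Suc t) (d (T - t)) - P t (d (T - t))) - P T (d 0)"
proof -
  have "(\<Sum>s<T. P (T - s) (d (Suc s)) - P (T - s) (d s)) =
      (\<Sum>t<T. P (Suc t) (d (T - t)) - P (Suc t) (d (T - Suc t)))"
    by (subst sum.nat_diff_reindex[symmetric]) (auto intro!: sum.cong simp: Suc_diff_Suc)
  moreover have "(\<Sum>t<T. P (Suc t) (d (T - Suc t))) = (\<Sum>t<T. P t (d (T - t))) + P T (d 0)"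
    using sum.lessThan_Suc_shift[of "\<lambda>t. P t (d (T - t))" T] assms by simp
  ultimately show ?thesis by (simp add: sum_subtractf)
qed

lemma contribution_by_parts:
  assumes "rotor_sequence (R x)" "even_config f0" "same_parity y (int T)"
  shows "contribution R f0 a0 y T x =
    (\<Sum>t<T. potential (R x) (rotor R f0 a0 x (T - t)) (path_vec (x - y) (Suc t) - path_vec (x - y) t))
    + potential (R x) (a0 x) (- path_vec (x - y) T)"
proof -
  define P where "P t A = potential (R x) A (path_vec (x - y) t)" for t A
  have "(\<Sum>j<chips R f0 a0 x s. influence (x - y) ((R x ^^ j) (rotor R f0 a0 x s)) (T - s)) =
      P (T - s) (rotor R f0 a0 x (Suc s)) - P (T - s) (rotor R f0 a0 x s)" if "s < T" for s
  proof (cases "same_parity x (int s)")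
    case True
    then have "same_parity (x - y) (int (T - s))"
      using assms(3) that by (auto simp: same_parity_iff of_nat_diff)
    then show ?thesis
      using sum_influence[OF assms(1), of "T - s"] that by (simp add: P_def path_vec_def rotor_Suc)
  next
    case False
    then show ?thesis using chips_parity[OF assms(2) False] by (simp add: rotor_Suc)
  qed
  then have "contribution R f0 a0 y T x =
      (\<Sum>s<T. P (T - s) (rotor R f0 a0 x (Suc s)) - P (T - s) (rotor R f0 a0 x s))"
    by (simp add: contribution_def)
  also have "\<dots> = (\<Sum>t<T. P (Suc t) (rotor R f0 a0 x (T - t)) - P t (rotor R f0 a0 x (T - t))) - P T (a0 x)"
    using sum_by_parts[of P T "rotor R f0 a0 x"] by (simp add: P_def)
  finally show ?thesis by (simp add: P_def potential_diff potential_uminus)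
qed

lemma contribution_le_path_length:
  assumes "rotor_sequence (R x)" "even_config f0" "same_parity y (int T)"
  shows "contribution R f0 a0 y T x \<le> path_length (R x) (x - y) T"
  unfolding contribution_by_parts[where R = R and x = x, OF assms] path_length_def
  by (intro add_mono sum_mono potential_le_max)

lemma contribution_ge_path_length:
  assumes "rotor_sequence (R x)" "even_config f0" "same_parity y (int T)"
  shows "- contribution R f0 a0 y T x \<le>
    (\<Sum>t<T. potential_max (R x) (- (path_vec (x - y) (Suc t) - path_vec (x - y) t))) +
    potential_max (R x) (path_vec (x - y) T)"
proof -
  have "- potential (R x) A v \<le> potential_max (R x) (- v)" for A v
    using potential_le_max[of "R x" A "- v"] by (simp add: potential_uminus)
  moreover from this[of _ "- v" for v] have "- potential (R x) A (- v) \<le> potential_max (R x) v" for A v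
    by simp
  ultimately show ?thesis
    unfolding contribution_by_parts[where R = R and x = x, OF assms] minus_add_distrib sum_negf[symmetric]
    by (intro add_mono sum_mono)
qed

lemma contribution_parity:
  assumes "even_config f0" "\<not> same_parity y (int T)" "y \<in> V"
  shows "contribution R f0 a0 y T x = 0"
proof -
  have "influence (x - y) A (T - s) = 0" if "s < T" "same_parity x (int s)" for s A
  proof -
    have "\<not> same_parity (x - y) (int (T - s))"
      using assms(2,3) that by (auto simp: same_parity_iff of_nat_diff V_iff)
    moreover from this have "\<not> same_parity (x - y + dirvec A) (int (T - s - 1))"
      using \<open>s < T\<close> by (cases A) (auto simp: same_parity_iff of_nat_diff)
    ultimately show ?thesis by (simp add: influence_def walk_prob_def)
  qed
  moreover have "chips R f0 a0 x s = 0" if "\<not> same_parity x (int s)" for s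
    using chips_parity[OF assms(1) that] .
  ultimately have "(\<Sum>j<chips R f0 a0 x s. influence (x - y) ((R x ^^ j) (rotor R f0 a0 x s)) (T - s)) = 0"
    if "s < T" for s
    using that by (cases "same_parity x (int s)") auto
  then show ?thesis by (simp add: contribution_def)
qed

lemma contribution_outside:
  assumes "even_config f0" "x \<notin> V"
  shows "contribution R f0 a0 y T x = 0"
proof -
  have "chips R f0 a0 x s = 0" for s
    by (rule chips_parity[OF assms(1)]) (use assms(2) in \<open>auto simp: same_parity_iff V_iff\<close>)
  then show ?thesis by (simp add: contribution_def)
qed

theorem path_length_attained:
  assumes R: "\<And>x. x \<in> V \<Longrightarrow> rotor_sequence (R x)" and T: "same_parity y (int T)" and B: "finite B" "B \<subseteq> V"
  shows "\<exists>f0 a0. even_config f0 \<and> (\<forall>x\<in>B. contribution R f0 a0 y T x = path_length (R x) (x - y) T)"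
proof -
  have yV: "y \<in> V" using T by (auto simp: same_parity_iff V_iff)
  define best where "best x v = (SOME A. potential (R x) A v = potential_max (R x) v)" for x v
  have best: "potential (R x) (best x v) v = potential_max (R x) v" for x v
    unfolding best_def by (rule someI_ex) (rule potential_max_attained)
  \<comment> \<open>The initial arrow serves the closing segment. The arrow set in step
    \<open>s\<close> is the one in force at time \<open>s + 1\<close>, which by
    \<open>contribution_by_parts\<close> is paired with the increment between the remaining times
    \<open>T - s - 1\<close> and \<open>T - s\<close>.\<close>
  define e where "e x = rec_nat (best x (- path_vec (x - y) T))
     (\<lambda>s A. if same_parity x (int s) then best x (path_vec (x - y) (T - s) - path_vec (x - y) (T - Suc s)) else A)" for x
  have e0: "e x 0 = best x (- path_vec (x - y) T)"
    and eS: "e x (Suc s) = (if same_parity x (int s) then best x (path_vec (x - y) (T - s) - path_vec (x - y) (T - Suc s)) else e x s)"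
    for x s by (simp_all add: e_def)
  have "\<exists>f0. even_config f0 \<and> (\<forall>x\<in>B. \<forall>t\<le>T. rotor R f0 (\<lambda>x. e x 0) x t = e x t)"
    by (rule arrow_forcing[OF R B]) (simp_all add: eS)
  then obtain f0 where f0: "even_config f0"
    "\<And>x t. x \<in> B \<Longrightarrow> t \<le> T \<Longrightarrow> rotor R f0 (\<lambda>x. e x 0) x t = e x t" by blast
  have "contribution R f0 (\<lambda>x. e x 0) y T x = path_length (R x) (x - y) T" if "x \<in> B" for x
  proof -
    have xV: "x \<in> V" using that B by blast
    have "potential (R x) (rotor R f0 (\<lambda>x. e x 0) x (T - t)) (path_vec (x - y) (Suc t) - path_vec (x - y) t) =
        potential_max (R x) (path_vec (x - y) (Suc t) - path_vec (x - y) t)" if "t < T" for t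
    proof (cases "same_parity x (int (T - Suc t))")
      case True
      have "T - t = Suc (T - Suc t)" using that by simp
      then have "e x (T - t) = best x (path_vec (x - y) (Suc t) - path_vec (x - y) t)"
        using True eS[of x "T - Suc t"] that by simp
      then show ?thesis using best f0(2)[OF \<open>x \<in> B\<close>, of "T - t"] by simp
    next
      case False
      then have "\<not> same_parity (x - y) (int (Suc t))"
        using T that by (auto simp: same_parity_iff of_nat_diff)
      moreover have "x - y \<in> V" using xV yV by (auto simp: V_iff)
      ultimately show ?thesis using path_vec_Suc[of "x - y" t] by simp
    qed
    then show ?thesis
      unfolding contribution_by_parts[where R = R and x = x, OF R[OF xV] f0(1) T] path_length_def
      by (simp add: e0 best)
  qed
  then show ?thesis using f0(1) by blast
qed

text \<open>With \<open>c s\<close> chips having left \<open>x\<close> before step \<open>s\<close>,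
  chip \<open>i\<close> leaves in the step \<open>s\<close> for which
  \<open>c s <= i < c (s + 1)\<close>, and the arrow it meets is that of the step advanced
  \<open>i - c s\<close> times.\<close>

lemma con_eq_contribution: "con R f0 a0 T x = contribution R f0 a0 (0, 0) T x"
proof -
  define c where "c s = (\<Sum>t<s. chips R f0 a0 x t)" for s
  have c_mono: "c s \<le> c u" if "s \<le> u" for s u
    unfolding c_def using that by (intro sum_mono2) auto
  have at_most: "(\<Sum>t\<le>u. chips R f0 a0 x t) = c (Suc u)" for u
    by (simp add: c_def lessThan_Suc_atMost)
  have time: "chip_time R f0 a0 x i = enat s" if "c s \<le> i" "i < c (Suc s)" for i s
  proof -
    have "(LEAST u. i < c (Suc u)) = s"
    proof (rule Least_equality)
      show "s \<le> u" if "i < c (Suc u)" for u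
        using that \<open>c s \<le> i\<close> c_mono[of "Suc u" s] by (cases "s \<le> u") auto
    qed (use that in simp)
    then show ?thesis using that by (auto simp: chip_time_def at_most)
  qed
  have time_iff: "chip_time R f0 a0 x i < enat T \<longleftrightarrow> i < c T" for i
  proof
    assume "i < c T"
    then have "\<exists>s<T. c s \<le> i \<and> i < c (Suc s)"
    proof (induction T)
      case (Suc T)
      then show ?case by (cases "i < c T") (auto intro: less_SucI)
    qed (simp add: c_def)
    then show "chip_time R f0 a0 x i < enat T" using time by auto
  next
    assume *: "chip_time R f0 a0 x i < enat T"
    then have ex: "\<exists>u. i < c (Suc u)" by (auto simp: chip_time_def at_most split: if_splits)
    then have "i < c (Suc (LEAST u. i < c (Suc u)))" by (rule LeastI_ex)
    moreover have "Suc (LEAST u. i < c (Suc u)) \<le> T" using * ex by (simp add: chip_time_def at_most Suc_le_eq)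
    ultimately show "i < c T" using c_mono order_less_le_trans by blast
  qed
  define F where "F i = influence x ((R x ^^ i) (a0 x)) (T - the_enat (chip_time R f0 a0 x i))" for i
  have add: "(\<Sum>i<m + n. F i) = (\<Sum>i<m. F i) + (\<Sum>j<n. F (m + j))" for m n
    by (induction n) (simp_all add: add.assoc)
  have "(\<Sum>i<c S. F i) = (\<Sum>s<S. \<Sum>j<chips R f0 a0 x s. F (c s + j))" for S
  proof (induction S)
    case (Suc S)
    have "c (Suc S) = c S + chips R f0 a0 x S" by (simp add: c_def)
    then show ?case using Suc by (simp add: add)
  qed (simp add: c_def)
  moreover have "F (c s + j) = influence x ((R x ^^ j) (rotor R f0 a0 x s)) (T - s)"
    if "j < chips R f0 a0 x s" for s j
    using time[of s "c s + j"] that by (simp add: F_def c_def rotor_eq funpow_add add.commute)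
  ultimately have "(\<Sum>i<c T. F i) = contribution R f0 a0 (0, 0) T x"
    by (simp add: contribution_def zero_prod_def[symmetric])
  moreover have "{i. chip_time R f0 a0 x i < enat T} = {..<c T}" using time_iff by auto
  ultimately show ?thesis by (simp add: con_def F_def)
qed


section \<open>Support functions of the six rotor sequences\<close>

primrec support :: "nat \<Rightarrow> real \<times> real \<times> real \<Rightarrow> real" where
  "support 0 = (\<lambda>(x, y, z). max (\<bar>x\<bar> - z / 2) (\<bar>y\<bar> + z / 2))"
| "support (Suc k) = (\<lambda>(x, y, z).
     if k = 0 then max (\<bar>x\<bar> + z / 2) (\<bar>y\<bar> - z / 2)
     else if k = 1 then max \<bar>x\<bar> (\<bar>z\<bar> - y)
     else if k = 2 then max \<bar>x\<bar> (\<bar>z\<bar> + y)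
     else if k = 3 then max \<bar>y\<bar> (\<bar>z\<bar> - x)
     else max \<bar>y\<bar> (\<bar>z\<bar> + x))"

lemma support_simps:
  "support 0 (x, y, z) = max (\<bar>x\<bar> - z / 2) (\<bar>y\<bar> + z / 2)"
  "support 1 (x, y, z) = max (\<bar>x\<bar> + z / 2) (\<bar>y\<bar> - z / 2)"
  "support (Suc 0) (x, y, z) = max (\<bar>x\<bar> + z / 2) (\<bar>y\<bar> - z / 2)"
  "support 2 (x, y, z) = max \<bar>x\<bar> (\<bar>z\<bar> - y)"
  "support 3 (x, y, z) = max \<bar>x\<bar> (\<bar>z\<bar> + y)"
  "support 4 (x, y, z) = max \<bar>y\<bar> (\<bar>z\<bar> - x)"
  "support 5 (x, y, z) = max \<bar>y\<bar> (\<bar>z\<bar> + x)"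
  by (simp_all add: eval_nat_numeral)

lemma less_6_iff: "k < 6 \<longleftrightarrow> k \<in> {0, 1, 2, 3, 4, 5 :: nat}"
  by auto

text \<open>Of the indices, 0 and 1 are the two circular sequences; 2, 3 and 4, 5 are the
  non-circular ones, the second pair being the first with the coordinates exchanged.\<close>

lemma potential_max_support:
  "potential_max N v = support
    (if N NE = SE \<and> N SE = SW then 0 else if N NE = NW \<and> N SE = NE then 1
     else if N NE = SE \<and> N SE = NW then 2 else if N NE = SW \<and> N SE = NE then 3
     else if N NE = NW \<and> N SE = SW then 4 else 5) v"
proof -
  obtain x y z where v: "v = (x, y, z)" by (cases v)
  have M: "potential_max N v = max (max (potential N NE v) (potential N SE v))
      (max (potential N SW v) (potential N NW v))"
    by (simp add: potential_max_def UNIV_dir max.assoc)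
  show ?thesis
    unfolding v M[unfolded v] potential_def
    by (cases "N NE"; cases "N SE"; auto simp: support_simps max_def abs_if)
qed

lemma circular_rotor_iff:
  assumes "rotor_sequence N"
  shows "circular_rotor N \<longleftrightarrow> N NE = SE \<and> N SE = SW \<or> N NE = NW \<and> N SE = NE"
  using rotor_sequence_cases[OF assms]
  by (elim insertE) (auto simp: circular_rotor_def rotor_tuple_def eval_nat_numeral)

lemma rotor_support:
  assumes "rotor_sequence N"
  shows "\<exists>k<6. potential_max N = support k \<and> (circular_rotor N \<longleftrightarrow> k < 2)"
proof -
  define k :: nat where "k = (if N NE = SE \<and> N SE = SW then 0 else if N NE = NW \<and> N SE = NE then 1
     else if N NE = SE \<and> N SE = NW then 2 else if N NE = SW \<and> N SE = NE then 3
     else if N NE = NW \<and> N SE = SW then 4 else 5)"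
  have "potential_max N = support k"
    by (rule ext) (simp only: potential_max_support k_def)
  moreover have "k < 6" by (simp add: k_def)
  moreover have "circular_rotor N \<longleftrightarrow> k < 2"
    unfolding circular_rotor_iff[OF assms] by (simp add: k_def)
  ultimately show ?thesis by blast
qed

lemma rotor_sequenceI:
  assumes "N (N (N (N NE))) = NE" "{NE, N NE, N (N NE), N (N (N NE))} = UNIV"
  shows "rotor_sequence N"
proof -
  have "{NE, N NE, N (N NE), N (N (N NE))} \<subseteq> range N"
    using assms(1) by (metis empty_subsetI insert_subset rangeI)
  then have "surj N" using assms(2) by auto
  then have "bij N" by (simp add: bij_def finite_UNIV_surj_inj)
  then have "N permutes UNIV" by (intro bij_imp_permutes) auto
  moreover have "N NE \<in> orbit N NE" "N (N NE) \<in> orbit N NE" "N (N (N NE)) \<in> orbit N NE"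
    by (auto intro: orbit.intros)
  then have "{NE, N NE, N (N NE), N (N (N NE))} \<subseteq> orbit N NE"
    using orbit.step[of "N (N (N NE))" N NE] assms(1) by auto
  then have "orbit N NE = UNIV" using assms(2) by auto
  ultimately show ?thesis unfolding rotor_sequence_def cyclic_on_def by blast
qed

lemma support_rotor:
  assumes "k < 6"
  shows "\<exists>N. rotor_sequence N \<and> potential_max N = support k"
proof -
  have *: "\<exists>N. rotor_sequence N \<and> potential_max N = support k"
    if "p \<noteq> NE" "q \<notin> {NE, p}" "r \<notin> {NE, p, q}" and
      k: "k = (let N = (\<lambda>A. if A = NE then p else if A = p then q else if A = q then r else NE) in
       if N NE = SE \<and> N SE = SW then 0 else if N NE = NW \<and> N SE = NE then 1
       else if N NE = SE \<and> N SE = NW then 2 else if N NE = SW \<and> N SE = NE then 3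
       else if N NE = NW \<and> N SE = SW then 4 else 5)" for p q r k
  proof -
    define N where "N = (\<lambda>A. if A = NE then p else if A = p then q else if A = q then r else NE)"
    have "{NE, p, q, r} = UNIV"
      using that(1-3) by (cases p; cases q; cases r) (auto simp: UNIV_dir)
    then have "rotor_sequence N"
      using that by (intro rotor_sequenceI) (auto simp: N_def)
    moreover have "potential_max N = support k"
      unfolding k Let_def using potential_max_support[of N] by (simp add: N_def fun_eq_iff)
    ultimately show ?thesis by blast
  qed
  show ?thesis
    using assms *[of SE SW NW k] *[of NW SW SE k] *[of SE NW SW k] *[of SW NW SE k] *[of NW SE SW k] *[of SW SE NW k]
    by (auto simp: less_6_iff)
qed

text \<open>Bounding the discrepancy from below means reversing the path. The reflected support
  function is again one of the six, and this is its index.\<close>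

definition dual :: "nat \<Rightarrow> nat" where
  "dual k = (if k < 2 then 1 - k else if k < 4 then 5 - k else 9 - k)"

lemma support_uminus: "k < 6 \<Longrightarrow> support k (- v) = support (dual k) v"
  by (cases v) (auto simp: less_6_iff dual_def support_simps)

lemma support_flip_x: "k < 6 \<Longrightarrow> support k (- x, y, - z) = support (if k < 2 then 1 - k else if k < 4 then k else 9 - k) (x, y, z)"
  by (auto simp: less_6_iff support_simps)

lemma support_flip_y: "k < 6 \<Longrightarrow> support k (x, - y, - z) = support (if k < 2 then 1 - k else if k < 4 then 5 - k else k) (x, y, z)"
  by (auto simp: less_6_iff support_simps)

lemma support_swap: "k < 6 \<Longrightarrow> support k (y, x, z) = support (if k < 2 then 1 - k else if k < 4 then k + 2 else k - 2) (x, y, z)"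
  by (auto simp: less_6_iff support_simps max.commute)

lemma support_add: "k < 6 \<Longrightarrow> support k (u + v) \<le> support k u + support k v"
  using support_rotor[of k] potential_max_add by metis

lemma support_0 [simp]: "k < 6 \<Longrightarrow> support k 0 = 0"
  by (auto simp: less_6_iff support_simps zero_prod_def)

definition support_length :: "nat \<Rightarrow> point \<Rightarrow> nat \<Rightarrow> real" where
  "support_length k x T = (\<Sum>t<T. support k (path_vec x (Suc t) - path_vec x t)) + support k (- path_vec x T)"

lemma abs_contribution_le:
  assumes "rotor_sequence (R x)" "even_config f0" "same_parity y (int T)"
    "k < 6" "potential_max (R x) = support k"
  shows "contribution R f0 a0 y T x \<le> support_length k (x - y) T"
    "- contribution R f0 a0 y T x \<le> support_length (dual k) (x - y) T"
proof -
  show "contribution R f0 a0 y T x \<le> support_length k (x - y) T"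
    using contribution_le_path_length[where R = R and x = x, OF assms(1-3)] assms(5)
    by (simp add: path_length_def support_length_def)
  have d: "support (dual k) v = support k (- v)" for v using support_uminus[OF assms(4)] by simp
  show "- contribution R f0 a0 y T x \<le> support_length (dual k) (x - y) T"
    using contribution_ge_path_length[where R = R and x = x, OF assms(1-3)] assms(5)
    by (simp add: d support_length_def)
qed

text \<open>A longer run replaces the closing segment by two segments with the same sum, so the
  triangle inequality applies.\<close>

lemma support_length_mono:
  assumes "k < 6" "S \<le> T"
  shows "support_length k x S \<le> support_length k x T"
proof (rule lift_Suc_mono_le[OF _ assms(2)])
  fix T
  have "support k (- path_vec x T) = support k ((path_vec x (Suc T) - path_vec x T) + (- path_vec x (Suc T)))"
    by simp
  also have "\<dots> \<le> support k (path_vec x (Suc T) - path_vec x T) + support k (- path_vec x (Suc T))"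
    by (rule support_add[OF assms(1)])
  finally show "support_length k x T \<le> support_length k x (Suc T)" by (simp add: support_length_def)
qed

lemma support_length_nonneg: "k < 6 \<Longrightarrow> 0 \<le> support_length k x T"
  using support_length_mono[of k 0 T x] by (simp add: support_length_def)

text \<open>The length of the polygon from \<open>v\<close> through the sampled points back to
  0.\<close>

fun chain_length :: "nat \<Rightarrow> ('a \<Rightarrow> real \<times> real \<times> real) \<Rightarrow> real \<times> real \<times> real \<Rightarrow> 'a list \<Rightarrow> real" where
  "chain_length k w v [] = support k (- v)"
| "chain_length k w v (t # ts) = support k (w t - v) + chain_length k w (w t) ts"

lemma support_telescope:
  assumes "k < 6" "s \<le> t"
  shows "support k (w t - w s) \<le> (\<Sum>i=s..<t. support k (w (Suc i) - w i))"
  using assms(2)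
proof (induction t rule: dec_induct)
  case (step t)
  have "support k (w (Suc t) - w s) = support k ((w (Suc t) - w t) + (w t - w s))" by simp
  also have "\<dots> \<le> support k (w (Suc t) - w t) + support k (w t - w s)"
    by (rule support_add[OF assms(1)])
  finally show ?case using step by simp
qed (use assms in simp)

text \<open>Sampling the path at fewer times shortens it, by sublinearity of the support functions.\<close>

lemma chain_length_le:
  assumes "k < 6" "sorted_wrt (<) (s # ts)" "\<forall>t\<in>set (s # ts). t \<le> T"
  shows "chain_length k w (w s) ts \<le> (\<Sum>i=s..<T. support k (w (Suc i) - w i)) + support k (- w T)"
  using assms(2,3)
proof (induction ts arbitrary: s)
  case Nil
  have "support k (- w s) = support k ((w T - w s) + (- w T))" by simp
  also have "\<dots> \<le> support k (w T - w s) + support k (- w T)" by (rule support_add[OF assms(1)])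
  finally show ?case using support_telescope[OF assms(1), of s T w] Nil by simp
next
  case (Cons t ts)
  have "(\<Sum>i=s..<T. support k (w (Suc i) - w i)) =
      (\<Sum>i=s..<t. support k (w (Suc i) - w i)) + (\<Sum>i=t..<T. support k (w (Suc i) - w i))"
    by (rule sum.atLeastLessThan_concat[symmetric]) (use Cons.prems in auto)
  moreover have "chain_length k w (w t) ts \<le> (\<Sum>i=t..<T. support k (w (Suc i) - w i)) + support k (- w T)"
    by (rule Cons.IH) (use Cons.prems in auto)
  ultimately show ?case using support_telescope[OF assms(1), of s t w] Cons.prems by simp
qed

lemma chain_length_le_support_length:
  assumes "k < 6" "sorted_wrt (<) ts" "\<forall>t\<in>set ts. 0 < t \<and> t \<le> T \<and> same_parity x (int t)"
  shows "chain_length k (influence_vec x) 0 ts \<le> support_length k x T"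
proof -
  have "chain_length k (path_vec x) (path_vec x 0) ts \<le> support_length k x T"
    using chain_length_le[OF assms(1), of 0 ts T "path_vec x"] assms(2,3)
    by (simp add: support_length_def lessThan_atLeast0)
  moreover have "chain_length k (path_vec x) v ts = chain_length k (influence_vec x) v ts" for v
    using assms(3) by (induction ts arbitrary: v) (auto simp: path_vec_def)
  ultimately show ?thesis by simp
qed

section \<open>Binomial probabilities\<close>

text \<open>The quotient is exp (-2 artanh z), and 2 artanh z = 2 z + 2/3 z^3 + ... . The
  coefficient 7/10, slightly above 2/3, suffices up to z = 1/6, where 2 / (1 - z^2) is still below
  its threefold 21/10.\<close>

lemma artanh_bounds:
  fixes z :: real
  assumes "0 \<le> z"
  shows "z < 1 \<Longrightarrow> (1 - z) / (1 + z) \<le> exp (- 2 * z)"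
    and "z \<le> 1 / 6 \<Longrightarrow> exp (- 2 * z - 7 / 10 * z ^ 3) \<le> (1 - z) / (1 + z)"
proof -
  have deriv: "((\<lambda>z. ln (1 + z) - ln (1 - z) - 2 * z - c * z ^ 3) has_real_derivative
      2 * x\<^sup>2 / (1 - x\<^sup>2) - 3 * c * x\<^sup>2) (at x)" if "0 \<le> x" "x < 1" for x c :: real
  proof -
    have "1 / (1 + x) + 1 / (1 - x) - 2 = 2 * x\<^sup>2 / ((1 + x) * (1 - x))"
      using that by (simp add: divide_simps) (simp add: algebra_simps power2_eq_square)
    moreover have "(1 + x) * (1 - x) = 1 - x\<^sup>2" by (simp add: algebra_simps power2_eq_square)
    ultimately have "1 / (1 + x) + 1 / (1 - x) - 2 = 2 * x\<^sup>2 / (1 - x\<^sup>2)" by simp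
    then have "1 / (1 + x) - - 1 / (1 - x) - 2 - c * (3 * x\<^sup>2) = 2 * x\<^sup>2 / (1 - x\<^sup>2) - 3 * c * x\<^sup>2"
      by simp
    moreover have "((\<lambda>z. ln (1 + z) - ln (1 - z) - 2 * z - c * z ^ 3) has_real_derivative
      1 / (1 + x) - - 1 / (1 - x) - 2 - c * (3 * x\<^sup>2)) (at x)"
      using that by (auto intro!: derivative_eq_intros simp: power2_eq_square divide_inverse)
    ultimately show ?thesis by (simp only:)
  qed
  have ineq: "(1 - z) / (1 + z) = exp (- (ln (1 + z) - ln (1 - z)))" if "z < 1"
    using that assms by (simp add: exp_diff)
  show "(1 - z) / (1 + z) \<le> exp (- 2 * z)" if "z < 1"
  proof -
    have "\<exists>y. ((\<lambda>z. ln (1 + z) - ln (1 - z) - 2 * z - 0 * z ^ 3) has_real_derivative y) (at x) \<and> 0 \<le> y"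
      if "0 \<le> x" "x \<le> z" for x
    proof -
      have "x\<^sup>2 < 1" using that \<open>z < 1\<close> by (simp add: power_less_one_iff abs_square_less_1)
      then show ?thesis using deriv[of x 0] that \<open>z < 1\<close> by (intro exI[of _ "2 * x\<^sup>2 / (1 - x\<^sup>2)"]) auto
    qed
    from DERIV_nonneg_imp_nondecreasing[OF assms this]
    have "2 * z \<le> ln (1 + z) - ln (1 - z)" by simp
    then show ?thesis unfolding ineq[OF that] by simp
  qed
  show "exp (- 2 * z - 7 / 10 * z ^ 3) \<le> (1 - z) / (1 + z)" if "z \<le> 1 / 6"
  proof -
    have "\<exists>y. ((\<lambda>z. ln (1 + z) - ln (1 - z) - 2 * z - 7 / 10 * z ^ 3) has_real_derivative y) (at x) \<and> y \<le> 0"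
      if "0 \<le> x" "x \<le> z" for x
    proof -
      have "x * x \<le> 1 / 6 * (1 / 6)" using that \<open>z \<le> 1 / 6\<close> by (intro mult_mono) auto
      then have "2 / (1 - x\<^sup>2) \<le> 21 / 10" by (simp add: field_simps power2_eq_square)
      then have "x\<^sup>2 * (2 / (1 - x\<^sup>2)) \<le> x\<^sup>2 * (21 / 10)" by (intro mult_left_mono) auto
      then show ?thesis using deriv[of x "7 / 10"] that \<open>z \<le> 1 / 6\<close> by (intro exI conjI) (auto simp: mult.commute)
    qed
    from DERIV_nonpos_imp_nonincreasing[OF assms this]
    have "ln (1 + z) - ln (1 - z) \<le> 2 * z + 7 / 10 * z ^ 3" by simp
    then show ?thesis using ineq that by simp
  qed
qed

section \<open>Central binomial probabilities\<close>

definition central :: "nat \<Rightarrow> real" where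
  "central n = bin_prob (2 * n) 0"

lemma central_0: "central 0 = 1"
  by (simp add: central_def bin_prob_zero)

text \<open>A walk at 0 after \<open>2 * n + 2\<close> steps comes from 1 or -1 with equal
  probability, so odd times introduce no new central values.\<close>

lemma central_odd: "bin_prob (2 * n + 1) 1 = central (Suc n)"
  using bin_prob_Suc[of "2 * n + 1" 0] bin_prob_uminus[of "2 * n + 1" 1] by (simp add: central_def)

lemma central_Suc: "central (Suc n) = central n * (2 * real n + 1) / (2 * real n + 2)"
proof -
  have "real (2 * n + 1) * bin_prob (2 * n) 0 = (real (2 * n + 1) + 1) * bin_prob (2 * n + 1) 1"
    using bin_prob_pred[of "2 * n" 1] by simp
  then show ?thesis unfolding central_odd[symmetric] by (simp add: central_def field_simps)
qed

lemma central_pos: "central n > 0"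
  by (induction n) (simp_all add: central_0 central_Suc)

text \<open>Wallis' product: its partial products are
  \<open>1 / ((central n)^2 * (2 * n + 1))\<close>.\<close>

lemma central_limit: "(\<lambda>n. (central n)\<^sup>2 * real n) \<longlonglongrightarrow> 1 / pi"
proof -
  have eq: "(\<Prod>k=1..n. (4 * real k ^ 2) / (4 * real k ^ 2 - 1)) = 1 / ((central n)\<^sup>2 * (2 * real n + 1))" for n
  proof (induction n)
    case (Suc n)
    have "4 * real (Suc n) ^ 2 - 1 = (2 * real n + 1) * (2 * real n + 3)"
      by (simp add: power2_eq_square algebra_simps)
    then show ?case using Suc central_pos[of n]
      by (simp add: central_Suc) (simp add: divide_simps; simp add: power2_eq_square algebra_simps)
  qed (simp add: central_0)
  have "(\<lambda>n. (central n)\<^sup>2 * (2 * real n + 1)) \<longlonglongrightarrow> 2 / pi"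
    using tendsto_inverse[OF wallis] unfolding eq by simp
  moreover have "(\<lambda>n. real n / (2 * real n + 1)) \<longlonglongrightarrow> 1 / 2" by real_asymp
  ultimately have "(\<lambda>n. (central n)\<^sup>2 * (2 * real n + 1) * (real n / (2 * real n + 1))) \<longlonglongrightarrow> 2 / pi * (1 / 2)"
    by (rule tendsto_mult)
  moreover have "(central n)\<^sup>2 * (2 * real n + 1) * (real n / (2 * real n + 1)) = (central n)\<^sup>2 * real n" for n
    by (simp add: field_simps)
  ultimately show ?thesis by simp
qed

lemma central_limit_shift: "(\<lambda>n. (central n)\<^sup>2 * (real n + c)) \<longlonglongrightarrow> 1 / pi"
proof -
  have "(\<lambda>n. 1 / real n) \<longlonglongrightarrow> 0" by real_asymp
  from tendsto_mult[OF central_limit tendsto_add[OF tendsto_const[of 1] tendsto_mult[OF tendsto_const[of c] this]]]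
  have "(\<lambda>n. (central n)\<^sup>2 * real n * (1 + c * (1 / real n))) \<longlonglongrightarrow> 1 / pi" by simp
  moreover have "\<forall>\<^sub>F n in sequentially. (central n)\<^sup>2 * real n * (1 + c * (1 / real n)) = (central n)\<^sup>2 * (real n + c)"
    using eventually_gt_at_top[of 0] by eventually_elim (simp add: field_simps)
  ultimately show ?thesis by (rule Lim_transform_eventually)
qed

text \<open>The shift 1/4 is the first-order correction in the asymptotics; with it the sequence
  increases to its limit \<open>1 / pi\<close>.\<close>

lemma central_upper: "(central n)\<^sup>2 \<le> 1 / (pi * (real n + 1 / 4))"
proof -
  have "incseq (\<lambda>n. (central n)\<^sup>2 * (real n + 1 / 4))"
  proof (rule incseq_SucI)
    fix n
    have "(2 * real n + 2)\<^sup>2 * (real n + 1 / 4) \<le> (2 * real n + 1)\<^sup>2 * (real (Suc n) + 1 / 4)"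
      by (simp add: power2_eq_square algebra_simps)
    then have "real n + 1 / 4 \<le> ((2 * real n + 1) / (2 * real n + 2))\<^sup>2 * (real (Suc n) + 1 / 4)"
      by (simp add: power_divide divide_simps mult.commute)
    from mult_left_mono[OF this zero_le_power2[of "central n"]]
    show "(central n)\<^sup>2 * (real n + 1 / 4) \<le> (central (Suc n))\<^sup>2 * (real (Suc n) + 1 / 4)"
      by (simp add: central_Suc power_mult_distrib power_divide mult_ac)
  qed
  from incseq_le[OF this central_limit_shift, of n]
  have "(central n)\<^sup>2 * (pi * (real n + 1 / 4)) \<le> 1"
    unfolding pos_le_divide_eq[OF pi_gt_zero] by (simp add: mult_ac)
  moreover have "0 < pi * (real n + 1 / 4)" by (intro mult_pos_pos) auto
  ultimately show ?thesis by (simp only: pos_le_divide_eq)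
qed

text \<open>With a shift slightly above 1/4 the sequence decreases instead. The two cubics compared
  in the proof differ by \<open>n / 25 - 11 / 50\<close>, which is positive from
  \<open>n = 6\<close> on.\<close>

lemma central_lower:
  assumes "n \<ge> 6"
  shows "1 / (pi * (real n + 13 / 50)) \<le> (central n)\<^sup>2"
proof -
  have "decseq (\<lambda>n. (central (n + 6))\<^sup>2 * (real (n + 6) + 13 / 50))"
  proof (rule decseq_SucI)
    fix m :: nat
    define n where "n = m + 6"
    have n: "real n \<ge> 6" by (simp add: n_def)
    then have "(2 * real n + 1)\<^sup>2 * (real (Suc n) + 13 / 50) \<le> (2 * real n + 2)\<^sup>2 * (real n + 13 / 50)"
      by (simp add: power2_eq_square algebra_simps)
    then have "((2 * real n + 1) / (2 * real n + 2))\<^sup>2 * (real (Suc n) + 13 / 50) \<le> real n + 13 / 50"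
      by (simp add: power_divide divide_simps mult.commute)
    from mult_left_mono[OF this zero_le_power2[of "central n"]]
    have "(central (Suc n))\<^sup>2 * (real (Suc n) + 13 / 50) \<le> (central n)\<^sup>2 * (real n + 13 / 50)"
      by (simp add: central_Suc power_mult_distrib power_divide mult_ac)
    then show "(central (Suc m + 6))\<^sup>2 * (real (Suc m + 6) + 13 / 50) \<le> (central (m + 6))\<^sup>2 * (real (m + 6) + 13 / 50)"
      by (simp add: n_def)
  qed
  moreover have "(\<lambda>n. (central (n + 6))\<^sup>2 * (real (n + 6) + 13 / 50)) \<longlonglongrightarrow> 1 / pi"
    using central_limit_shift[of "13 / 50"] by (rule LIMSEQ_ignore_initial_segment)
  ultimately have "1 / pi \<le> (central (n - 6 + 6))\<^sup>2 * (real (n - 6 + 6) + 13 / 50)"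
    by (rule decseq_ge)
  then have "1 \<le> (central n)\<^sup>2 * (pi * (real n + 13 / 50))"
    using assms unfolding pos_divide_le_eq[OF pi_gt_zero] by (simp add: mult_ac)
  moreover have "0 < pi * (real n + 13 / 50)" by (intro mult_pos_pos) auto
  ultimately show ?thesis by (simp only: pos_divide_le_eq)
qed

section \<open>Gaussian bounds\<close>

lemma bin_prob_step:
  "(real t + real x + 2) * bin_prob t (int x + 2) = (real t - real x) * bin_prob t (int x)"
proof -
  define B where "B = bin_prob (Suc t) (int x + 1)"
  have 1: "(real t + real x + 2) * B = real (Suc t) * bin_prob t (int x)"
    using bin_prob_pred[of t "int x + 1"] by (simp add: B_def algebra_simps)
  have 2: "(real t - real x) * B = real (Suc t) * bin_prob t (int x + 2)"
    using bin_prob_succ[of t "int x + 1"] by (simp add: B_def algebra_simps)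
  have "real (Suc t) * ((real t + real x + 2) * bin_prob t (int x + 2)) = (real t + real x + 2) * ((real t - real x) * B)"
    unfolding 2 by (simp only: mult_ac)
  also have "\<dots> = real (Suc t) * ((real t - real x) * bin_prob t (int x))"
    using arg_cong[OF 1, of "\<lambda>y. (real t - real x) * y"] by (simp only: mult_ac)
  finally show ?thesis by (simp del: of_nat_Suc)
qed

text \<open>The step from \<open>x\<close> to \<open>x + 2\<close> is centred at
  \<open>x + 1\<close>. Measured in units of \<open>u = t + 1\<close> the ratio takes the symmetric
  form to which \<open>artanh_bounds\<close> applies.\<close>

lemma bin_prob_step_ratio:
  assumes "u = real t + 1" "z = (real x + 1) / u"
  shows "bin_prob t (int (x + 2)) = (1 - z) / (1 + z) * bin_prob t (int x)"
proof -
  have "u > 0" using assms by simp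
  have "1 + z = (u + real x + 1) / u" "1 - z = (u - real x - 1) / u"
    using \<open>u > 0\<close> by (simp_all add: assms(2) field_simps)
  then have "(1 - z) / (1 + z) = (real t - real x) / (real t + real x + 2)"
    using \<open>u > 0\<close> by (simp add: assms(1))
  moreover have "real t + real x + 2 \<noteq> 0" by linarith
  then have "bin_prob t (int x + 2) = (real t - real x) * bin_prob t (int x) / (real t + real x + 2)"
    by (metis bin_prob_step nonzero_mult_div_cancel_left)
  moreover have "int (x + 2) = int x + 2" by simp
  ultimately show ?thesis by (simp only: times_divide_eq_left)
qed

text \<open>Here \<open>e\<close> is the parity of \<open>x\<close>, and \<open>u = t + 1\<close> makes the Gaussian bound exact to first order.\<close>

lemma bin_prob_upper_step:
  assumes "u = real t + 1"
  shows "bin_prob t (int (e + 2 * k)) \<le> bin_prob t (int e) * exp (((real e)\<^sup>2 - (real (e + 2 * k))\<^sup>2) / (2 * u))"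
proof (induction k)
  case (Suc k)
  define x where "x = e + 2 * k"
  define z where "z = (real x + 1) / u"
  have u: "u > 0" using assms by simp
  have expo: "((real e)\<^sup>2 - (real (x + 2))\<^sup>2) / (2 * u) = ((real e)\<^sup>2 - (real x)\<^sup>2) / (2 * u) + (- 2 * z)"
    using u by (simp add: z_def field_simps power2_eq_square)
  have IH: "bin_prob t (int x) \<le> bin_prob t (int e) * exp (((real e)\<^sup>2 - (real x)\<^sup>2) / (2 * u))"
    using Suc by (simp add: x_def)
  show ?case
  proof (cases "z < 1")
    case True
    have "z \<ge> 0" using u by (simp add: z_def)
    have "bin_prob t (int (x + 2)) \<le> exp (- 2 * z) * (bin_prob t (int e) * exp (((real e)\<^sup>2 - (real x)\<^sup>2) / (2 * u)))"
      unfolding bin_prob_step_ratio[OF assms z_def]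
      by (rule mult_mono[OF artanh_bounds(1) IH]) (use True \<open>z \<ge> 0\<close> in \<open>auto simp: bin_prob_nonneg\<close>)
    then have "bin_prob t (int (x + 2)) \<le> bin_prob t (int e) * exp (((real e)\<^sup>2 - (real (x + 2))\<^sup>2) / (2 * u))"
      unfolding expo exp_add by (simp add: mult_ac)
    then show ?thesis by (simp add: x_def)
  next
    case False
    then have "x \<ge> t" using u assms by (simp add: z_def field_simps)
    then have "bin_prob t (int (x + 2)) = 0" by (intro bin_prob_eq_0) auto
    then show ?thesis by (simp add: x_def bin_prob_nonneg)
  qed
qed simp

text \<open>The cubic errors 7/10 z^3 of the single steps are summed by means of (x + 2)^4 - x^4 >=
  8 (x + 1)^3, whence the quartic term with factor 7/80. The condition
  \<open>6 * (e + 2 * k) <= t\<close> keeps every z below 1/6.\<close>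

lemma bin_prob_lower_step:
  assumes "u = real t + 1" "6 * (e + 2 * k) \<le> t"
  shows "bin_prob t (int e) * exp (((real e)\<^sup>2 - (real (e + 2 * k))\<^sup>2) / (2 * u) - 7 / 80 * (real (e + 2 * k)) ^ 4 / u ^ 3)
    \<le> bin_prob t (int (e + 2 * k))"
  using assms(2)
proof (induction k)
  case 0
  have u: "u > 0" using assms by simp
  then have "exp (- (7 / 80 * (real e) ^ 4 / u ^ 3)) \<le> 1" by simp
  from mult_left_mono[OF this bin_prob_nonneg[of t "int e"]] show ?case by simp
next
  case (Suc k)
  define x where "x = e + 2 * k"
  define z where "z = (real x + 1) / u"
  have u: "u > 0" using assms by simp
  define q where "q = ((real e)\<^sup>2 - (real x)\<^sup>2) / (2 * u) - 7 / 80 * (real x) ^ 4 / u ^ 3"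
  have IH: "bin_prob t (int e) * exp q \<le> bin_prob t (int x)"
    using Suc by (simp add: x_def q_def)
  have "z \<ge> 0" using u by (simp add: z_def)
  have "real (6 * (x + 2)) \<le> real t" using Suc.prems unfolding x_def of_nat_le_iff by simp
  then have "6 * (real x + 2) \<le> real t" by simp
  then have "z \<le> 1 / 6" using u assms(1) by (simp add: z_def field_simps)
  have "8 * (real x + 1) ^ 3 + (real x) ^ 4 \<le> (real (x + 2)) ^ 4"
    by (simp add: power4_eq_xxxx power3_eq_cube algebra_simps)
  then have "7 / 80 * (8 * (real x + 1) ^ 3 + (real x) ^ 4) / u ^ 3 \<le> 7 / 80 * (real (x + 2)) ^ 4 / u ^ 3"
    using u by (intro divide_right_mono) auto
  then have 1: "7 / 10 * z ^ 3 + 7 / 80 * (real x) ^ 4 / u ^ 3 \<le> 7 / 80 * (real (x + 2)) ^ 4 / u ^ 3"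
    unfolding z_def power_divide by (simp add: add_divide_distrib distrib_left)
  have "((real e)\<^sup>2 - (real (x + 2))\<^sup>2) / (2 * u) = ((real e)\<^sup>2 - (real x)\<^sup>2) / (2 * u) + (- 2 * z)"
    using u by (simp add: z_def field_simps power2_eq_square)
  with 1 have "((real e)\<^sup>2 - (real (x + 2))\<^sup>2) / (2 * u) - 7 / 80 * (real (x + 2)) ^ 4 / u ^ 3 \<le> q + (- 2 * z - 7 / 10 * z ^ 3)"
    by (simp add: q_def)
  then have "bin_prob t (int e) * exp (((real e)\<^sup>2 - (real (x + 2))\<^sup>2) / (2 * u) - 7 / 80 * (real (x + 2)) ^ 4 / u ^ 3)
      \<le> bin_prob t (int e) * exp (q + (- 2 * z - 7 / 10 * z ^ 3))"
    by (intro mult_left_mono) (auto simp: bin_prob_nonneg)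
  also have "\<dots> = exp (- 2 * z - 7 / 10 * z ^ 3) * (bin_prob t (int e) * exp q)"
    by (simp add: exp_add mult_ac)
  also have "\<dots> \<le> (1 - z) / (1 + z) * bin_prob t (int x)"
    by (rule mult_mono[OF artanh_bounds(2) IH]) (use \<open>z \<ge> 0\<close> \<open>z \<le> 1 / 6\<close> in \<open>auto simp: bin_prob_nonneg\<close>)
  also have "\<dots> = bin_prob t (int (x + 2))" unfolding bin_prob_step_ratio[OF assms(1) z_def] ..
  finally show ?case by (simp add: x_def)
qed

lemma sqrt_exp_power2: "0 \<le> c \<Longrightarrow> (sqrt c * exp x)\<^sup>2 = c * exp (2 * x)"
  for c x :: real
  by (simp add: power_mult_distrib exp_double)

lemma scaled_eq:
  fixes w u v :: real
  assumes "2 * w = u * v"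
  shows "1 / (pi * w) = 2 / (pi * u) * (1 / v)"
proof -
  have "2 / (pi * u) * (1 / v) = 2 / (pi * (u * v))" by simp
  also have "\<dots> = 1 / (pi * w)" unfolding assms[symmetric] by simp
  finally show ?thesis ..
qed

text \<open>For even t = 2 n the starting value at 0 is given by \<open>central_upper\<close>, where
  2 (n + 1/4) = u - 1/2. The factor 1 / (1 - 1 / (2 u)) is at most exp (1 / u), and its square root
  is the 1 in the exponent. For odd t the start is at 1, where the exponent is 0.\<close>

lemma bin_prob_upper:
  assumes "t > 0" "u = real t + 1"
  shows "bin_prob t x \<le> sqrt (2 / (pi * u)) * exp ((1 - (of_int x)\<^sup>2) / (2 * u))"
proof -
  have u: "u \<ge> 2" using assms by simp
  have *: "bin_prob t (int x) \<le> sqrt (2 / (pi * u)) * exp ((1 - (real x)\<^sup>2) / (2 * u))" for x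
  proof (cases "even (t + x)")
    case False
    then show ?thesis using u by (subst bin_prob_eq_0) auto
  next
    case True
    define e where "e = x mod 2"
    define k where "k = x div 2"
    have x: "x = e + 2 * k" by (simp add: e_def k_def)
    define s where "s = sqrt (2 / (pi * u)) * exp ((1 - (real e)\<^sup>2) / (2 * u))"
    have "bin_prob t (int e) \<le> s"
    proof (cases "even t")
      case even: True
      then have e: "e = 0" using True by (simp add: e_def)
      obtain n where n: "t = 2 * n" using even by blast
      define y where "y = 1 / u"
      have y: "0 \<le> y" "y \<le> 1" "1 / (2 * u) = y / 2" using u by (auto simp: y_def)
      have "1 \<le> (1 + y) * (1 - y / 2)"
        using mult_left_mono[OF y(2,1)] by (simp add: algebra_simps)
      also have "\<dots> \<le> exp y * (1 - y / 2)"
        using y by (intro mult_right_mono) auto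
      finally have "1 / (1 - 1 / (2 * u)) \<le> exp (1 / u)"
        unfolding y(3) y_def[symmetric] using y by (simp add: divide_le_eq)
      then have "2 / (pi * u) * (1 / (1 - 1 / (2 * u))) \<le> 2 / (pi * u) * exp (1 / u)"
        using u by (intro mult_left_mono) auto
      moreover have "1 / (pi * (real n + 1 / 4)) = 2 / (pi * u) * (1 / (1 - 1 / (2 * u)))"
      proof (rule scaled_eq)
        have "u * (1 - 1 / (2 * u)) = u - 1 / 2" using u by (simp add: right_diff_distrib)
        then show "2 * (real n + 1 / 4) = u * (1 - 1 / (2 * u))" using assms(2) n by simp
      qed
      ultimately have "(central n)\<^sup>2 \<le> 2 / (pi * u) * exp (1 / u)"
        using central_upper[of n] by simp
      moreover have "s\<^sup>2 = 2 / (pi * u) * exp (1 / u)"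
      proof -
        have "2 * ((1 - (real 0)\<^sup>2) / (2 * u)) = 1 / u" by simp
        then show ?thesis unfolding s_def e using sqrt_exp_power2[of "2 / (pi * u)"] u by simp
      qed
      ultimately have "(central n)\<^sup>2 \<le> s\<^sup>2" by simp
      moreover have "0 \<le> s" using u by (simp add: s_def)
      ultimately have "central n \<le> s" using power2_le_imp_le by blast
      then show ?thesis by (simp add: central_def n e)
    next
      case odd: False
      then have "odd x" using True by simp
      then have e: "e = 1" by (simp add: e_def odd_iff_mod_2_eq_one)
      obtain n where n: "t = 2 * n + 1" using odd oddE by blast
      have "(central (Suc n))\<^sup>2 \<le> 1 / (pi * (real (Suc n) + 1 / 4))" by (rule central_upper)
      also have "\<dots> \<le> 1 / (pi * (real (Suc n)))" by (intro divide_left_mono mult_left_mono) auto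
      also have "\<dots> = 2 / (pi * u)"
      proof -
        have "u = 2 * real (Suc n)" using assms n by simp
        then show ?thesis by (simp del: of_nat_Suc)
      qed
      finally have "central (Suc n) \<le> sqrt (2 / (pi * u))" using real_le_rsqrt by blast
      then show ?thesis using central_odd[of n] by (simp add: n e s_def)
    qed
    then have "bin_prob t (int e) * exp (((real e)\<^sup>2 - (real x)\<^sup>2) / (2 * u)) \<le> s * exp (((real e)\<^sup>2 - (real x)\<^sup>2) / (2 * u))"
      by (rule mult_right_mono) simp
    with bin_prob_upper_step[OF assms(2), of e k, folded x]
    have "bin_prob t (int x) \<le> s * exp (((real e)\<^sup>2 - (real x)\<^sup>2) / (2 * u))" by (rule order.trans)
    also have "\<dots> = sqrt (2 / (pi * u)) * exp ((1 - (real e)\<^sup>2) / (2 * u) + ((real e)\<^sup>2 - (real x)\<^sup>2) / (2 * u))"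
      by (simp add: s_def exp_add)
    also have "(1 - (real e)\<^sup>2) / (2 * u) + ((real e)\<^sup>2 - (real x)\<^sup>2) / (2 * u) = (1 - (real x)\<^sup>2) / (2 * u)"
      by (simp add: add_divide_distrib[symmetric])
    finally show ?thesis .
  qed
  have "bin_prob t x = bin_prob t (int (nat \<bar>x\<bar>))"
    by (cases "x \<ge> 0") (simp_all add: bin_prob_uminus)
  then show ?thesis using *[of "nat \<bar>x\<bar>"] by simp
qed

text \<open>For even t = 2 n, \<open>central_lower\<close> gives 2 (n + 13/50) = u - 12/25, and half
  of 12/25 is the 6/25 in the exponent, opposite the 1/2 of the upper bound. For odd t the start x =
  1 turns it into 6/25 - 1/2 = -13/50.\<close>

lemma bin_prob_lower:
  assumes "t \<ge> 12" "u = real t + 1" "6 * x \<le> t" "even (t + x)"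
  shows "sqrt (2 / (pi * u)) * exp (6 / 25 / u - (real x)\<^sup>2 / (2 * u) - 7 / 80 * real x ^ 4 / u ^ 3) \<le> bin_prob t (int x)"
proof -
  have u: "u \<ge> 13" using assms by simp
  define e where "e = x mod 2"
  define k where "k = x div 2"
  have x: "x = e + 2 * k" by (simp add: e_def k_def)
  define s where "s = sqrt (2 / (pi * u)) * exp (6 / 25 / u - (real e)\<^sup>2 / (2 * u))"
  have "s \<le> bin_prob t (int e)"
  proof (cases "even t")
    case even: True
    then have e: "e = 0" using assms(4) by (simp add: e_def)
    obtain n where n: "t = 2 * n" using even by blast
    have "1 - 12 / 25 / u \<le> exp (- (12 / 25 / u))" using exp_ge_add_one_self[of "- (12 / 25 / u)"] by simp
    then have "(1 - 12 / 25 / u) * exp (12 / 25 / u) \<le> 1"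
      by (simp add: exp_minus divide_simps mult.commute split: if_splits)
    then have "exp (12 / 25 / u) \<le> 1 / (1 - 12 / 25 / u)"
      using u by (simp add: divide_simps mult.commute split: if_splits)
    then have "2 / (pi * u) * exp (12 / 25 / u) \<le> 2 / (pi * u) * (1 / (1 - 12 / 25 / u))"
      using u by (intro mult_left_mono) auto
    also have "\<dots> = 1 / (pi * (real n + 13 / 50))"
    proof (rule scaled_eq[symmetric])
      have "u * (1 - 12 / 25 / u) = u - 12 / 25" using u by (simp add: right_diff_distrib)
      then show "2 * (real n + 13 / 50) = u * (1 - 12 / 25 / u)" using assms(2) n by simp
    qed
    finally have "2 / (pi * u) * exp (12 / 25 / u) \<le> (central n)\<^sup>2"
      using central_lower[of n] n assms(1) by simp
    moreover have "s\<^sup>2 = 2 / (pi * u) * exp (12 / 25 / u)"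
    proof -
      have "2 * (6 / 25 / u - (real 0)\<^sup>2 / (2 * u)) = 12 / 25 / u" by simp
      then show ?thesis unfolding s_def e using sqrt_exp_power2[of "2 / (pi * u)"] u by simp
    qed
    ultimately have "s\<^sup>2 \<le> (central n)\<^sup>2" by simp
    then have "s \<le> central n" using central_pos[of n] power2_le_imp_le less_imp_le by blast
    then show ?thesis by (simp add: central_def n e)
  next
    case odd: False
    then have "odd x" using assms(4) by simp
    then have e: "e = 1" by (simp add: e_def odd_iff_mod_2_eq_one)
    obtain n where n: "t = 2 * n + 1" using odd oddE by blast
    have "exp (- (13 / 25 / u)) \<le> 1 / (1 + 13 / 25 / u)"
      using exp_ge_add_one_self[of "13 / 25 / u"] u by (simp add: exp_minus divide_simps mult_ac split: if_splits)
    then have "2 / (pi * u) * exp (- (13 / 25 / u)) \<le> 2 / (pi * u) * (1 / (1 + 13 / 25 / u))"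
      using u by (intro mult_left_mono) auto
    also have "\<dots> = 1 / (pi * (real (Suc n) + 13 / 50))"
    proof (rule scaled_eq[symmetric])
      have "u * (1 + 13 / 25 / u) = u + 13 / 25" using u by (simp add: distrib_left)
      then show "2 * (real (Suc n) + 13 / 50) = u * (1 + 13 / 25 / u)" using assms(2) n by simp
    qed
    finally have "2 / (pi * u) * exp (- (13 / 25 / u)) \<le> (central (Suc n))\<^sup>2"
      using central_lower[of "Suc n"] n assms(1) by simp
    moreover have "s\<^sup>2 = 2 / (pi * u) * exp (- (13 / 25 / u))"
    proof -
      have "2 * (6 / 25 / u - (real 1)\<^sup>2 / (2 * u)) = - (13 / 25 / u)" by (simp add: field_simps)
      then show ?thesis unfolding s_def e using sqrt_exp_power2[of "2 / (pi * u)"] u by simp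
    qed
    ultimately have "s\<^sup>2 \<le> (central (Suc n))\<^sup>2" by simp
    then have "s \<le> central (Suc n)" using central_pos[of "Suc n"] power2_le_imp_le less_imp_le by blast
    then show ?thesis using central_odd[of n] by (simp add: n e)
  qed
  then have "s * exp (((real e)\<^sup>2 - (real x)\<^sup>2) / (2 * u) - 7 / 80 * real x ^ 4 / u ^ 3) \<le>
      bin_prob t (int e) * exp (((real e)\<^sup>2 - (real x)\<^sup>2) / (2 * u) - 7 / 80 * real x ^ 4 / u ^ 3)"
    by (rule mult_right_mono) simp
  also have "\<dots> \<le> bin_prob t (int x)"
    using bin_prob_lower_step[OF assms(2), of e k] assms(3) unfolding x[symmetric] by simp
  finally have "s * exp (((real e)\<^sup>2 - (real x)\<^sup>2) / (2 * u) - 7 / 80 * real x ^ 4 / u ^ 3) \<le> bin_prob t (int x)" .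
  moreover have "6 / 25 / u - (real e)\<^sup>2 / (2 * u) + (((real e)\<^sup>2 - (real x)\<^sup>2) / (2 * u) - 7 / 80 * real x ^ 4 / u ^ 3)
      = 6 / 25 / u - (real x)\<^sup>2 / (2 * u) - 7 / 80 * real x ^ 4 / u ^ 3"
    by (simp add: diff_divide_distrib)
  ultimately show ?thesis unfolding s_def mult.assoc exp_add[symmetric] by (simp only:)
qed

section \<open>The size and monotonicity of the influences\<close>

definition gval :: "nat \<Rightarrow> nat \<Rightarrow> nat \<Rightarrow> real" where
  "gval a b t = bin_prob t (int a) * bin_prob t (int b) / t"

definition hval :: "nat \<Rightarrow> nat \<Rightarrow> nat \<Rightarrow> real" where
  "hval a b t = bin_prob t (int a) * bin_prob t (int b) / t\<^sup>2"

lemma influence_vec_nat: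
  "influence_vec (int a, int b) t = (a * gval a b t, b * gval a b t, a * b * hval a b t)"
  by (simp add: influence_vec_def gval_def hval_def walk_prob_eq)

lemma gval_nonneg: "gval a b t \<ge> 0" and hval_nonneg: "hval a b t \<ge> 0"
  by (simp_all add: gval_def hval_def bin_prob_nonneg)

lemma gval_eq_0: "t < a \<Longrightarrow> gval a b t = 0" and hval_eq_0: "t < a \<Longrightarrow> hval a b t = 0"
  by (simp_all add: gval_def hval_def bin_prob_eq_0)

lemma gval_0 [simp]: "gval a b 0 = 0" and hval_0 [simp]: "hval a b 0 = 0"
  by (simp_all add: gval_def hval_def)

lemma walk_upper:
  assumes "t > 0" "u = real t + 1"
  shows "bin_prob t (int a) * bin_prob t (int b) \<le> 2 / (pi * u) * exp ((2 - ((real a)\<^sup>2 + (real b)\<^sup>2)) / (2 * u))"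
proof -
  have u: "u > 0" using assms by simp
  have "bin_prob t (int a) * bin_prob t (int b) \<le>
      (sqrt (2 / (pi * u)) * exp ((1 - (real a)\<^sup>2) / (2 * u))) * (sqrt (2 / (pi * u)) * exp ((1 - (real b)\<^sup>2) / (2 * u)))"
    using bin_prob_upper[OF assms, of "int a"] bin_prob_upper[OF assms, of "int b"] u
    by (intro mult_mono) (auto simp: bin_prob_nonneg)
  also have "\<dots> = (sqrt (2 / (pi * u)) * sqrt (2 / (pi * u))) * exp ((1 - (real a)\<^sup>2) / (2 * u) + (1 - (real b)\<^sup>2) / (2 * u))"
    by (simp only: exp_add mult_ac)
  also have "sqrt (2 / (pi * u)) * sqrt (2 / (pi * u)) = 2 / (pi * u)" using u by simp
  also have "(1 - (real a)\<^sup>2) / (2 * u) + (1 - (real b)\<^sup>2) / (2 * u) = (2 - ((real a)\<^sup>2 + (real b)\<^sup>2)) / (2 * u)"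
    by (simp add: add_divide_distrib[symmetric])
  finally show ?thesis .
qed

text \<open>Over u > 0, the maximum of 2/pi u^(-n) exp (-rho / (2 u)) is attained at u = rho / (2
  n). It equals \<open>K2\<close> / rho^2 for n = 2 and \<open>K3\<close> / rho^3 for n = 3.\<close>

definition K2 :: real where "K2 = 32 * exp (- 2) / pi"
definition K3 :: real where "K3 = 432 * exp (- 3) / pi"

lemma mult_exp_le: "y * exp (- y) \<le> exp (- 1)" for y :: real
proof -
  have "y \<le> exp (y - 1)" using exp_ge_add_one_self[of "y - 1"] by simp
  then have "y * exp (- y) \<le> exp (y - 1) * exp (- y)" by (intro mult_right_mono) auto
  also have "\<dots> = exp (- 1)" by (simp flip: exp_add)
  finally show ?thesis .
qed

lemma power_exp_le:
  assumes "n > 0" "\<rho> > 0" "u > 0"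
  shows "(1 / u) ^ n * exp (- \<rho> / (2 * u)) \<le> (2 * real n / \<rho>) ^ n * exp (- real n)"
proof -
  define y where "y = \<rho> / (2 * real n * u)"
  have y: "y > 0" using assms by (simp add: y_def)
  have 1: "1 / u = 2 * real n / \<rho> * y" using assms by (simp add: y_def)
  have 2: "- \<rho> / (2 * u) = real n * (- y)" using assms by (simp add: y_def)
  have "(1 / u) ^ n * exp (- \<rho> / (2 * u)) = (2 * real n / \<rho>) ^ n * (y * exp (- y)) ^ n"
    unfolding 1 2 exp_of_nat_mult power_mult_distrib by (simp only: mult_ac)
  also have "\<dots> \<le> (2 * real n / \<rho>) ^ n * exp (- 1) ^ n"
    using assms y by (intro mult_left_mono power_mono mult_exp_le) auto
  also have "exp (- 1) ^ n = exp (- real n)"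
    using exp_of_nat_mult[of n "- 1 :: real"] by simp
  finally show ?thesis .
qed

text \<open>The change from \<open>t\<close> to \<open>u\<close> is moved into the exponent, where
  it merely shifts a^2 + b^2. For \<open>t >= 9\<close> the quotient \<open>u / t\<close> is at most
  10/9.\<close>

lemma inverse_le_exp:
  assumes "t \<ge> 9" "u = real t + 1"
  shows "1 / real t \<le> 1 / u * exp (10 / 9 / u)"
proof -
  have t: "real t \<ge> 9" using assms by simp
  have "u / real t = 1 + 1 / real t" using t assms by (simp add: field_simps)
  also have "1 / real t \<le> 10 / 9 / u" using t assms by (simp add: field_simps)
  also have "1 + 10 / 9 / u \<le> exp (10 / 9 / u)" by (rule exp_ge_add_one_self)
  finally have "u / real t \<le> exp (10 / 9 / u)" by simp
  then show ?thesis using t assms by (simp add: field_simps)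
qed

text \<open>The exponent (2 - r) / (2 u) of the Gaussian factors and 10/9 / u for each factor 1/t
  add up to -(r - 38/9) / (2 u), or to -(r - 58/9) / (2 u) for two such factors. Since the values
  vanish before time \<open>a\<close>, the assumption on \<open>a\<close> supplies
  \<open>t >= 9\<close>.\<close>

lemma gval_upper:
  assumes "a \<ge> 9"
  shows "gval a b t \<le> K2 / ((real a)\<^sup>2 + (real b)\<^sup>2 - 38 / 9)\<^sup>2"
    and "hval a b t \<le> K3 / ((real a)\<^sup>2 + (real b)\<^sup>2 - 58 / 9) ^ 3"
proof -
  define r where "r = (real a)\<^sup>2 + (real b)\<^sup>2"
  have "(9::real)\<^sup>2 \<le> (real a)\<^sup>2" using assms by (intro power_mono) auto
  then have r: "r \<ge> 81" by (simp add: r_def add_increasing2)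
  define u where "u = real t + 1"
  have u: "u > 0" by (simp add: u_def)
  consider "t < a" | "t \<ge> 9" using assms by linarith
  then have "gval a b t \<le> K2 / (r - 38 / 9)\<^sup>2 \<and> hval a b t \<le> K3 / (r - 58 / 9) ^ 3"
  proof cases
    case 1
    then show ?thesis using r by (simp add: gval_eq_0 hval_eq_0 K2_def K3_def)
  next
    case 2
    have W: "bin_prob t (int a) * bin_prob t (int b) \<le> 2 / (pi * u) * exp ((2 - r) / (2 * u))"
      using walk_upper[OF _ u_def] 2 by (simp add: r_def)
    have I: "1 / real t \<le> 1 / u * exp (10 / 9 / u)" by (rule inverse_le_exp[OF 2 u_def])
    have "gval a b t = bin_prob t (int a) * bin_prob t (int b) * (1 / real t)" by (simp add: gval_def)
    also have "\<dots> \<le> 2 / (pi * u) * exp ((2 - r) / (2 * u)) * (1 / u * exp (10 / 9 / u))"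
      using u by (intro mult_mono W I) auto
    also have "\<dots> = 2 / pi * ((1 / u) ^ 2 * exp ((2 - r) / (2 * u) + 10 / 9 / u))"
      by (simp add: exp_add power2_eq_square)
    also have "(2 - r) / (2 * u) + 10 / 9 / u = - (r - 38 / 9) / (2 * u)"
      using u by (simp add: field_simps)
    also have "2 / pi * ((1 / u) ^ 2 * exp (- (r - 38 / 9) / (2 * u))) \<le> 2 / pi * ((2 * real 2 / (r - 38 / 9)) ^ 2 * exp (- real 2))"
      using r u by (intro mult_left_mono power_exp_le) auto
    also have "\<dots> = K2 / (r - 38 / 9)\<^sup>2" by (simp add: K2_def power_divide)
    finally have "gval a b t \<le> K2 / (r - 38 / 9)\<^sup>2" .
    moreover have "hval a b t = bin_prob t (int a) * bin_prob t (int b) * ((1 / real t) * (1 / real t))"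
      by (simp add: hval_def power2_eq_square)
    moreover have "\<dots> \<le> 2 / (pi * u) * exp ((2 - r) / (2 * u)) * ((1 / u * exp (10 / 9 / u)) * (1 / u * exp (10 / 9 / u)))"
      by (intro mult_mono W I) (use u in auto)
    moreover have "\<dots> = 2 / pi * ((1 / u) ^ 3 * exp ((2 - r) / (2 * u) + 10 / 9 / u + 10 / 9 / u))"
    proof -
      have "2 / (pi * u) * E * ((1 / u * e) * (1 / u * e)) = 2 / pi * ((1 / u) ^ 3 * (E * e * e))" for E e
        by (simp add: power3_eq_cube)
      then show ?thesis by (simp only: exp_add)
    qed
    moreover have "(2 - r) / (2 * u) + 10 / 9 / u + 10 / 9 / u = - (r - 58 / 9) / (2 * u)"
      using u by (simp add: field_simps)
    moreover have "2 / pi * ((1 / u) ^ 3 * exp (- (r - 58 / 9) / (2 * u))) \<le> 2 / pi * ((2 * real 3 / (r - 58 / 9)) ^ 3 * exp (- real 3))"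
      using r u by (intro mult_left_mono power_exp_le) auto
    moreover have "\<dots> = K3 / (r - 58 / 9) ^ 3" by (simp add: K3_def power_divide)
    ultimately show ?thesis by simp
  qed
  then show "gval a b t \<le> K2 / ((real a)\<^sup>2 + (real b)\<^sup>2 - 38 / 9)\<^sup>2"
    and "hval a b t \<le> K3 / ((real a)\<^sup>2 + (real b)\<^sup>2 - 58 / 9) ^ 3"
    by (simp_all add: r_def)
qed

text \<open>The maximum over \<open>t\<close> is attained near \<open>t = (a\<^sup>2 + b\<^sup>2) / 4\<close>.\<close>

lemma gval_lower:
  assumes "a \<ge> 25" "b \<le> a" "even (a + b)"
  shows "\<exists>t>0. even (t + a) \<and> K2 / ((real a)\<^sup>2 + (real b)\<^sup>2)\<^sup>2 \<le> gval a b t"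
proof -
  define r where "r = (real a)\<^sup>2 + (real b)\<^sup>2"
  define s where "s = r / 4"
  have aa: "25 * real a \<le> (real a)\<^sup>2" using assms(1) by (simp add: power2_eq_square)
  then have s: "25 * real a \<le> 4 * s" "s \<ge> 625 / 4"
    using assms(1) by (auto simp: s_def r_def add_increasing2)
  \<comment> \<open>The last time of the right parity not after \<open>s\<close>, so that
    \<open>u = t + 1\<close> differs from \<open>s\<close> by at most 1.\<close>
  obtain t where t: "real t \<le> s" "s - 2 \<le> real t" "even (t + a)"
  proof -
    define n where "n = nat \<lfloor>s\<rfloor>"
    have n: "real n \<le> s" "s < real n + 1" using s by (simp_all add: n_def)
    show ?thesis
    proof (cases "even (n + a)")
      case True
      then show ?thesis using n by (intro that[of n]) auto
    next
      case False
      moreover have "n \<ge> 1" using n s by (cases n) auto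
      ultimately show ?thesis using n by (intro that[of "n - 1"]) (auto simp: of_nat_diff)
    qed
  qed
  define u where "u = real t + 1"
  have u: "u \<ge> 155" "s - 1 \<le> u" "u \<le> s + 1" using t s by (auto simp: u_def)
  have "6 * real a \<le> real t" using t s by linarith
  then have "6 * a \<le> t" by linarith
  then have six: "6 * a \<le> t" "6 * b \<le> t" using assms(2) by auto
  have t12: "t \<ge> 12" using u by (simp add: u_def)
  have par: "even (t + a)" "even (t + b)" using t(3) assms(3) by auto
  define q where "q = s / u"
  have "1 - 1 / u = (u - 1) / u" "1 + 1 / u = (u + 1) / u"
    using u by (auto simp: diff_divide_distrib add_divide_distrib)
  then have q: "q > 0" "1 - 1 / u \<le> q" "q \<le> 1 + 1 / u"
    using u s by (auto simp: q_def intro!: divide_right_mono)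
  define E where "E x = exp (6 / 25 / u - (real x)\<^sup>2 / (2 * u) - 7 / 80 * real x ^ 4 / u ^ 3)" for x :: nat
  have "sqrt (2 / (pi * u)) * E a * (sqrt (2 / (pi * u)) * E b) \<le> bin_prob t (int a) * bin_prob t (int b)"
    using u unfolding E_def by (intro mult_mono bin_prob_lower t12 u_def six par) (auto simp: bin_prob_nonneg)
  moreover have "sqrt (2 / (pi * u)) * E a * (sqrt (2 / (pi * u)) * E b) = (sqrt (2 / (pi * u)) * sqrt (2 / (pi * u))) * (E a * E b)"
    by (simp only: mult_ac)
  moreover have "sqrt (2 / (pi * u)) * sqrt (2 / (pi * u)) = 2 / (pi * u)" using u by simp
  ultimately have 1: "2 / (pi * u) * (E a * E b) \<le> bin_prob t (int a) * bin_prob t (int b)" by simp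
  have "real a ^ 4 + real b ^ 4 \<le> r\<^sup>2"
    by (simp add: r_def power2_eq_square power4_eq_xxxx algebra_simps)
  then have "7 / 80 * (real a ^ 4 + real b ^ 4) / u ^ 3 \<le> 7 / 80 * (r\<^sup>2) / u ^ 3"
    using u by (intro divide_right_mono) auto
  also have "\<dots> = 7 / 5 * q\<^sup>2 / u" using u by (simp add: q_def s_def power2_eq_square power3_eq_cube)
  finally have "12 / 25 / u - 2 * q - 7 / 5 * q\<^sup>2 / u \<le>
      12 / 25 / u - r / (2 * u) - 7 / 80 * (real a ^ 4 + real b ^ 4) / u ^ 3"
    by (simp add: q_def s_def)
  moreover have "E a * E b = exp (12 / 25 / u - r / (2 * u) - 7 / 80 * (real a ^ 4 + real b ^ 4) / u ^ 3)"
    by (simp add: E_def r_def add_divide_distrib distrib_left flip: exp_add)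
  ultimately have 2: "exp (12 / 25 / u - 2 * q - 7 / 5 * q\<^sup>2 / u) \<le> E a * E b" by simp
  have "1 - 1 / u \<le> exp (- (1 / u))" using exp_ge_add_one_self[of "- (1 / u)"] by simp
  then have "(1 - 1 / u) * exp (1 / u) \<le> exp (- (1 / u)) * exp (1 / u)" by (rule mult_right_mono) simp
  then have "real t / u * exp (1 / u) \<le> 1" using u by (simp add: u_def field_simps flip: exp_add)
  then have 3: "1 / u * exp (1 / u) \<le> 1 / real t" using t12 u by (simp add: field_simps)
  \<comment> \<open>37/25 is 12/25, twice the 6/25 of \<open>bin_prob_lower\<close>, plus 1 for
    passing from 1/u to 1/t.\<close>
  have "2 / pi * (1 / u)\<^sup>2 * exp (37 / 25 / u - 2 * q - 7 / 5 * q\<^sup>2 / u) =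
      2 / (pi * u) * exp (12 / 25 / u - 2 * q - 7 / 5 * q\<^sup>2 / u) * (1 / u * exp (1 / u))"
    by (simp add: power2_eq_square mult.assoc flip: exp_add)
  also have "\<dots> \<le> 2 / (pi * u) * (E a * E b) * (1 / real t)"
    using u 2 3 by (intro mult_mono) (auto simp: E_def)
  also have "\<dots> \<le> gval a b t"
    using mult_right_mono[OF 1, of "1 / real t"] by (simp add: gval_def)
  finally have 4: "2 / pi * (1 / u)\<^sup>2 * exp (37 / 25 / u - 2 * q - 7 / 5 * q\<^sup>2 / u) \<le> gval a b t" .
  \<comment> \<open>A bound for ln q without logarithms. As q is within 1/u of 1, the loss (q - 1)^2
    / q is of second order.\<close>
  have "exp (1 - 1 / q) \<le> q"
  proof -
    have "1 / q \<le> exp (1 / q - 1)" using exp_ge_add_one_self[of "1 / q - 1"] by simp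
    then have "1 / exp (1 / q - 1) \<le> q" using q by (simp add: field_simps)
    then show ?thesis by (simp add: exp_diff field_simps)
  qed
  then have "exp (1 - 1 / q) * exp (1 - 1 / q) \<le> q * q" by (intro mult_mono) (use q in auto)
  then have qq: "exp (2 - 2 / q) \<le> q\<^sup>2" by (simp add: power2_eq_square flip: exp_add)
  have "(q - 1)\<^sup>2 / q \<le> (1 / u)\<^sup>2 / (1 - 1 / u)"
    using q u by (intro frac_le) (auto simp: abs_le_square_iff[symmetric])
  also have "\<dots> = 1 / u * (1 / (u - 1))" using u by (simp add: power2_eq_square field_simps)
  also have "\<dots> \<le> 1 / u * (1 / 154)" using u by (intro mult_left_mono divide_left_mono) auto
  finally have d1: "(q - 1)\<^sup>2 / q \<le> 1 / 154 / u" by simp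
  have "q \<le> 1 + 1 / 155" using q(3) u by (smt (verit) frac_le)
  then have "q\<^sup>2 \<le> (1 + 1 / 155)\<^sup>2" using q by (intro power_mono) auto
  then have "7 / 5 * q\<^sup>2 / u \<le> 7 / 5 * (1 + 1 / 155)\<^sup>2 / u" using u by (intro divide_right_mono) auto
  then have d2: "7 / 5 * q\<^sup>2 / u \<le> 1.42 / u"
    using u by (elim order.trans) (intro divide_right_mono, auto simp: power2_eq_square)
  have "2 / q + 2 * q = 4 + 2 * ((q - 1)\<^sup>2 / q)" using q by (simp add: field_simps power2_eq_square)
  then have "0 \<le> (2 - 2 / q) + (37 / 25 / u - 2 * q - 7 / 5 * q\<^sup>2 / u) + 2"
  proof -
    \<comment> \<open>The surplus 0.06 / u left after the quartic error 1.42 / u has to cover the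
      loss from q not being 1, which is at most 2/154 / u.\<close>
    have "37 / 25 / u = 1.42 / u + 0.06 / u" "0.06 / u \<ge> 2 * (1 / 154 / u)"
      using u by (simp_all add: field_simps)
    then show ?thesis using d1 d2 \<open>2 / q + 2 * q = _\<close> by linarith
  qed
  then have "exp (- 2) \<le> exp ((2 - 2 / q) + (37 / 25 / u - 2 * q - 7 / 5 * q\<^sup>2 / u))" by simp
  also have "\<dots> \<le> q\<^sup>2 * exp (37 / 25 / u - 2 * q - 7 / 5 * q\<^sup>2 / u)"
    unfolding exp_add by (intro mult_right_mono qq) auto
  finally have "2 / pi / s\<^sup>2 * exp (- 2) \<le> 2 / pi / s\<^sup>2 * (q\<^sup>2 * exp (37 / 25 / u - 2 * q - 7 / 5 * q\<^sup>2 / u))"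
    by (intro mult_left_mono) auto
  also have "\<dots> = 2 / pi * (1 / u)\<^sup>2 * exp (37 / 25 / u - 2 * q - 7 / 5 * q\<^sup>2 / u)"
    using s u by (simp add: q_def power_divide)
  also note 4
  finally have "K2 / r\<^sup>2 \<le> gval a b t" by (simp add: K2_def s_def power_divide)
  then show ?thesis using t12 par by (intro exI[of _ t]) (auto simp: r_def)
qed

section \<open>Recurrence in time and unimodality\<close>

lemma bin_prob_Suc_Suc:
  "((real t + 2)\<^sup>2 - (real x)\<^sup>2) * bin_prob (t + 2) (int x) = (real t + 1) * (real t + 2) * bin_prob t (int x)"
proof -
  have 1: "(real t + 2 - real x) * bin_prob (t + 2) (int x) = (real t + 2) * bin_prob (t + 1) (int x + 1)"
    using bin_prob_succ[of "Suc t" "int x"] by (simp add: algebra_simps)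
  have 2: "(real t + 2 + real x) * bin_prob (t + 1) (int x + 1) = (real t + 1) * bin_prob t (int x)"
    using bin_prob_pred[of t "int x + 1"] by (simp add: algebra_simps)
  have "((real t + 2)\<^sup>2 - (real x)\<^sup>2) * bin_prob (t + 2) (int x) =
      (real t + 2 + real x) * ((real t + 2 - real x) * bin_prob (t + 2) (int x))"
    by (simp add: power2_eq_square algebra_simps)
  also have "\<dots> = (real t + 2) * ((real t + 2 + real x) * bin_prob (t + 1) (int x + 1))"
    unfolding 1 by (simp only: mult_ac)
  also have "\<dots> = (real t + 1) * (real t + 2) * bin_prob t (int x)"
    unfolding 2 by (simp only: mult_ac)
  finally show ?thesis .
qed

lemma gval_Suc_Suc:
  assumes "t > 0"
  shows "gval a b (t + 2) * ((real t + 2) * (((real t + 2)\<^sup>2 - (real a)\<^sup>2) * ((real t + 2)\<^sup>2 - (real b)\<^sup>2))) =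
    gval a b t * (((real t + 1) * (real t + 2))\<^sup>2 * real t)"
    and "hval a b (t + 2) * ((real t + 2)\<^sup>2 * (((real t + 2)\<^sup>2 - (real a)\<^sup>2) * ((real t + 2)\<^sup>2 - (real b)\<^sup>2))) =
    hval a b t * (((real t + 1) * (real t + 2))\<^sup>2 * (real t)\<^sup>2)"
proof -
  have "bin_prob (t + 2) (int a) * bin_prob (t + 2) (int b) * (((real t + 2)\<^sup>2 - (real a)\<^sup>2) * ((real t + 2)\<^sup>2 - (real b)\<^sup>2)) =
      (((real t + 2)\<^sup>2 - (real a)\<^sup>2) * bin_prob (t + 2) (int a)) * (((real t + 2)\<^sup>2 - (real b)\<^sup>2) * bin_prob (t + 2) (int b))"
    by (simp only: mult_ac)
  also have "\<dots> = bin_prob t (int a) * bin_prob t (int b) * ((real t + 1) * (real t + 2))\<^sup>2"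
    unfolding bin_prob_Suc_Suc by (simp only: power2_eq_square mult_ac)
  finally have *: "bin_prob (t + 2) (int a) * bin_prob (t + 2) (int b) * (((real t + 2)\<^sup>2 - (real a)\<^sup>2) * ((real t + 2)\<^sup>2 - (real b)\<^sup>2))
      = bin_prob t (int a) * bin_prob t (int b) * ((real t + 1) * (real t + 2))\<^sup>2" .
  have "real (t + 2) = real t + 2" by simp
  have g: "gval a b (t + 2) * (real t + 2) = bin_prob (t + 2) (int a) * bin_prob (t + 2) (int b)"
    and h: "hval a b (t + 2) * (real t + 2)\<^sup>2 = bin_prob (t + 2) (int a) * bin_prob (t + 2) (int b)"
    unfolding gval_def hval_def \<open>real (t + 2) = real t + 2\<close> by (rule nonzero_eq_divide_eq[THEN iffD1]; simp)+
  have g': "gval a b t * real t = bin_prob t (int a) * bin_prob t (int b)"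
    and h': "hval a b t * (real t)\<^sup>2 = bin_prob t (int a) * bin_prob t (int b)"
    using assms by (simp_all add: gval_def hval_def)
  show "gval a b (t + 2) * ((real t + 2) * (((real t + 2)\<^sup>2 - (real a)\<^sup>2) * ((real t + 2)\<^sup>2 - (real b)\<^sup>2))) =
    gval a b t * (((real t + 1) * (real t + 2))\<^sup>2 * real t)"
    unfolding mult.assoc[symmetric, of "gval a b (t + 2)" "real t + 2"] g *
    by (subst g'[symmetric]) (simp only: mult_ac)
  show "hval a b (t + 2) * ((real t + 2)\<^sup>2 * (((real t + 2)\<^sup>2 - (real a)\<^sup>2) * ((real t + 2)\<^sup>2 - (real b)\<^sup>2))) =
    hval a b t * (((real t + 1) * (real t + 2))\<^sup>2 * (real t)\<^sup>2)"
    unfolding mult.assoc[symmetric, of "hval a b (t + 2)" "(real t + 2)\<^sup>2"] h *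
    by (subst h'[symmetric]) (simp only: mult_ac)
qed

lemma compare_by_ratio:
  fixes g g' X Y :: real
  assumes "g' * X = g * Y" "X > 0" "g \<ge> 0"
  shows "Y \<le> X \<Longrightarrow> g' \<le> g" and "g' < g \<Longrightarrow> Y < X"
proof -
  assume "Y \<le> X"
  then have "g' * X \<le> g * X" unfolding assms(1) by (intro mult_left_mono assms)
  then show "g' \<le> g" using assms(2) by simp
next
  assume "g' < g"
  then have "g * Y < g * X" unfolding assms(1)[symmetric] using assms(2) by simp
  then show "Y < X" using assms(3) by (meson mult_left_mono not_less)
qed

text \<open>Up to a factor u (for \<open>hpoly\<close>, u^2), the difference of the two coefficients
  in \<open>gval_Suc_Suc\<close> at u = t + 2. Its sign decides whether the value falls from t to t
  + 2.\<close>

definition gpoly :: "real \<Rightarrow> real \<Rightarrow> real \<Rightarrow> real" where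
  "gpoly a b u = 4 * u ^ 3 - (5 + a\<^sup>2 + b\<^sup>2) * u\<^sup>2 + 2 * u + a\<^sup>2 * b\<^sup>2"

definition hpoly :: "real \<Rightarrow> real \<Rightarrow> real \<Rightarrow> real" where
  "hpoly a b u = 6 * u ^ 3 - (13 + a\<^sup>2 + b\<^sup>2) * u\<^sup>2 + 12 * u - 4 + a\<^sup>2 * b\<^sup>2"

lemma gval_decreasing_iff:
  assumes "b \<le> a" "a \<le> t" "t > 0"
  shows "gval a b (t + 2) < gval a b t \<Longrightarrow> 0 < gpoly a b (real t + 2)"
    and "0 < gpoly a b (real t + 2) \<Longrightarrow> gval a b (t + 2) \<le> gval a b t"
    and "hval a b (t + 2) < hval a b t \<Longrightarrow> 0 < hpoly a b (real t + 2)"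
    and "0 < hpoly a b (real t + 2) \<Longrightarrow> hval a b (t + 2) \<le> hval a b t"
proof -
  define u where "u = real t + 2"
  define X where "X = (u\<^sup>2 - (real a)\<^sup>2) * (u\<^sup>2 - (real b)\<^sup>2)"
  have u: "u > 0" "real t + 1 = u - 1" "real t = u - 2" by (auto simp: u_def)
  have "(real a)\<^sup>2 < u\<^sup>2" "(real b)\<^sup>2 < u\<^sup>2"
    using assms by (auto simp: u_def intro!: power_strict_mono)
  then have X: "X > 0" by (simp add: X_def)
  have g: "gval a b (t + 2) * (u * X) = gval a b t * (((u - 1) * u)\<^sup>2 * (u - 2))"
    using gval_Suc_Suc(1)[OF assms(3), of a b] unfolding u_def[symmetric] unfolding X_def[symmetric] u(2) unfolding u(3) by simp
  have h: "hval a b (t + 2) * (u\<^sup>2 * X) = hval a b t * (((u - 1) * u)\<^sup>2 * (u - 2)\<^sup>2)"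
    using gval_Suc_Suc(2)[OF assms(3), of a b] unfolding u_def[symmetric] unfolding X_def[symmetric] u(2) unfolding u(3) by simp
  have 1: "u * X - ((u - 1) * u)\<^sup>2 * (u - 2) = u * gpoly a b u"
    by (simp add: gpoly_def X_def power2_eq_square power3_eq_cube algebra_simps)
  have 2: "u\<^sup>2 * X - ((u - 1) * u)\<^sup>2 * (u - 2)\<^sup>2 = u\<^sup>2 * hpoly a b u"
    by (simp add: hpoly_def X_def power2_eq_square power3_eq_cube algebra_simps)
  have uX: "0 < u * X" "0 < u\<^sup>2 * X" using u X by auto
  note G = compare_by_ratio[OF g uX(1) gval_nonneg] and H = compare_by_ratio[OF h uX(2) hval_nonneg]
  show "0 < gpoly a b (real t + 2)" if "gval a b (t + 2) < gval a b t"
    using G(2)[OF that] 1 u unfolding u_def[symmetric] by (smt (verit) zero_less_mult_pos)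
  show "gval a b (t + 2) \<le> gval a b t" if "0 < gpoly a b (real t + 2)"
    using that 1 u unfolding u_def[symmetric] by (intro G(1)) (smt (verit) mult_pos_pos)
  show "0 < hpoly a b (real t + 2)" if "hval a b (t + 2) < hval a b t"
    using H(2)[OF that] 2 u unfolding u_def[symmetric] by (smt (verit) zero_less_mult_pos zero_less_power)
  show "hval a b (t + 2) \<le> hval a b t" if "0 < hpoly a b (real t + 2)"
    using that 2 u unfolding u_def[symmetric] by (intro H(1)) (smt (verit) mult_pos_pos zero_less_power)
qed

text \<open>After division by \<open>u\<^sup>2\<close> the polynomials become convex functions of \<open>u\<close>, so that
  once positive to the right of a nonpositive value they remain positive.\<close>

lemma convex_stays_positive:
  fixes \<alpha> \<beta> \<gamma> \<delta> a u v :: real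
  assumes "\<gamma> \<ge> 0" "\<delta> \<ge> 0" "0 < a" "a < u" "u \<le> v"
    and "\<alpha> * a + \<beta> + \<gamma> / a + \<delta> / a\<^sup>2 \<le> 0" "0 < \<alpha> * u + \<beta> + \<gamma> / u + \<delta> / u\<^sup>2"
  shows "0 < \<alpha> * v + \<beta> + \<gamma> / v + \<delta> / v\<^sup>2"
proof -
  define m where "m = (u - a) / (v - a)"
  have m: "0 < m" "m \<le> 1" using assms by (auto simp: m_def)
  have u: "u = (1 - m) * a + m * v"
  proof -
    have "m * (v - a) = u - a" using assms by (simp add: m_def)
    then show ?thesis by (simp add: algebra_simps)
  qed
  define q where "q x = \<alpha> * x + \<beta> + \<gamma> / x + \<delta> / x\<^sup>2" for x
  define i j where "i = 1 / a" and "j = 1 / v"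
  have "((1 - m) * a + m * v) * ((1 - m) * i + m * j) = 1 + (1 - m) * m * ((a - v)\<^sup>2 * (i * j))"
    using assms by (simp add: i_def j_def field_simps power2_eq_square)
  moreover have "(1 - m) * m * ((a - v)\<^sup>2 * (i * j)) \<ge> 0"
    using m assms by (auto simp: i_def j_def)
  ultimately have "1 \<le> u * ((1 - m) * i + m * j)" using u by simp
  then have inv: "1 / u \<le> (1 - m) * i + m * j" using assms by (simp add: divide_le_eq mult.commute)
  have "(1 / u)\<^sup>2 \<le> ((1 - m) * i + m * j)\<^sup>2" using inv assms by (intro power_mono) auto
  also have "\<dots> = (1 - m) * i\<^sup>2 + m * j\<^sup>2 - (1 - m) * m * (i - j)\<^sup>2"
    by (simp add: power2_eq_square algebra_simps)
  also have "\<dots> \<le> (1 - m) * i\<^sup>2 + m * j\<^sup>2" using m by simp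
  finally have inv2: "(1 / u)\<^sup>2 \<le> (1 - m) * i\<^sup>2 + m * j\<^sup>2" .
  have "q u = \<alpha> * ((1 - m) * a + m * v) + \<beta> + \<gamma> * (1 / u) + \<delta> * (1 / u)\<^sup>2"
    by (simp add: q_def power_divide flip: u)
  also have "\<dots> \<le> \<alpha> * ((1 - m) * a + m * v) + \<beta> + \<gamma> * ((1 - m) * i + m * j) + \<delta> * ((1 - m) * i\<^sup>2 + m * j\<^sup>2)"
    using mult_left_mono[OF inv assms(1)] mult_left_mono[OF inv2 assms(2)] by linarith
  also have "\<dots> = (1 - m) * q a + m * q v"
    by (simp add: q_def i_def j_def power_divide algebra_simps)
  finally have "q u \<le> (1 - m) * q a + m * q v" .
  moreover have "(1 - m) * q a \<le> 0" using m assms(6) by (intro mult_nonneg_nonpos) (auto simp: q_def)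
  ultimately have "0 < m * q v" using assms(7) by (simp add: q_def)
  then show ?thesis using m by (simp add: zero_less_mult_iff q_def)
qed

text \<open>The nonpositive value to the left is found at u = a, where the cubic equals -a (a - 1)^2
  (a - 2), whatever b is.\<close>

lemma gpoly_stays_positive:
  assumes "2 \<le> a" "a < u" "u \<le> v" "0 < gpoly a b u"
  shows "0 < gpoly a b v"
proof -
  have eq: "gpoly a b x / x\<^sup>2 = 4 * x + (- (5 + a\<^sup>2 + b\<^sup>2)) + 2 / x + (a\<^sup>2 * b\<^sup>2) / x\<^sup>2" if "x > 0" for x
    using that by (simp add: gpoly_def field_simps power2_eq_square power3_eq_cube)
  have "gpoly a b a = - (a * ((a - 1)\<^sup>2 * (a - 2)))"
    by (simp add: gpoly_def power2_eq_square power3_eq_cube algebra_simps)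
  also have "\<dots> \<le> 0" using assms by simp
  finally have "gpoly a b a / a\<^sup>2 \<le> 0" by (simp add: divide_nonpos_nonneg)
  moreover have "0 < gpoly a b u / u\<^sup>2" using assms by simp
  ultimately have "0 < gpoly a b v / v\<^sup>2"
    using assms convex_stays_positive[of 2 "a\<^sup>2 * b\<^sup>2" a u v 4 "- (5 + a\<^sup>2 + b\<^sup>2)"] by (simp add: eq)
  then show ?thesis by (simp add: zero_less_divide_iff)
qed

text \<open>At u = a the value is -(a - 1)^2 (a - 2)^2. With \<open>b >= 1\<close> the coefficient
  a^2 b^2 - 4 of 1/u^2 is nonnegative, as convexity demands.\<close>

lemma hpoly_stays_positive:
  assumes "2 \<le> a" "1 \<le> b" "a < u" "u \<le> v" "0 < hpoly a b u"
  shows "0 < hpoly a b v"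
proof -
  have eq: "hpoly a b x / x\<^sup>2 = 6 * x + (- (13 + a\<^sup>2 + b\<^sup>2)) + 12 / x + (a\<^sup>2 * b\<^sup>2 - 4) / x\<^sup>2" if "x > 0" for x
    using that by (simp add: hpoly_def field_simps power2_eq_square power3_eq_cube)
  have "2 * 1 \<le> a * b" using assms by (intro mult_mono) auto
  then have "2\<^sup>2 \<le> (a * b)\<^sup>2" by (intro power_mono) auto
  then have ab: "0 \<le> a\<^sup>2 * b\<^sup>2 - 4" by (simp add: power_mult_distrib)
  have "hpoly a b a = - ((a - 1)\<^sup>2 * (a - 2)\<^sup>2)"
    by (simp add: hpoly_def power2_eq_square power3_eq_cube algebra_simps)
  then have "hpoly a b a / a\<^sup>2 \<le> 0" by (simp add: divide_nonpos_nonneg)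
  moreover have "0 < hpoly a b u / u\<^sup>2" using assms by simp
  ultimately have "0 < hpoly a b v / v\<^sup>2"
    using assms ab convex_stays_positive[of 12 "a\<^sup>2 * b\<^sup>2 - 4" a u v 6 "- (13 + a\<^sup>2 + b\<^sup>2)"] by (simp add: eq)
  then show ?thesis by (simp add: zero_less_divide_iff)
qed

section \<open>Total variation of the moments\<close>

definition held :: "nat \<Rightarrow> (nat \<Rightarrow> real) \<Rightarrow> nat \<Rightarrow> real" where
  "held a g t = (if even (t + a) then g t else g (t - 1))"

lemma path_vec_held:
  assumes "even (a + b)"
  shows "path_vec (int a, int b) t =
    (a * held a (gval a b) t, b * held a (gval a b) t, a * b * held a (hval a b) t)"
proof -
  have "same_parity (int a, int b) (int t) \<longleftrightarrow> even (t + a)"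
    using assms by (auto simp: same_parity_iff)
  then show ?thesis by (simp add: path_vec_def influence_vec_nat held_def)
qed

text \<open>The third hypothesis says that after its first descent \<open>p\<close> never rises
  again. So it climbs from 0 to one maximum and falls, and with the final return to 0 it covers that
  height exactly twice.\<close>

lemma variation_le:
  fixes p :: "nat \<Rightarrow> real"
  assumes "p 0 = 0" "\<And>t. p t \<le> B"
    and "\<And>s t. p (Suc s) < p s \<Longrightarrow> s \<le> t \<Longrightarrow> p (Suc t) \<le> p t"
  shows "(\<Sum>t<T. \<bar>p (Suc t) - p t\<bar>) + p T \<le> 2 * B"
proof -
  have up: "(\<Sum>t<T. \<bar>p (Suc t) - p t\<bar>) = p T" if "\<And>t. t < T \<Longrightarrow> p t \<le> p (Suc t)" for T
  proof -
    have "(\<Sum>t<T. \<bar>p (Suc t) - p t\<bar>) = (\<Sum>t<T. p (Suc t) - p t)" using that by simp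
    then show ?thesis using assms(1) by (simp add: sum_lessThan_telescope)
  qed
  show ?thesis
  proof (cases "\<exists>s<T. p (Suc s) < p s")
    case False
    then have "(\<Sum>t<T. \<bar>p (Suc t) - p t\<bar>) = p T" by (intro up) (meson not_le)
    then show ?thesis using assms(2)[of T] by simp
  next
    case True
    define s where "s = (LEAST s. p (Suc s) < p s)"
    have s: "p (Suc s) < p s" unfolding s_def using True by (auto intro: LeastI_ex)
    have "s \<le> T" using True unfolding s_def by (meson Least_le le_less_trans less_imp_le)
    have "(\<Sum>t<T. \<bar>p (Suc t) - p t\<bar>) = (\<Sum>t<s. \<bar>p (Suc t) - p t\<bar>) + (\<Sum>t=s..<T. \<bar>p (Suc t) - p t\<bar>)"
      using \<open>s \<le> T\<close> by (simp add: lessThan_atLeast0 sum.atLeastLessThan_concat)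
    also have "(\<Sum>t<s. \<bar>p (Suc t) - p t\<bar>) = p s"
    proof (rule up)
      fix t assume "t < s"
      then show "p t \<le> p (Suc t)" unfolding s_def by (meson not_less not_less_Least)
    qed
    also have "(\<Sum>t=s..<T. \<bar>p (Suc t) - p t\<bar>) = (\<Sum>t=s..<T. - (p (Suc t) - p t))"
      using assms(3)[OF s] by (intro sum.cong) auto
    also have "\<dots> = p s - p T"
      unfolding sum_negf using sum_Suc_diff'[OF \<open>s \<le> T\<close>, of p] by linarith
    finally show ?thesis using assms(2)[of s] by simp
  qed
qed

lemma held_decreasing:
  assumes stay: "\<And>t. even (t + a) \<Longrightarrow> s0 \<le> t \<Longrightarrow> g (t + 2) \<le> g t" and "g 0 = 0" "s0 \<le> s"
    and "even (s0 + a)"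
  shows "held a g (Suc s) \<le> held a g s"
proof (cases "even (Suc s + a)")
  case True
  then obtain t where t: "s = Suc t" using assms(3,4) by (cases s) auto
  then have "s0 \<le> t" using assms(3,4) True by (cases "s0 = s") auto
  then show ?thesis using stay[of t] True t by (simp add: held_def)
next
  case False
  then show ?thesis by (simp add: held_def)
qed

lemma held_variation_le:
  assumes "\<And>t. g t \<le> B" "g 0 = 0" "\<And>t. t < a \<Longrightarrow> g t = 0" "\<And>t. g t \<ge> 0"
    and dec: "\<And>s t. a \<le> s \<Longrightarrow> g (s + 2) < g s \<Longrightarrow> s \<le> t \<Longrightarrow> g (t + 2) \<le> g t"
  shows "(\<Sum>t<T. \<bar>held a g (Suc t) - held a g t\<bar>) + held a g T \<le> 2 * B"
proof (rule variation_le)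
  show "held a g 0 = 0" using assms(2) by (simp add: held_def)
  show "held a g t \<le> B" for t using assms(1) by (simp add: held_def)
  fix s t assume *: "held a g (Suc s) < held a g s" "s \<le> t"
  then have par: "even (Suc s + a)" by (auto simp: held_def split: if_splits)
  then obtain r where r: "s = Suc r" using *(1) assms(2) assms(4)[of "Suc s"] by (cases s) (auto simp: held_def)
  then have less: "g (r + 2) < g r" using * par by (simp add: held_def)
  have "\<not> r < a"
  proof
    assume "r < a"
    then have "g r = 0" by (rule assms(3))
    then show False using less assms(4)[of "r + 2"] by linarith
  qed
  then have "a \<le> r" by simp
  from dec[OF this less] have stay: "\<And>t. even (t + a) \<Longrightarrow> r \<le> t \<Longrightarrow> g (t + 2) \<le> g t" by blast
  have "r \<le> t" "even (r + a)" using *(2) r par by auto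
  with stay assms(2) show "held a g (Suc t) \<le> held a g t" by (rule held_decreasing)
qed

lemma gval_variation:
  assumes "2 \<le> a" "b \<le> a" "\<And>t. gval a b t \<le> B"
  shows "(\<Sum>t<T. \<bar>held a (gval a b) (Suc t) - held a (gval a b) t\<bar>) + held a (gval a b) T \<le> 2 * B"
proof (rule held_variation_le)
  fix s t assume *: "a \<le> s" "gval a b (s + 2) < gval a b s" "s \<le> t"
  then have s: "a \<le> s" "0 < s" and t: "a \<le> t" "0 < t" using assms(1) by linarith+
  have "0 < gpoly a b (real s + 2)" by (rule gval_decreasing_iff(1)[OF assms(2) s *(2)])
  then have "0 < gpoly a b (real t + 2)"
    by (rule gpoly_stays_positive[rotated -1]) (use s(1) *(3) assms(1) in simp_all)
  then show "gval a b (t + 2) \<le> gval a b t" by (rule gval_decreasing_iff(2)[OF assms(2) t])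
qed (use assms in \<open>auto simp: gval_nonneg gval_eq_0\<close>)

lemma hval_variation:
  assumes "2 \<le> a" "b \<le> a" "1 \<le> b" "\<And>t. hval a b t \<le> B"
  shows "(\<Sum>t<T. \<bar>held a (hval a b) (Suc t) - held a (hval a b) t\<bar>) + held a (hval a b) T \<le> 2 * B"
proof (rule held_variation_le)
  fix s t assume *: "a \<le> s" "hval a b (s + 2) < hval a b s" "s \<le> t"
  then have s: "a \<le> s" "0 < s" and t: "a \<le> t" "0 < t" using assms(1) by linarith+
  have "0 < hpoly a b (real s + 2)" by (rule gval_decreasing_iff(3)[OF assms(2) s *(2)])
  then have "0 < hpoly a b (real t + 2)"
    by (rule hpoly_stays_positive[rotated -1]) (use s(1) *(3) assms(1,3) in simp_all)
  then show "hval a b (t + 2) \<le> hval a b t" by (rule gval_decreasing_iff(4)[OF assms(2) t])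
qed (use assms in \<open>auto simp: hval_nonneg hval_eq_0\<close>)

text \<open>The first two moments are proportional to \<open>gval\<close>, so without the third one
  the path runs out and back on a segment. The third moment enters through the triangle inequality,
  with its own variation, and is of lower order.\<close>

lemma support_length_far:
  assumes "9 \<le> a" "b \<le> a" "even (a + b)" "k < 6"
  shows "support_length k (int a, int b) T \<le>
    (if k < 4 then 2 * real a else real a + real b) * (K2 / ((real a)\<^sup>2 + (real b)\<^sup>2 - 38 / 9)\<^sup>2)
    + 2 * (real a * real b) * (K3 / ((real a)\<^sup>2 + (real b)\<^sup>2 - 58 / 9) ^ 3)"
proof -
  define A B where "A = real a" and "B = real b"
  have AB: "0 \<le> B" "B \<le> A" using assms by (auto simp: A_def B_def)
  define p q where "p = held a (gval a b)" and "q = held a (hval a b)"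
  define Bg Bh where "Bg = K2 / (A\<^sup>2 + B\<^sup>2 - 38 / 9)\<^sup>2" and "Bh = K3 / (A\<^sup>2 + B\<^sup>2 - 58 / 9) ^ 3"
  have path: "path_vec (int a, int b) t = (A * p t, B * p t, A * B * q t)" for t
    using path_vec_held[OF assms(3)] by (simp add: p_def q_def A_def B_def)
  have nonneg: "p t \<ge> 0" "q t \<ge> 0" for t by (simp_all add: p_def q_def held_def gval_nonneg hval_nonneg)
  have p0: "p 0 = 0" by (simp add: p_def held_def)
  have Vg: "(\<Sum>t<T. \<bar>p (Suc t) - p t\<bar>) + p T \<le> 2 * Bg"
    unfolding p_def Bg_def A_def B_def
    by (rule gval_variation) (use assms gval_upper(1) in auto)
  have Vh: "A * B * ((\<Sum>t<T. \<bar>q (Suc t) - q t\<bar>) + q T) \<le> A * B * (2 * Bh)"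
  proof (cases "b = 0")
    case False
    have "(\<Sum>t<T. \<bar>q (Suc t) - q t\<bar>) + q T \<le> 2 * Bh"
      unfolding q_def Bh_def A_def B_def
      by (rule hval_variation) (use assms gval_upper(2) False in auto)
    then show ?thesis using AB by (intro mult_left_mono) auto
  qed (simp add: B_def)
  \<comment> \<open>For \<open>k >= 4\<close> rising and falling increments have different unit
    lengths, \<open>A\<close> and \<open>B\<close> in one order or the other. Split into an even
    part with \<alpha> and an odd part with \<beta>, the odd part cancels along the closed
    path.\<close>
  define \<alpha> \<beta> where "\<alpha> = (if k < 4 then A else (A + B) / 2)"
    and "\<beta> = (if k < 4 then 0 else if k = 4 then - ((A - B) / 2) else (A - B) / 2)"
  have step: "support k (A * d, B * d, A * B * e) \<le> \<alpha> * \<bar>d\<bar> + \<beta> * d + A * B * \<bar>e\<bar>" for d e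
  proof -
    have ab: "A * B \<ge> 0" using AB by simp
    then have e: "A * B * e \<le> A * B * \<bar>e\<bar>" "- (A * B * e) \<le> A * B * \<bar>e\<bar>"
      using mult_left_mono[of e "\<bar>e\<bar>" "A * B"] mult_left_mono[of "- e" "\<bar>e\<bar>" "A * B"] by auto
    have abs: "\<bar>A * d\<bar> = A * \<bar>d\<bar>" "\<bar>B * d\<bar> = B * \<bar>d\<bar>" "\<bar>A * B * e\<bar> = A * B * \<bar>e\<bar>"
      using AB ab by (simp_all add: abs_mult)
    have Bd: "B * \<bar>d\<bar> \<le> A * \<bar>d\<bar>" using AB by (intro mult_right_mono) auto
    have d: "A * d \<le> A * \<bar>d\<bar>" "- (A * d) \<le> A * \<bar>d\<bar>" "B * d \<le> B * \<bar>d\<bar>" "- (B * d) \<le> B * \<bar>d\<bar>"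
      using abs_ge_self[of "A * d"] abs_ge_minus_self[of "A * d"] abs_ge_self[of "B * d"] abs_ge_minus_self[of "B * d"]
      unfolding abs by simp_all
    have dd: "(A - B) * d \<le> (A - B) * \<bar>d\<bar>" "- ((A - B) * d) \<le> (A - B) * \<bar>d\<bar>"
      using AB mult_left_mono[of d "\<bar>d\<bar>" "A - B"] mult_left_mono[of "- d" "\<bar>d\<bar>" "A - B"] by auto
    have k: "k \<in> {0, 1, 2, 3, 4, 5}" using assms(4) by auto
    have 4: "max \<bar>B * d\<bar> (\<bar>A * B * e\<bar> - A * d) \<le> (A + B) / 2 * \<bar>d\<bar> + - ((A - B) / 2) * d + A * B * \<bar>e\<bar>"
      and 5: "max \<bar>B * d\<bar> (\<bar>A * B * e\<bar> + A * d) \<le> (A + B) / 2 * \<bar>d\<bar> + (A - B) / 2 * d + A * B * \<bar>e\<bar>"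
      unfolding abs max.bounded_iff using dd e d Bd by (auto simp: abs_if field_simps split: if_splits)
    from k show ?thesis
      unfolding \<alpha>_def \<beta>_def
      apply (elim insertE emptyE)
      using abs e d Bd 4 5 by (simp_all add: support_simps)
  qed
  have "support_length k (int a, int b) T =
      (\<Sum>t<T. support k (A * (p (Suc t) - p t), B * (p (Suc t) - p t), A * B * (q (Suc t) - q t)))
      + support k (A * (- p T), B * (- p T), A * B * (- q T))"
    by (simp add: support_length_def path algebra_simps)
  also have "\<dots> \<le> (\<Sum>t<T. \<alpha> * \<bar>p (Suc t) - p t\<bar> + \<beta> * (p (Suc t) - p t) + A * B * \<bar>q (Suc t) - q t\<bar>)
      + (\<alpha> * \<bar>- p T\<bar> + \<beta> * (- p T) + A * B * \<bar>- q T\<bar>)"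
    by (intro add_mono sum_mono step)
  also have "\<dots> = \<alpha> * ((\<Sum>t<T. \<bar>p (Suc t) - p t\<bar>) + p T) + A * B * ((\<Sum>t<T. \<bar>q (Suc t) - q t\<bar>) + q T)"
    using nonneg[of T] p0 sum_lessThan_telescope[of p T]
    by (simp add: sum.distrib sum_distrib_left[symmetric] distrib_left)
  also have "\<dots> \<le> \<alpha> * (2 * Bg) + A * B * (2 * Bh)"
    using AB by (intro add_mono Vh mult_left_mono Vg) (auto simp: \<alpha>_def)
  also have "\<alpha> * (2 * Bg) = (if k < 4 then 2 * A else A + B) * Bg" by (simp add: \<alpha>_def)
  also have "A * B * (2 * Bh) = 2 * (A * B) * Bh" by simp
  finally show ?thesis unfolding A_def B_def Bg_def Bh_def .
qed

section \<open>Symmetries of the grid\<close>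

lemma walk_prob_flip:
  "walk_prob (- x, y) t = walk_prob (x, y) t" "walk_prob (x, - y) t = walk_prob (x, y) t"
  "walk_prob (y, x) t = walk_prob (x, y) t"
  by (simp_all add: walk_prob_eq bin_prob_uminus)

lemma path_vec_flip:
  assumes "path_vec (x, y) t = (p, q, r)"
  shows "path_vec (- x, y) t = (- p, q, - r)" "path_vec (x, - y) t = (p, - q, - r)"
    "path_vec (y, x) t = (q, p, r)"
  using assms
  by (auto simp: path_vec_def influence_vec_def walk_prob_flip(1,2) walk_prob_flip(3)[of y x] same_parity_iff mult.commute)

text \<open>A symmetry of the grid changes signs or the order of the moments, which amounts to
  passing to another of the six support functions.\<close>

lemma support_length_flip:
  assumes "k < 6"
  shows "support_length k (- x, y) T = support_length (if k < 2 then 1 - k else if k < 4 then k else 9 - k) (x, y) T"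
    and "support_length k (x, - y) T = support_length (if k < 2 then 1 - k else if k < 4 then 5 - k else k) (x, y) T"
    and "support_length k (y, x) T = support_length (if k < 2 then 1 - k else if k < 4 then k + 2 else k - 2) (x, y) T"
proof -
  define F where "F j = (\<lambda>(p, q, r). support j (p, q, r))" for j :: nat
  define P where "P t = path_vec (x, y) t" for t
  have 1: "path_vec (- x, y) t = (- fst (P t), fst (snd (P t)), - snd (snd (P t)))"
    and 2: "path_vec (x, - y) t = (fst (P t), - fst (snd (P t)), - snd (snd (P t)))"
    and 3: "path_vec (y, x) t = (fst (snd (P t)), fst (P t), snd (snd (P t)))" for t
    using path_vec_flip[of x y t] by (auto simp: P_def)
  have P: "path_vec (x, y) t = (fst (P t), fst (snd (P t)), snd (snd (P t)))" for t by (simp add: P_def)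
  have f1: "support k (- p - - p', q, - r - - r') = support (if k < 2 then 1 - k else if k < 4 then k else 9 - k) (p - p', q, r - r')"
    "support k (p, - q - - q', - r - - r') = support (if k < 2 then 1 - k else if k < 4 then 5 - k else k) (p, q - q', r - r')"
    for p p' q q' r r'
    using support_flip_x[OF assms, of "p - p'" q "r - r'"] support_flip_y[OF assms, of p "q - q'" "r - r'"] by simp_all
  have f2: "support k (p, - q, r) = support (if k < 2 then 1 - k else if k < 4 then k else 9 - k) (- p, - q, - r)"
    "support k (- p, q, r) = support (if k < 2 then 1 - k else if k < 4 then 5 - k else k) (- p, - q, - r)"
    for p q r
    using support_flip_x[OF assms, of "- p" "- q" "- r"] support_flip_y[OF assms, of "- p" "- q" "- r"] by simp_all
  show "support_length k (- x, y) T = support_length (if k < 2 then 1 - k else if k < 4 then k else 9 - k) (x, y) T"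
    unfolding support_length_def 1 P diff_Pair uminus_Pair minus_minus f1 f2 ..
  show "support_length k (x, - y) T = support_length (if k < 2 then 1 - k else if k < 4 then 5 - k else k) (x, y) T"
    unfolding support_length_def 2 P diff_Pair uminus_Pair minus_minus f1 f2 ..
  show "support_length k (y, x) T = support_length (if k < 2 then 1 - k else if k < 4 then k + 2 else k - 2) (x, y) T"
    unfolding support_length_def 3 P diff_Pair uminus_Pair support_swap[OF assms] ..
qed

text \<open>A list and not a set: on the axes and the diagonals every vertex occurs twice, and
  \<open>weight\<close> corrects this by the factor one half.\<close>

definition images :: "nat \<Rightarrow> nat \<Rightarrow> point list" where
  "images a b = (let x = int a; y = int b in
    [(x, y), (x, - y), (- x, y), (- x, - y), (y, x), (y, - x), (- y, x), (- y, - x)])"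

section \<open>Summation over orbits\<close>

text \<open>The total over the eight images for one fixed rotor sequence. The eight symmetries reach
  each of the two circular support functions four times, or each of the four non-circular ones
  twice.\<close>

definition orbit_length :: "bool \<Rightarrow> nat \<Rightarrow> nat \<Rightarrow> nat \<Rightarrow> real" where
  "orbit_length c a b T = (if c then 4 * (\<Sum>k<2. support_length k (int a, int b) T)
     else 2 * (\<Sum>k=2..<6. support_length k (int a, int b) T))"

lemma sum_images:
  assumes "k < 6"
  shows "(\<Sum>z\<leftarrow>images a b. support_length k z T) = orbit_length (k < 2) a b T"
proof -
  have "{2..<6} = {2, 3, 4, 5 :: nat}" "{..<2} = {0, 1 :: nat}" by auto
  then have o: "orbit_length True a b T = 4 * (support_length 0 (int a, int b) T + support_length 1 (int a, int b) T)"
    "orbit_length False a b T = 2 * (support_length 2 (int a, int b) T + support_length 3 (int a, int b) T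
      + support_length 4 (int a, int b) T + support_length 5 (int a, int b) T)"
    by (simp_all add: orbit_length_def)
  show ?thesis
    using assms unfolding less_6_iff
    by (elim insertE emptyE)
      (simp_all add: o images_def Let_def support_length_flip(1,2) support_length_flip(3)[where x = "int a" and y = "int b"])
qed

lemma support_length_image:
  assumes "k < 6" "z \<in> set (images a b)"
  shows "\<exists>j<6. support_length k z T = support_length j (int a, int b) T"
proof -
  have "support_length k z T \<in> (\<lambda>j. support_length j (int a, int b) T) ` {0, 1, 2, 3, 4, 5}"
    using assms unfolding less_6_iff images_def Let_def
    by (elim insertE emptyE)
      (auto simp: support_length_flip(1,2) support_length_flip(3)[where x = "int a" and y = "int b"])
  then show ?thesis by force
qed

definition weight :: "nat \<Rightarrow> nat \<Rightarrow> real" where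
  "weight a b = (if b = 0 \<or> b = a then 1 / 2 else 1)"

definition fiber :: "nat \<Rightarrow> nat \<Rightarrow> point set" where
  "fiber a b = {z. max \<bar>fst z\<bar> \<bar>snd z\<bar> = int a \<and> min \<bar>fst z\<bar> \<bar>snd z\<bar> = int b}"

lemma fiber_eq:
  assumes "b \<le> a"
  shows "fiber a b = set (images a b)"
proof -
  have "max p q = int a \<and> min p q = int b \<longleftrightarrow> p = int a \<and> q = int b \<or> p = int b \<and> q = int a" for p q
    using assms by linarith
  moreover have "\<bar>x\<bar> = int c \<longleftrightarrow> x = int c \<or> x = - int c" for x c by linarith
  ultimately have "z \<in> fiber a b \<longleftrightarrow> z \<in> set (images a b)" for z
    by (cases z) (auto simp: fiber_def images_def Let_def)
  then show ?thesis by blast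
qed

lemma sum_fiber:
  fixes F :: "point \<Rightarrow> real"
  assumes "b \<le> a" "0 < a"
  shows "(\<Sum>z\<in>fiber a b. F z) = weight a b * (\<Sum>z\<leftarrow>images a b. F z)"
proof -
  consider "b = 0" | "b = a" | "b \<noteq> 0" "b < a" using assms by linarith
  then show ?thesis
  proof cases
    case 1
    then have "fiber a b = {(int a, 0), (- int a, 0), (0, int a), (0, - int a)}"
      unfolding fiber_eq[OF assms(1)] by (auto simp: images_def Let_def)
    then show ?thesis using 1 assms by (simp add: weight_def images_def Let_def)
  next
    case 2
    then have "fiber a b = {(int a, int a), (int a, - int a), (- int a, int a), (- int a, - int a)}"
      unfolding fiber_eq[OF assms(1)] by (auto simp: images_def Let_def)
    then show ?thesis using 2 assms by (simp add: weight_def images_def Let_def)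
  next
    case 3
    then have "distinct (images a b)" by (auto simp: images_def Let_def)
    then show ?thesis unfolding fiber_eq[OF assms(1)] using 3
      by (simp add: weight_def sum_list_distinct_conv_sum_set)
  qed
qed

definition cells :: "nat \<Rightarrow> (nat \<times> nat) set" where
  "cells n = {(a, b). 1 \<le> a \<and> a \<le> n \<and> b \<le> a \<and> even (a + b)}"

lemma finite_cells [simp]: "finite (cells n)"
  by (rule finite_subset[of _ "{..n} \<times> {..n}"]) (auto simp: cells_def)

definition disk :: "nat \<Rightarrow> point set" where
  "disk n = V \<inter> vbox (0, 0) n - {(0, 0)}"

lemma disk_eq: "disk n = (\<Union>(a, b)\<in>cells n. fiber a b)"
proof (intro set_eqI iffI)
  fix z assume "z \<in> disk n"
  then have "(nat (max \<bar>fst z\<bar> \<bar>snd z\<bar>), nat (min \<bar>fst z\<bar> \<bar>snd z\<bar>)) \<in> cells n"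
    "z \<in> fiber (nat (max \<bar>fst z\<bar> \<bar>snd z\<bar>)) (nat (min \<bar>fst z\<bar> \<bar>snd z\<bar>))"
    by (cases z; auto simp: disk_def vbox_def V_iff cells_def fiber_def max_def min_def even_nat_iff abs_if split: if_splits)+
  then show "z \<in> (\<Union>(a, b)\<in>cells n. fiber a b)" by blast
next
  fix z assume "z \<in> (\<Union>(a, b)\<in>cells n. fiber a b)"
  then obtain a b where ab: "(a, b) \<in> cells n" "z \<in> fiber a b" by blast
  then have "z \<in> set (images a b)" using fiber_eq[of b a] by (simp add: cells_def)
  with ab(1)
  show "z \<in> disk n"
    by (auto simp: disk_def vbox_def V_iff cells_def images_def Let_def)
qed

lemma sum_disk:
  fixes F :: "point \<Rightarrow> real"
  shows "(\<Sum>z\<in>disk n. F z) = (\<Sum>(a, b)\<in>cells n. weight a b * (\<Sum>z\<leftarrow>images a b. F z))"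
proof -
  have "(\<Sum>z\<in>disk n. F z) = (\<Sum>c\<in>cells n. \<Sum>z\<in>fiber (fst c) (snd c). F z)"
    unfolding disk_eq case_prod_unfold
  proof (rule sum.UNION_disjoint)
    show "\<forall>i\<in>cells n. finite (fiber (fst i) (snd i))"
      by (auto simp: cells_def fiber_eq)
    show "\<forall>i\<in>cells n. \<forall>j\<in>cells n. i \<noteq> j \<longrightarrow> fiber (fst i) (snd i) \<inter> fiber (fst j) (snd j) = {}"
      by (auto simp: fiber_def)
  qed simp
  also have "\<dots> = (\<Sum>(a, b)\<in>cells n. weight a b * (\<Sum>z\<leftarrow>images a b. F z))"
    by (intro sum.cong) (auto simp: cells_def sum_fiber)
  finally show ?thesis .
qed

lemma same_parity_0: "same_parity (0, 0) (int T) \<longleftrightarrow> even T"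
  by (simp add: same_parity_iff)

lemma zero_in_V: "(0, 0) \<in> V"
  by (simp add: V_iff)

lemma support_length_origin: "k < 6 \<Longrightarrow> support_length k (0, 0) T = 0"
proof -
  assume k: "k < 6"
  have "path_vec (0, 0) t = 0" for t by (simp add: path_vec_def influence_vec_def zero_prod_def)
  then show ?thesis using k by (simp add: support_length_def)
qed

lemma cells_0: "cells 0 = {}"
  by (auto simp: cells_def)

section \<open>From orbits to suprema\<close>

lemma choose_support:
  assumes "\<And>x. x \<in> V \<Longrightarrow> rotor_sequence (R x)"
  obtains k where "\<And>x. x \<in> V \<Longrightarrow> k x < 6 \<and> potential_max (R x) = support (k x)"
proof -
  have "\<forall>x\<in>V. \<exists>k. k < 6 \<and> potential_max (R x) = support k"
    using rotor_support assms by blast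
  then show ?thesis using that by (metis bchoice)
qed

lemma diff_origin: "x - (0, 0) = (x :: point)"
  by (cases x) simp

lemma discrepancy_eq:
  assumes "even_config f0"
  shows "real (chips R f0 a0 y T) - linear_chips f0 T y =
    (\<Sum>x\<in>V \<inter> vbox y T. contribution R f0 a0 y T x)"
proof -
  have "real (chips R f0 a0 y T) - linear_chips f0 T y = (\<Sum>x\<in>vbox y T. contribution R f0 a0 y T x)"
    by (rule chips_minus_linear) auto
  also have "\<dots> = (\<Sum>x\<in>V \<inter> vbox y T. contribution R f0 a0 y T x)"
  proof (rule sum.mono_neutral_right)
    show "\<forall>x\<in>vbox y T - V \<inter> vbox y T. contribution R f0 a0 y T x = 0"
      using contribution_outside[OF assms] by blast
  qed auto
  finally show ?thesis .
qed

lemma shift_disk: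
  fixes s :: "point \<Rightarrow> real"
  assumes "y \<in> V" "s (0, 0) = 0"
  shows "(\<Sum>x\<in>V \<inter> vbox y T. s (x - y)) = (\<Sum>z\<in>disk T. s z)"
proof -
  have "(\<Sum>x\<in>V \<inter> vbox y T. s (x - y)) = (\<Sum>z\<in>V \<inter> vbox (0, 0) T. s z)"
    by (rule sum.reindex_bij_witness[of _ "\<lambda>z. z + y" "\<lambda>x. x - y"])
      (use assms(1) in \<open>auto simp: V_iff vbox_def mem_Times_iff\<close>)
  also have "\<dots> = (\<Sum>z\<in>disk T. s z)"
    by (rule sum.mono_neutral_right) (use assms(2) in \<open>auto simp: disk_def\<close>)
  finally show ?thesis .
qed

lemma discrepancy_le:
  assumes "even_config f0" "y \<in> V"
    and "\<And>x. x \<in> V \<Longrightarrow> contribution R f0 a0 y T x \<le> s (x - y)" "s (0, 0) = 0" "(\<Sum>z\<in>disk T. s z) \<le> B"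
    and "\<And>x. x \<in> V \<Longrightarrow> - contribution R f0 a0 y T x \<le> s' (x - y)" "s' (0, 0) = 0" "(\<Sum>z\<in>disk T. s' z) \<le> B"
  shows "discrepancy R f0 a0 y T \<le> B"
proof -
  have "(\<Sum>x\<in>V \<inter> vbox y T. contribution R f0 a0 y T x) \<le> (\<Sum>x\<in>V \<inter> vbox y T. s (x - y))"
    by (intro sum_mono assms(3)) auto
  moreover have "- (\<Sum>x\<in>V \<inter> vbox y T. contribution R f0 a0 y T x) \<le> (\<Sum>x\<in>V \<inter> vbox y T. s' (x - y))"
    unfolding sum_negf[symmetric] by (intro sum_mono assms(6)) auto
  ultimately show ?thesis
    unfolding discrepancy_def discrepancy_eq[OF assms(1)]
    using shift_disk[OF assms(2), of s T] shift_disk[OF assms(2), of s' T] assms by linarith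
qed

lemma discrepancy_parity:
  assumes "even_config f0" "y \<in> V" "\<not> same_parity y (int T)"
  shows "discrepancy R f0 a0 y T = 0"
  using contribution_parity[OF assms(1,3,2)]
  by (simp add: discrepancy_def discrepancy_eq[OF assms(1)])

lemma sum_disk_support_length:
  assumes "k < 6"
  shows "(\<Sum>z\<in>disk n. support_length k z T) = (\<Sum>(a, b)\<in>cells n. weight a b * orbit_length (k < 2) a b T)"
  unfolding sum_disk by (intro sum.cong) (auto simp: sum_images[OF assms])

lemma weight_pos: "weight a b > 0"
  by (simp add: weight_def)

lemma dual_less: "k < 6 \<Longrightarrow> dual k < 6 \<and> (dual k < 2 \<longleftrightarrow> k < 2)"
  by (auto simp: dual_def)

text \<open>Discrepancies of either sign are covered by one bound: the positive part is governed by
  \<open>k\<close>, the negative one by \<open>dual k\<close>, which is of the same type and so has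
  the same orbit totals.\<close>

theorem sup_discrepancy_le:
  assumes N: "rotor_sequence N"
    and U: "\<And>a b T. 1 \<le> a \<Longrightarrow> b \<le> a \<Longrightarrow> even (a + b) \<Longrightarrow> orbit_length (circular_rotor N) a b T \<le> U a b"
    and B: "\<And>n. (\<Sum>(a, b)\<in>cells n. weight a b * U a b) \<le> B"
  shows "sup_discrepancy (\<lambda>_. N) \<le> ereal B"
proof -
  obtain k where k: "k < 6" "potential_max N = support k" "circular_rotor N \<longleftrightarrow> k < 2"
    using rotor_support[OF N] by blast
  have B0: "0 \<le> B" using B[of 0] by (simp add: cells_0)
  have sum_le: "(\<Sum>z\<in>disk T. support_length j z T) \<le> B" if "j < 6" "j < 2 \<longleftrightarrow> k < 2" for j T
  proof -
    have "(\<Sum>z\<in>disk T. support_length j z T) \<le> (\<Sum>(a, b)\<in>cells T. weight a b * U a b)"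
      unfolding sum_disk_support_length[OF that(1)]
      using U[of _ _ T] k(3) that(2) less_imp_le[OF weight_pos]
      by (intro sum_mono) (auto simp: cells_def intro!: mult_left_mono)
    then show ?thesis using B by (rule order.trans)
  qed
  have "discrepancy (\<lambda>_. N) f0 a0 y T \<le> B" if "even_config f0" "y \<in> V" for f0 a0 y T
  proof (cases "same_parity y (int T)")
    case True
    show ?thesis
    proof (rule discrepancy_le[OF that])
      show "contribution (\<lambda>_. N) f0 a0 y T x \<le> support_length k (x - y) T" for x
        by (rule abs_contribution_le(1)) (use N that True k in auto)
      show "- contribution (\<lambda>_. N) f0 a0 y T x \<le> support_length (dual k) (x - y) T" for x
        by (rule abs_contribution_le(2)) (use N that True k in auto)
    qed (use sum_le k dual_less[OF k(1)] in \<open>auto simp: support_length_origin\<close>)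
  next
    case False
    then show ?thesis using discrepancy_parity[OF that False] B0 by simp
  qed
  then show ?thesis unfolding sup_discrepancy_def by (intro SUP_least) auto
qed

text \<open>Here the images of a vertex may carry different rotor sequences, so each of the eight is
  bounded by the worst of the six support functions at the representative.\<close>

theorem sup_discrepancy_origin_le:
  assumes R: "\<And>x. x \<in> V \<Longrightarrow> rotor_sequence (R x)"
    and U: "\<And>a b k T. 1 \<le> a \<Longrightarrow> b \<le> a \<Longrightarrow> even (a + b) \<Longrightarrow> k < 6 \<Longrightarrow> 8 * support_length k (int a, int b) T \<le> U a b"
    and B: "\<And>n. (\<Sum>(a, b)\<in>cells n. weight a b * U a b) \<le> B"
  shows "sup_discrepancy_origin R \<le> ereal B"
proof -
  obtain k where k: "\<And>x. x \<in> V \<Longrightarrow> k x < 6 \<and> potential_max (R x) = support (k x)"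
    using choose_support R by blast
  have B0: "0 \<le> B" using B[of 0] by (simp add: cells_0)
  have sum_le: "(\<Sum>z\<in>disk T. support_length (j z) z T) \<le> B" if j: "\<And>x. x \<in> V \<Longrightarrow> j x < 6" for j T
  proof -
    have "(\<Sum>z\<leftarrow>images a b. support_length (j z) z T) \<le> U a b" if "(a, b) \<in> cells T" for a b
    proof -
      have "support_length (j z) z T \<le> U a b / 8" if z: "z \<in> set (images a b)" for z
      proof -
        have "z \<in> V" using z \<open>(a, b) \<in> cells T\<close> by (auto simp: images_def Let_def V_iff cells_def)
        then obtain i where "i < 6" "support_length (j z) z T = support_length i (int a, int b) T"
          using support_length_image[OF j z, where T = T] by blast
        then show ?thesis
          using U[of a b i T] \<open>(a, b) \<in> cells T\<close> by (simp add: cells_def)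
      qed
      then have "(\<Sum>z\<leftarrow>images a b. support_length (j z) z T) \<le> (\<Sum>z\<leftarrow>images a b. U a b / 8)"
        by (intro sum_list_mono) auto
      then show ?thesis by (simp add: images_def Let_def)
    qed
    then have "(\<Sum>z\<in>disk T. support_length (j z) z T) \<le> (\<Sum>(a, b)\<in>cells T. weight a b * U a b)"
      unfolding sum_disk using less_imp_le[OF weight_pos] by (intro sum_mono) (auto intro!: mult_left_mono)
    then show ?thesis using B by (rule order.trans)
  qed
  have "discrepancy R f0 a0 (0, 0) T \<le> B" if "even_config f0" for f0 a0 T
  proof (cases "same_parity (0, 0) (int T)")
    case True
    show ?thesis
    proof (rule discrepancy_le[OF that zero_in_V])
      show "contribution R f0 a0 (0, 0) T x \<le> (\<lambda>z. support_length (k z) z T) (x - (0, 0))" if "x \<in> V" for x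
        using abs_contribution_le(1)[where R = R and x = x, OF R[OF that] \<open>even_config f0\<close> True] k[OF that]
        by (simp add: diff_origin)
      show "- contribution R f0 a0 (0, 0) T x \<le> (\<lambda>z. support_length (dual (k z)) z T) (x - (0, 0))" if "x \<in> V" for x
        using abs_contribution_le(2)[where R = R and x = x, OF R[OF that] \<open>even_config f0\<close> True] k[OF that]
        by (simp add: diff_origin)
    qed (use sum_le k dual_less zero_in_V in \<open>auto simp: support_length_origin\<close>)
  next
    case False
    then show ?thesis using discrepancy_parity[OF that zero_in_V False] B0 by simp
  qed
  then show ?thesis unfolding sup_discrepancy_origin_def by (intro SUP_least) auto
qed

lemma orbit_length_mono: "S \<le> T \<Longrightarrow> orbit_length c a b S \<le> orbit_length c a b T"
  by (auto simp: orbit_length_def intro!: sum_mono support_length_mono)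

lemma orbit_length_nonneg: "orbit_length c a b T \<ge> 0"
  by (auto simp: orbit_length_def intro!: sum_nonneg support_length_nonneg)

lemma discrepancy_attained:
  assumes R: "\<And>x. x \<in> V \<Longrightarrow> rotor_sequence (R x)" and "even T"
    and k: "\<And>x. x \<in> V \<Longrightarrow> k x < 6 \<and> potential_max (R x) = support (k x)"
  shows "\<exists>f0 a0. even_config f0 \<and> (\<Sum>z\<in>disk T. support_length (k z) z T) \<le> discrepancy R f0 a0 (0, 0) T"
proof -
  have par: "same_parity (0, 0) (int T)" using assms(2) by (simp add: same_parity_0)
  obtain f0 a0 where f0: "even_config f0"
    "\<And>x. x \<in> V \<inter> vbox (0, 0) T \<Longrightarrow> contribution R f0 a0 (0, 0) T x = path_length (R x) (x - (0, 0)) T"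
    using path_length_attained[where R = R and B = "V \<inter> vbox (0, 0) T", OF R par] by auto
  have "(\<Sum>x\<in>V \<inter> vbox (0, 0) T. contribution R f0 a0 (0, 0) T x) = (\<Sum>x\<in>V \<inter> vbox (0, 0) T. support_length (k x) x T)"
    by (intro sum.cong refl) (use f0(2) k in \<open>auto simp: path_length_def support_length_def diff_origin\<close>)
  also have "\<dots> = (\<Sum>z\<in>disk T. support_length (k z) z T)"
    using shift_disk[OF zero_in_V, of "\<lambda>z. support_length (k z) z T" T] k zero_in_V
    by (simp add: support_length_origin diff_origin)
  finally show ?thesis
    using f0(1) discrepancy_eq[OF f0(1), of R a0 "(0, 0)" T]
    by (intro exI[of _ f0] exI[of _ a0]) (simp add: discrepancy_def)
qed

text \<open>For properties that persist in time, witnesses for finitely many orbits are merged into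
  one time. It is even because the origin receives chips at even times only.\<close>

lemma common_time:
  assumes "finite J" "\<And>c. c \<in> J \<Longrightarrow> \<exists>T. P c T" "\<And>c S T. c \<in> J \<Longrightarrow> P c S \<Longrightarrow> S \<le> T \<Longrightarrow> P c T"
  shows "\<exists>T\<ge>n. even T \<and> (\<forall>c\<in>J. P c (T :: nat))"
proof -
  obtain t where t: "\<And>c. c \<in> J \<Longrightarrow> P c (t c)" using assms(2) by metis
  define T where "T = 2 * (n + (\<Sum>c\<in>J. t c))"
  have "t c \<le> T" if "c \<in> J" for c
    using member_le_sum[OF that _ assms(1), of t] by (simp add: T_def)
  then have "\<forall>c\<in>J. P c T" using t assms(3) by blast
  then show ?thesis by (intro exI[of _ T]) (auto simp: T_def)
qed

text \<open>Finitely many orbits are given explicit values; all others within reach of the origin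
  contribute at least 0.\<close>

theorem sup_discrepancy_ge:
  assumes N: "rotor_sequence N" and J: "J \<subseteq> cells n"
    and v: "\<And>a b. (a, b) \<in> J \<Longrightarrow> \<exists>T. v a b \<le> orbit_length (circular_rotor N) a b T"
  shows "ereal (\<Sum>(a, b)\<in>J. weight a b * v a b) \<le> sup_discrepancy (\<lambda>_. N)"
proof -
  obtain k where k: "k < 6" "potential_max N = support k" "circular_rotor N \<longleftrightarrow> k < 2"
    using rotor_support[OF N] by blast
  have "finite J" by (rule finite_subset[OF J finite_cells])
  have "\<exists>T\<ge>n. even T \<and> (\<forall>c\<in>J. v (fst c) (snd c) \<le> orbit_length (k < 2) (fst c) (snd c) T)"
  proof (rule common_time[OF \<open>finite J\<close>])
    show "\<exists>T. v (fst c) (snd c) \<le> orbit_length (k < 2) (fst c) (snd c) T" if "c \<in> J" for c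
      using v[of "fst c" "snd c"] that k(3) by simp
    show "v (fst c) (snd c) \<le> orbit_length (k < 2) (fst c) (snd c) T"
      if "v (fst c) (snd c) \<le> orbit_length (k < 2) (fst c) (snd c) S" "S \<le> T" for c S T
      using that(1) orbit_length_mono[OF that(2)] by (rule order.trans)
  qed
  then obtain T where T: "n \<le> T" "even T" "\<And>a b. (a, b) \<in> J \<Longrightarrow> v a b \<le> orbit_length (k < 2) a b T"
    by fastforce
  obtain f0 a0 where f0: "even_config f0"
    "(\<Sum>z\<in>disk T. support_length k z T) \<le> discrepancy (\<lambda>_. N) f0 a0 (0, 0) T"
    using discrepancy_attained[of "\<lambda>_. N" T "\<lambda>_. k"] N T(2) k by auto
  have "cells n \<subseteq> cells T" using T(1) by (auto simp: cells_def)
  have "(\<Sum>(a, b)\<in>J. weight a b * v a b) \<le> (\<Sum>(a, b)\<in>J. weight a b * orbit_length (k < 2) a b T)"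
    using T(3) less_imp_le[OF weight_pos] by (intro sum_mono) (auto intro!: mult_left_mono)
  also have "\<dots> \<le> (\<Sum>(a, b)\<in>cells T. weight a b * orbit_length (k < 2) a b T)"
    using J \<open>cells n \<subseteq> cells T\<close> less_imp_le[OF weight_pos] orbit_length_nonneg
    by (intro sum_mono2) auto
  also have "\<dots> \<le> discrepancy (\<lambda>_. N) f0 a0 (0, 0) T"
    using f0(2) unfolding sum_disk_support_length[OF k(1)] .
  finally have "ereal (\<Sum>(a, b)\<in>J. weight a b * v a b) \<le> ereal (discrepancy (\<lambda>_. N) f0 a0 (0, 0) T)" by simp
  also have "\<dots> \<le> sup_discrepancy (\<lambda>_. N)"
    unfolding sup_discrepancy_def using f0(1) zero_in_V
    by (intro SUP_upper2[of "(f0, a0, (0, 0), T)"]) auto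
  finally show ?thesis .
qed

text \<open>The converse of \<open>support_length_image\<close>: every support function at the
  representative is matched at the image by one index that serves all times.\<close>

lemma image_support_length:
  assumes "j < 6" "z \<in> set (images a b)"
  shows "\<exists>k<6. \<forall>T. support_length k z T = support_length j (int a, int b) T"
proof -
  have "\<exists>k\<in>{0, 1, 2, 3, 4, 5}. \<forall>T. support_length k z T = support_length j (int a, int b) T"
    using assms unfolding less_6_iff images_def Let_def
    by (elim insertE emptyE)
      (auto simp: support_length_flip(1,2) support_length_flip(3)[where x = "int a" and y = "int b"])
  then show ?thesis by force
qed

text \<open>Optimality compares suprema over all run-times, so the time at which another rotor
  sequence does well says nothing about when the optimal one does. Only a strict lower bound can be
  carried over, and the time changes with it.\<close>

lemma optimal_support_length:
  assumes R: "maxcon_optimal R" and z: "z \<in> V" and k: "k < 6" "potential_max (R z) = support k"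
    and j: "j < 6" "v < support_length j z T"
  shows "\<exists>S. v < support_length k z S"
proof -
  have Rs: "\<And>x. x \<in> V \<Longrightarrow> rotor_sequence (R x)" using R by (simp add: maxcon_optimal_def)
  obtain N where N: "rotor_sequence N" "potential_max N = support j" using support_rotor[OF j(1)] by blast
  define R' where "R' = R(z := N)"
  \<comment> \<open>Doubling makes the time even, as attainment at the origin requires, and does not
    shorten the path.\<close>
  define S where "S = 2 * T"
  have S: "v < support_length j z S"
    using j(2) support_length_mono[OF j(1), of T S z] by (simp add: S_def)
  have "\<exists>f0 a0. even_config f0 \<and> (\<forall>x\<in>{z}. contribution R' f0 a0 (0, 0) S x = path_length (R' x) (x - (0, 0)) S)"
  proof (rule path_length_attained)
    show "same_parity (0, 0) (int S)" unfolding same_parity_0 by (simp add: S_def)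
  qed (use Rs N z in \<open>auto simp: R'_def\<close>)
  then obtain f0 a0 where f0: "even_config f0" "con R' f0 a0 S z = support_length j z S"
    using N(2) by (auto simp: con_eq_contribution R'_def path_length_def support_length_def simp add: diff_origin)
  have "ereal v < ereal (con R' f0 a0 S z)" using S f0 by simp
  also have "\<dots> \<le> maxcon R' z"
    unfolding maxcon_def using f0(1) by (intro SUP_upper2[of "(f0, a0, S)"]) auto
  also have "\<dots> \<le> maxcon R z" using R z N(1) by (simp add: maxcon_optimal_def R'_def)
  finally obtain f1 a1 T1 where f1: "even_config f1" "v < con R f1 a1 T1 z"
    unfolding maxcon_def less_SUP_iff by auto
  show ?thesis
  proof (cases "even T1")
    case True
    then have "contribution R f1 a1 (0, 0) T1 z \<le> support_length k (z - (0, 0)) T1"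
      by (intro abs_contribution_le(1)) (use Rs z f1 k in \<open>auto simp: same_parity_0\<close>)
    then show ?thesis using f1(2) by (intro exI[of _ T1]) (simp add: con_eq_contribution diff_origin)
  next
    \<comment> \<open>At an odd time the contribution is 0, so \<open>v\<close> is negative and any
      time serves.\<close>
    case False
    then have "contribution R f1 a1 (0, 0) T1 z = 0"
      by (intro contribution_parity f1) (auto simp: same_parity_0 zero_in_V)
    then show ?thesis using f1(2) support_length_nonneg[OF k(1), of z 0]
      by (intro exI[of _ 0]) (simp add: con_eq_contribution)
  qed
qed

theorem sup_discrepancy_origin_ge:
  assumes R: "maxcon_optimal R" and J: "J \<subseteq> cells n"
    and v: "\<And>a b. (a, b) \<in> J \<Longrightarrow> \<exists>j<6. \<exists>T. v a b < 8 * support_length j (int a, int b) T"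
  shows "ereal (\<Sum>(a, b)\<in>J. weight a b * v a b) \<le> sup_discrepancy_origin R"
proof -
  have Rs: "\<And>x. x \<in> V \<Longrightarrow> rotor_sequence (R x)" using R by (simp add: maxcon_optimal_def)
  obtain k where k: "\<And>x. x \<in> V \<Longrightarrow> k x < 6 \<and> potential_max (R x) = support (k x)"
    using choose_support Rs by blast
  have "finite J" by (rule finite_subset[OF J finite_cells])
  have inV: "z \<in> V" if "(a, b) \<in> cells m" "z \<in> set (images a b)" for a b z m
    using that by (auto simp: images_def Let_def V_iff cells_def)
  have ex: "\<exists>S. v a b < 8 * support_length (k z) z S" if ab: "(a, b) \<in> J" and z: "z \<in> set (images a b)" for a b z
  proof -
    from v[OF ab] obtain j T where "j < 6" "v a b < 8 * support_length j (int a, int b) T" by blast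
    then have j: "j < 6" "v a b / 8 < support_length j (int a, int b) T" by simp_all
    obtain i where i: "i < 6" "\<And>T. support_length i z T = support_length j (int a, int b) T"
      using image_support_length[OF j(1) z] by blast
    have zV: "z \<in> V" using inV J ab z by blast
    then have "\<exists>S. v a b / 8 < support_length (k z) z S"
      using k[OF zV] i j by (intro optimal_support_length[OF R zV, of _ i _ T]) auto
    then show ?thesis by (auto simp: mult.commute)
  qed
  have "\<exists>T\<ge>n. even T \<and> (\<forall>c\<in>J. \<forall>z\<in>set (images (fst c) (snd c)). v (fst c) (snd c) \<le> 8 * support_length (k z) z T)"
  proof (rule common_time[OF \<open>finite J\<close>])
    fix c assume c: "c \<in> J"
    have "\<exists>T\<ge>n. even T \<and> (\<forall>z\<in>set (images (fst c) (snd c)). v (fst c) (snd c) \<le> 8 * support_length (k z) z T)"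
    proof (rule common_time)
      fix z assume z: "z \<in> set (images (fst c) (snd c))"
      show "\<exists>T. v (fst c) (snd c) \<le> 8 * support_length (k z) z T"
        using ex[of "fst c" "snd c" z] c z by (auto intro: less_imp_le)
      fix S T :: nat assume "v (fst c) (snd c) \<le> 8 * support_length (k z) z S" "S \<le> T"
      moreover have "k z < 6" using k inV c z J by (metis prod.collapse subsetD)
      ultimately show "v (fst c) (snd c) \<le> 8 * support_length (k z) z T"
        using support_length_mono[of "k z" S T z] by simp
    qed simp
    then show "\<exists>T. \<forall>z\<in>set (images (fst c) (snd c)). v (fst c) (snd c) \<le> 8 * support_length (k z) z T" by blast
    fix S T :: nat assume *: "\<forall>z\<in>set (images (fst c) (snd c)). v (fst c) (snd c) \<le> 8 * support_length (k z) z S" "S \<le> T"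
    show "\<forall>z\<in>set (images (fst c) (snd c)). v (fst c) (snd c) \<le> 8 * support_length (k z) z T"
    proof
      fix z assume z: "z \<in> set (images (fst c) (snd c))"
      have "k z < 6" using k inV c z J by (metis prod.collapse subsetD)
      then show "v (fst c) (snd c) \<le> 8 * support_length (k z) z T"
        using support_length_mono[of "k z" S T z] * z by fastforce
    qed
  qed
  then obtain T where T: "n \<le> T" "even T"
    "\<And>a b z. (a, b) \<in> J \<Longrightarrow> z \<in> set (images a b) \<Longrightarrow> v a b \<le> 8 * support_length (k z) z T"
    by fastforce
  obtain f0 a0 where f0: "even_config f0"
    "(\<Sum>z\<in>disk T. support_length (k z) z T) \<le> discrepancy R f0 a0 (0, 0) T"
    using discrepancy_attained[where R = R and k = k, OF Rs T(2) k] by auto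
  have "cells n \<subseteq> cells T" using T(1) by (auto simp: cells_def)
  have "(\<Sum>(a, b)\<in>J. weight a b * v a b) \<le> (\<Sum>(a, b)\<in>J. weight a b * (\<Sum>z\<leftarrow>images a b. support_length (k z) z T))"
  proof (intro sum_mono, clarify)
    fix a b assume ab: "(a, b) \<in> J"
    have "(\<Sum>z\<leftarrow>images a b. v a b / 8) \<le> (\<Sum>z\<leftarrow>images a b. support_length (k z) z T)"
      using T(3)[OF ab] by (intro sum_list_mono) fastforce
    then have "v a b \<le> (\<Sum>z\<leftarrow>images a b. support_length (k z) z T)" by (simp add: images_def Let_def)
    then show "weight a b * v a b \<le> weight a b * (\<Sum>z\<leftarrow>images a b. support_length (k z) z T)"
      using less_imp_le[OF weight_pos] by (intro mult_left_mono)
  qed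
  also have "\<dots> \<le> (\<Sum>(a, b)\<in>cells T. weight a b * (\<Sum>z\<leftarrow>images a b. support_length (k z) z T))"
  proof (rule sum_mono2)
    fix c assume "c \<in> cells T - J"
    then have "0 \<le> support_length (k z) z T" if "z \<in> set (images (fst c) (snd c))" for z
      using k inV that by (metis DiffD1 prod.collapse support_length_nonneg)
    then show "0 \<le> (case c of (a, b) \<Rightarrow> weight a b * (\<Sum>z\<leftarrow>images a b. support_length (k z) z T))"
      using less_imp_le[OF weight_pos] by (auto simp: case_prod_unfold intro!: mult_nonneg_nonneg sum_list_nonneg)
  qed (use J \<open>cells n \<subseteq> cells T\<close> in auto)
  also have "\<dots> \<le> discrepancy R f0 a0 (0, 0) T"
    using f0(2) unfolding sum_disk .
  finally have "ereal (\<Sum>(a, b)\<in>J. weight a b * v a b) \<le> ereal (discrepancy R f0 a0 (0, 0) T)" by simp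
  also have "\<dots> \<le> sup_discrepancy_origin R"
    unfolding sup_discrepancy_origin_def using f0(1)
    by (intro SUP_upper2[of "(f0, a0, T)"]) auto
  finally show ?thesis .
qed

section \<open>The path after its last turn\<close>

lemma chain_length_map: "chain_length k w v (map f ms) = chain_length k (\<lambda>m. w (f m)) v ms"
  by (induction ms arbitrary: v) auto

lemma chain_length_upt:
  "chain_length k w (w s) [Suc s..<Suc (s + n)] = (\<Sum>i=s..<s + n. support k (w (Suc i) - w i)) + support k (- w (s + n))"
proof (induction n arbitrary: s)
  case (Suc n)
  have "[Suc s..<Suc (s + Suc n)] = Suc s # [Suc (Suc s)..<Suc (Suc s + n)]"
    by (subst upt_conv_Cons) auto
  then show ?case using Suc[of "Suc s"] by (simp add: sum.atLeast_Suc_lessThan)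
qed simp

text \<open>Before time \<open>a\<close> the walk cannot reach the origin and the moments vanish;
  afterwards they move only every second step. Sampling at \<open>a, a + 2, ...\<close> therefore
  loses nothing.\<close>

lemma support_length_eq_chain:
  assumes "even (a + b)" "k < 6" "a > 0" "b \<le> a"
  shows "support_length k (int a, int b) (a + 2 * M) =
    chain_length k (influence_vec (int a, int b)) 0 (map (\<lambda>m. a + 2 * m) [0..<Suc M])"
proof -
  define p where "p = path_vec (int a, int b)"
  have par: "same_parity (int a, int b) (int t) \<longleftrightarrow> even (t + a)" for t
    using assms(1) by (auto simp: same_parity_iff)
  have p_good: "p (a + 2 * m) = influence_vec (int a, int b) (a + 2 * m)" for m
    using par[of "a + 2 * m"] by (simp add: p_def path_vec_def)
  have p_hold: "p (Suc (a + 2 * m)) = p (a + 2 * m)" for m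
    using par[of "a + 2 * m"] par[of "Suc (a + 2 * m)"] by (simp add: p_def path_vec_def)
  have p_zero: "p t = 0" if "t < a" for t
    using that path_vec_held[OF assms(1), of t]
    by (simp add: p_def held_def gval_eq_0 hval_eq_0 zero_prod_def)
  have "(\<Sum>t<a. support k (p (Suc t) - p t)) = support k (p a)"
  proof -
    obtain a' where a: "a = Suc a'" using assms(3) gr0_conv_Suc by blast
    have "(\<Sum>t<a'. support k (p (Suc t) - p t)) = (\<Sum>t<a'. 0)"
      using assms(2) a by (intro sum.cong) (auto simp: p_zero)
    then show ?thesis using p_zero[of a'] a by simp
  qed
  moreover have "(\<Sum>t<a + 2 * M. support k (p (Suc t) - p t)) =
      (\<Sum>t<a. support k (p (Suc t) - p t)) + (\<Sum>m<M. support k (p (a + 2 * Suc m) - p (a + 2 * m)))" for M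
  proof (induction M)
    case (Suc M)
    have "(\<Sum>t<a + 2 * Suc M. support k (p (Suc t) - p t)) = (\<Sum>t<a + 2 * M. support k (p (Suc t) - p t))
        + support k (p (Suc (a + 2 * M)) - p (a + 2 * M)) + support k (p (a + 2 * Suc M) - p (Suc (a + 2 * M)))"
      by simp
    then show ?case using Suc assms(2) unfolding p_hold by simp
  qed simp
  ultimately have "support_length k (int a, int b) (a + 2 * M) =
      support k (p a) + (\<Sum>m<M. support k (p (a + 2 * Suc m) - p (a + 2 * m))) + support k (- p (a + 2 * M))"
    by (simp add: support_length_def p_def)
  moreover have "chain_length k (\<lambda>m. p (a + 2 * m)) 0 [0..<Suc M] =
      support k (p a) + ((\<Sum>m<M. support k (p (a + 2 * Suc m) - p (a + 2 * m))) + support k (- p (a + 2 * M)))"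
    using chain_length_upt[of k "\<lambda>m. p (a + 2 * m)" 0 M] by (simp add: upt_conv_Cons lessThan_atLeast0 del: upt_Suc)
  ultimately show ?thesis by (simp add: chain_length_map p_good del: upt_Suc)
qed

text \<open>Late in the process every increment is maximized by the same direction, so that the support
  function is additive along the rest of the path.\<close>

lemma support_late:
  fixes X Y Z :: real
  assumes "0 \<le> Y" "Y \<le> X" "0 \<le> Z"
  shows "support 0 (- X, - Y, - Z) = X + Z / 2" "support 4 (- X, - Y, - Z) = X + Z"
    "Z \<le> X - Y \<Longrightarrow> support 1 (- X, - Y, - Z) = X - Z / 2" "Z \<le> X - Y \<Longrightarrow> support 2 (- X, - Y, - Z) = X"
    "Z \<le> X + Y \<Longrightarrow> support 3 (- X, - Y, - Z) = X" "Z \<le> X + Y \<Longrightarrow> support 5 (- X, - Y, - Z) = Y"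
    "X = Y \<Longrightarrow> support 1 (- X, - Y, - Z) = X + Z / 2" "X = Y \<Longrightarrow> support 2 (- X, - Y, - Z) = X + Z"
proof -
  have abs: "\<bar>- X\<bar> = X" "\<bar>- Y\<bar> = Y" "\<bar>- Z\<bar> = Z" using assms by auto
  show "support 0 (- X, - Y, - Z) = X + Z / 2" "support 4 (- X, - Y, - Z) = X + Z"
    using assms unfolding support_simps abs by (simp_all add: max_def)
  show "support 1 (- X, - Y, - Z) = X - Z / 2" "support 2 (- X, - Y, - Z) = X" if "Z \<le> X - Y"
    using assms that unfolding support_simps abs by (simp_all add: max_def)
  show "support 3 (- X, - Y, - Z) = X" "support 5 (- X, - Y, - Z) = Y" if "Z \<le> X + Y"
    using assms that unfolding support_simps abs by (simp_all add: max_def)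
  show "support 1 (- X, - Y, - Z) = X + Z / 2" "support 2 (- X, - Y, - Z) = X + Z" if "X = Y"
    using assms that unfolding support_simps abs by (simp_all add: max_def)
qed

text \<open>The alternatives are vertices off and on the diagonal. On the diagonal
  \<open>X = Y\<close> leaves no room for \<open>Z <= X - Y\<close>, but there the maxima in the
  functions 1 and 2 are attained by the other argument throughout.\<close>

lemma support_additive:
  fixes X Y Z X' Y' Z' :: real
  assumes "k < 6" "0 \<le> Y" "Y \<le> X" "0 \<le> Z" "0 \<le> Y'" "Y' \<le> X'" "0 \<le> Z'"
    and "Z \<le> X - Y \<and> Z' \<le> X' - Y' \<or> X = Y \<and> X' = Y' \<and> Z \<le> 2 * X \<and> Z' \<le> 2 * X'"
  shows "support k (- X, - Y, - Z) + support k (- X', - Y', - Z') = support k (- (X + X'), - (Y + Y'), - (Z + Z'))"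
proof -
  have sum: "0 \<le> Y + Y'" "Y + Y' \<le> X + X'" "0 \<le> Z + Z'" using assms by auto
  note S = support_late[OF assms(2-4)] support_late[OF assms(5-7)] support_late[OF sum]
  have le: "Z \<le> X + Y" "Z' \<le> X' + Y'" "Z + Z' \<le> X + X' + (Y + Y')" using assms by auto
  have k: "k \<in> {0, 1, 2, 3, 4, 5}" using assms(1) by auto
  from assms(8) show ?thesis
  proof (elim disjE conjE)
    assume *: "Z \<le> X - Y" "Z' \<le> X' - Y'"
    then have "Z + Z' \<le> X + X' - (Y + Y')" by simp
    show ?thesis using k
      by (elim insertE emptyE) (simp_all only: S * le \<open>Z + Z' \<le> X + X' - (Y + Y')\<close>, simp_all add: add_divide_distrib)
  next
    assume *: "X = Y" "X' = Y'"
    then have eq: "X + X' = Y + Y'" by simp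
    show ?thesis using k
      by (elim insertE emptyE) (simp_all only: S(1,2,9,10,17,18) S(5,6)[OF le(1)]
        S(13,14)[OF le(2)] S(21,22)[OF le(3)] S(7,8)[OF *(1)] S(15,16)[OF *(2)] S(23,24)[OF eq], simp_all add: add_divide_distrib)
  qed
qed

lemma hval_eq: "hval a b t = gval a b t / real t"
  by (simp add: hval_def gval_def power2_eq_square)

text \<open>The hypotheses of \<open>support_additive\<close> are needed for the next decrement and
  for the remaining vector. Off the diagonal \<open>a - b >= 2\<close> by parity, so
  \<open>c = a * b\<close> and the factor 2 give \<open>Z <= X - Y\<close>; on the diagonal
  \<open>c = a\<close> gives \<open>Z <= 2 * X\<close>.\<close>

lemma late_condition:
  fixes c :: real
  assumes "b \<le> a" "a \<le> t" "t > 0" "c \<ge> 0" "c \<le> 2 * real t" "(real a)\<^sup>2 + (real b)\<^sup>2 \<le> 4 * real t + 3"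
    and "2 * c * real t \<le> (2 * real t - c) * (4 * real t + 3 - ((real a)\<^sup>2 + (real b)\<^sup>2))"
  shows "c * (hval a b t - hval a b (t + 2)) \<le> 2 * (gval a b t - gval a b (t + 2))"
    and "c * hval a b (t + 2) \<le> 2 * gval a b (t + 2)"
    and "gval a b (t + 2) \<le> gval a b t" and "hval a b (t + 2) \<le> hval a b t"
proof -
  define u where "u = real t + 2"
  have u: "u > 2" "real t = u - 2" "real t + 1 = u - 1" using assms(3) by (auto simp: u_def)
  define r where "r = (real a)\<^sup>2 + (real b)\<^sup>2"
  define P where "P = gpoly (real a) (real b) u"
  define X where "X = u * ((u\<^sup>2 - (real a)\<^sup>2) * (u\<^sup>2 - (real b)\<^sup>2))"
  define Y where "Y = ((u - 1) * u)\<^sup>2 * (u - 2)"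
  define g g' where "g = gval a b t" and "g' = gval a b (t + 2)"
  have hg: "hval a b t = g / real t" "hval a b (t + 2) = g' / u"
  proof -
    have "real (t + 2) = u" by (simp add: u_def)
    then show "hval a b (t + 2) = g' / u"
      by (simp only: hval_eq g'_def)
    show "hval a b t = g / real t" by (simp add: hval_eq g_def)
  qed
  have g0: "g' \<ge> 0" "g \<ge> 0" by (simp_all add: g_def g'_def gval_nonneg)
  have gX: "g' * X = g * Y"
    using gval_Suc_Suc(1)[OF assms(3), of a b] unfolding u_def[symmetric] unfolding u(3) unfolding u(2)
    by (simp add: g_def g'_def X_def Y_def u_def)
  have XY: "X - Y = u * P"
    by (simp add: X_def Y_def P_def gpoly_def power2_eq_square power3_eq_cube algebra_simps)
  have Y: "Y > 0" using u by (simp add: Y_def)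
  have "u\<^sup>2 * (4 * u - 5 - r) \<le> P"
    using u by (simp add: P_def gpoly_def r_def power2_eq_square power3_eq_cube algebra_simps)
  moreover have Q: "0 \<le> 4 * u - 5 - r" "4 * u - 5 - r = 4 * real t + 3 - r"
    using assms(6) by (simp_all add: r_def u_def)
  moreover have sq: "(u - 1)\<^sup>2 \<le> u\<^sup>2" using u by (intro power_mono) auto
  ultimately have P1: "(u - 1)\<^sup>2 * (4 * u - 5 - r) \<le> P"
    by (meson mult_right_mono order.trans)
  then have P0: "0 \<le> P" using Q(1) by (meson mult_nonneg_nonneg order.trans zero_le_power2)
  \<comment> \<open>The decrease of \<open>gval\<close> is expressed by the cubic \<open>P\<close>,
    of which only the part u^2 (4 u - 5 - r) is kept in the bound above; the dropped terms are
    nonnegative.\<close>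
  have dY: "(g - g') * Y = g' * (u * P)"
    using gX XY by (simp add: algebra_simps)
  then have "0 \<le> (g - g') * Y" using g0 P0 u by simp
  then have d0: "0 \<le> g - g'" using Y by (simp add: zero_le_mult_iff)
  have "2 * c * real t * (u - 1)\<^sup>2 \<le> (2 * real t - c) * (4 * u - 5 - r) * (u - 1)\<^sup>2"
    using assms(7) unfolding r_def[symmetric] Q(2) by (intro mult_right_mono) auto
  also have "\<dots> \<le> (2 * real t - c) * P"
    using mult_left_mono[OF P1, of "2 * real t - c"] assms(5) by (simp add: mult_ac)
  finally have "g' * u\<^sup>2 * (2 * c * real t * (u - 1)\<^sup>2) \<le> g' * u\<^sup>2 * ((2 * real t - c) * P)"
    using g0 by (intro mult_left_mono) auto
  then have "2 * c * g' * Y \<le> (2 * real t - c) * u * ((g - g') * Y)"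
    unfolding dY by (simp add: Y_def u(2) power2_eq_square power_mult_distrib mult_ac)
  then have "(2 * c * g') * Y \<le> ((2 * real t - c) * u * (g - g')) * Y" by (simp add: mult.assoc)
  then have key: "2 * c * g' \<le> (2 * real t - c) * u * (g - g')" using Y by simp
  have t: "real t > 0" using assms(3) by simp
  have e: "g / real t - g' / u = ((g - g') * u + 2 * g') / (real t * u)"
  proof -
    have "(g - g') * u + 2 * g' = g * u - g' * real t" unfolding u(2) by (simp add: algebra_simps)
    then show ?thesis using t u(1) by (simp add: diff_frac_eq)
  qed
  have "c * ((g - g') * u + 2 * g') \<le> 2 * (g - g') * (real t * u)"
    using key by (simp add: algebra_simps)
  then have "c * (((g - g') * u + 2 * g') / (real t * u)) \<le> 2 * (g - g')"
    using t u(1) by (simp add: pos_divide_le_eq)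
  then show "c * (hval a b t - hval a b (t + 2)) \<le> 2 * (gval a b t - gval a b (t + 2))"
    unfolding hg e g_def[symmetric] g'_def[symmetric] .
  show "c * hval a b (t + 2) \<le> 2 * gval a b (t + 2)"
  proof -
    have "c * g' \<le> 2 * u * g'" using assms(5) u g0 by (intro mult_right_mono) auto
    then show ?thesis unfolding hg g'_def[symmetric] using u(1) by (simp add: pos_divide_le_eq mult_ac)
  qed
  show "gval a b (t + 2) \<le> gval a b t" using d0 by (simp add: g_def g'_def)
  have "g' / u \<le> g / real t" using d0 g0 t u by (intro frac_le) auto
  then show "hval a b (t + 2) \<le> hval a b t" by (simp only: hg)
qed

text \<open>The hypotheses of \<open>late_condition\<close> over the integers, fit for evaluation.
  The last conjunct makes the linear coefficient in \<open>t\<close> of the quadratic inequality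
  nonnegative, so that the condition persists.\<close>

definition late_time :: "int \<Rightarrow> int \<Rightarrow> int \<Rightarrow> bool" where
  "late_time a b t \<longleftrightarrow> (let c = (if a = b then a else a * b); P = 2 * t - c; Q = 4 * t + 3 - (a\<^sup>2 + b\<^sup>2)
     in a \<le> t \<and> 0 < t \<and> 0 \<le> P \<and> 0 \<le> Q \<and> 2 * c * t \<le> P * Q \<and> c \<le> Q + 2 * P)"

lemma late_time_mono:
  assumes "late_time a b s" "s \<le> t"
  shows "late_time a b t"
proof -
  define c r where "c = (if a = b then a else a * b)" and "r = a\<^sup>2 + b\<^sup>2"
  define d where "d = t - s"
  have d: "d \<ge> 0" "t = s + d" using assms(2) by (auto simp: d_def)
  have s: "a \<le> s" "0 < s" "0 \<le> 2 * s - c" "0 \<le> 4 * s + 3 - r" "2 * c * s \<le> (2 * s - c) * (4 * s + 3 - r)"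
    "c \<le> (4 * s + 3 - r) + 2 * (2 * s - c)"
    using assms(1) by (simp_all add: late_time_def Let_def c_def r_def)
  have "(2 * t - c) * (4 * t + 3 - r) - 2 * c * t =
      ((2 * s - c) * (4 * s + 3 - r) - 2 * c * s) + d * (2 * ((4 * s + 3 - r) + 2 * (2 * s - c) - c)) + 8 * (d * d)"
    unfolding d(2) by (simp add: algebra_simps)
  moreover have "0 \<le> d * (2 * ((4 * s + 3 - r) + 2 * (2 * s - c) - c))" using d s by simp
  moreover have "0 \<le> 8 * (d * d)" by simp
  ultimately have "2 * c * t \<le> (2 * t - c) * (4 * t + 3 - r)" using s(5) by linarith
  moreover have "a \<le> t" "0 < t" "0 \<le> 2 * t - c" "0 \<le> 4 * t + 3 - r" "c \<le> (4 * t + 3 - r) + 2 * (2 * t - c)"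
    using s d by auto
  ultimately show ?thesis by (simp add: late_time_def Let_def flip: c_def r_def)
qed

text \<open>Past a late time, the segment to the next sample and the one from there to 0 add up to
  the segment to 0. Further samples leave the length unchanged, and monotonicity covers all other
  run-times.\<close>

lemma support_length_late:
  assumes "even (a + b)" "b \<le> a" "a > 0" "k < 6" "late_time a b (int (a + 2 * M))"
  shows "support_length k (int a, int b) T \<le>
    chain_length k (influence_vec (int a, int b)) 0 (map (\<lambda>m. a + 2 * m) [0..<Suc M])"
proof -
  define L where "L m = support_length k (int a, int b) (a + 2 * m)" for m
  have step: "L (Suc m) \<le> L m" if "m \<ge> M" for m
  proof -
    define t where "t = a + 2 * m"
    have late: "late_time a b (int t)"
      by (rule late_time_mono[OF assms(5)]) (use that in \<open>simp add: t_def\<close>)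
    define ci where "ci = (if a = b then int a else int a * int b)"
    define c where "c = (if a = b then real a else real a * real b)"
    have ci: "real_of_int ci = c" by (simp add: c_def ci_def)
    have L: "int a \<le> int t" "0 < int t" "ci \<le> 2 * int t" "(int a)\<^sup>2 + (int b)\<^sup>2 \<le> 4 * int t + 3"
      "2 * ci * int t \<le> (2 * int t - ci) * (4 * int t + 3 - ((int a)\<^sup>2 + (int b)\<^sup>2))"
      using late by (simp_all add: late_time_def Let_def ci_def)
    have c: "a \<le> t" "0 < t" using L(1,2) by simp_all
    have "real_of_int ci \<le> real_of_int (2 * int t)" using L(3) by (simp only: of_int_le_iff)
    moreover have "real_of_int ((int a)\<^sup>2 + (int b)\<^sup>2) \<le> real_of_int (4 * int t + 3)" using L(4) by (simp only: of_int_le_iff)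
    moreover have "real_of_int (2 * ci * int t) \<le> real_of_int ((2 * int t - ci) * (4 * int t + 3 - ((int a)\<^sup>2 + (int b)\<^sup>2)))"
      using L(5) by (simp only: of_int_le_iff)
    ultimately have c': "c \<le> 2 * real t" "(real a)\<^sup>2 + (real b)\<^sup>2 \<le> 4 * real t + 3"
      "2 * c * real t \<le> (2 * real t - c) * (4 * real t + 3 - ((real a)\<^sup>2 + (real b)\<^sup>2))"
      by (simp_all add: ci)
    have c0: "c \<ge> 0" by (simp add: c_def)
    note lc = late_condition[OF assms(2) c c0 c']
    define d e g h where "d = gval a b t - gval a b (t + 2)" and "e = hval a b t - hval a b (t + 2)"
      and "g = gval a b (t + 2)" and "h = hval a b (t + 2)"
    have nn: "d \<ge> 0" "e \<ge> 0" "g \<ge> 0" "h \<ge> 0" "c * e \<le> 2 * d" "c * h \<le> 2 * g"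
      using lc by (auto simp: d_def e_def g_def h_def gval_nonneg hval_nonneg)
    have "support k (- (a * d), - (b * d), - (a * b * e)) + support k (- (a * g), - (b * g), - (a * b * h)) =
        support k (- (a * d + a * g), - (b * d + b * g), - (a * b * e + a * b * h))"
    proof (rule support_additive[OF assms(4)])
      show "a * b * e \<le> a * d - b * d \<and> a * b * h \<le> a * g - b * g \<or>
        real a * d = b * d \<and> real a * g = b * g \<and> a * b * e \<le> 2 * (a * d) \<and> a * b * h \<le> 2 * (a * g)"
      proof (cases "a = b")
        case True
        have "real a * (a * e) \<le> a * (2 * d)" "real a * (a * h) \<le> a * (2 * g)"
          using nn True by (auto intro!: mult_left_mono simp: c_def)
        then show ?thesis using True by (simp add: mult_ac)
      next
        case False
        then have "b + 2 \<le> a" using assms(1,2) by presburger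
        then have ab: "2 \<le> real a - real b" by linarith
        have "2 * d \<le> (real a - real b) * d" "2 * g \<le> (real a - real b) * g"
          using nn ab by (auto intro!: mult_right_mono)
        then show ?thesis using nn False by (simp add: c_def algebra_simps)
      qed
    qed (use nn assms(2) in \<open>auto intro!: mult_right_mono\<close>)
    moreover have "influence_vec (int a, int b) (t + 2) - influence_vec (int a, int b) t = (- (a * d), - (b * d), - (a * b * e))"
      by (simp add: influence_vec_nat d_def e_def algebra_simps)
    moreover have "- influence_vec (int a, int b) (t + 2) = (- (a * g), - (b * g), - (a * b * h))"
      by (simp add: influence_vec_nat g_def h_def)
    moreover have "- influence_vec (int a, int b) t = (- (a * d + a * g), - (b * d + b * g), - (a * b * e + a * b * h))"
      by (simp add: influence_vec_nat d_def e_def g_def h_def algebra_simps)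
    ultimately have add: "support k (influence_vec (int a, int b) (t + 2) - influence_vec (int a, int b) t)
        + support k (- influence_vec (int a, int b) (t + 2)) = support k (- influence_vec (int a, int b) t)" by simp
    have par: "same_parity (int a, int b) (int s) \<longleftrightarrow> even (s + a)" for s
      using assms(1) by (auto simp: same_parity_iff)
    have "even (t + a)" by (simp add: t_def)
    then have p: "path_vec (int a, int b) t = influence_vec (int a, int b) t"
      "path_vec (int a, int b) (Suc t) = influence_vec (int a, int b) t"
      "path_vec (int a, int b) (Suc (Suc t)) = influence_vec (int a, int b) (t + 2)"
      using par[of t] par[of "Suc t"] par[of "Suc (Suc t)"] by (simp_all add: path_vec_def)
    have "support_length k (int a, int b) (Suc (Suc t)) = support_length k (int a, int b) t"
      using add assms(4) by (simp add: support_length_def p)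
    then show ?thesis by (simp add: L_def t_def)
  qed
  have dec: "L m \<le> L M" if "m \<ge> M" for m
    using that by (induction m rule: dec_induct) (auto intro: order.trans[OF step])
  have "support_length k (int a, int b) T \<le> L (M + T)"
    unfolding L_def using assms(4) by (intro support_length_mono) auto
  also have "\<dots> \<le> L M" by (rule dec) simp
  finally show ?thesis unfolding L_def support_length_eq_chain[OF assms(1,4,3,2)] .
qed

section \<open>Sums over distant orbits\<close>

text \<open>Consecutive cells of a column differ by 2 in \<open>a\<close>, so differences between
  \<open>a - 1\<close> and \<open>a + 1\<close> telescope. With the shift +1 the denominators
  satisfy D E = r^2 + 4 b^2 + 4, which errs on the right side.\<close>

lemma telescope_lower:
  fixes a b :: real
  assumes "a > 0"
  shows "1 / ((a - 1)\<^sup>2 + b\<^sup>2 + 1) - 1 / ((a + 1)\<^sup>2 + b\<^sup>2 + 1) \<le> 4 * a / (a\<^sup>2 + b\<^sup>2)\<^sup>2"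
proof -
  define D E r where "D = (a - 1)\<^sup>2 + b\<^sup>2 + 1" and "E = (a + 1)\<^sup>2 + b\<^sup>2 + 1" and "r = a\<^sup>2 + b\<^sup>2"
  have pos: "D > 0" "E > 0" "r > 0" using assms by (auto simp: D_def E_def r_def add_nonneg_pos add_pos_nonneg)
  have "D * E = r\<^sup>2 + 4 * b\<^sup>2 + 4"
    by (simp add: D_def E_def r_def power2_eq_square algebra_simps)
  then have "r\<^sup>2 \<le> D * E" by simp
  then have "4 * a / (D * E) \<le> 4 * a / r\<^sup>2" using assms pos by (intro divide_left_mono) auto
  moreover have "1 / D - 1 / E = 4 * a / (D * E)"
    using pos by (simp add: diff_frac_eq) (simp add: D_def E_def power2_eq_square algebra_simps)
  ultimately show ?thesis by (simp add: D_def E_def r_def)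
qed

text \<open>With the shift -1 the denominators are r - 2 a and r + 2 a, whose product r^2 - 4 a^2
  errs on the other side. The cubic version multiplies by 2 r / r^2, which is at most 1/D +
  1/E.\<close>

lemma telescope_upper:
  fixes a b c :: real
  assumes "a > 0" "(a - 1)\<^sup>2 + b\<^sup>2 - 1 - c > 0"
  shows "4 * a / (a\<^sup>2 + b\<^sup>2 - c)\<^sup>2 \<le> 1 / ((a - 1)\<^sup>2 + b\<^sup>2 - 1 - c) - 1 / ((a + 1)\<^sup>2 + b\<^sup>2 - 1 - c)"
    and "8 * a / (a\<^sup>2 + b\<^sup>2 - c) ^ 3 \<le> 1 / ((a - 1)\<^sup>2 + b\<^sup>2 - 1 - c)\<^sup>2 - 1 / ((a + 1)\<^sup>2 + b\<^sup>2 - 1 - c)\<^sup>2"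
proof -
  define D E r where "D = (a - 1)\<^sup>2 + b\<^sup>2 - 1 - c" and "E = (a + 1)\<^sup>2 + b\<^sup>2 - 1 - c" and "r = a\<^sup>2 + b\<^sup>2 - c"
  have ED: "E = D + 4 * a" and sum: "D + E = 2 * r"
    by (simp_all add: D_def E_def r_def power2_eq_square algebra_simps)
  have pos: "D > 0" "E > 0" "r > 0" using assms ED sum by (auto simp: D_def)
  have "D * E = r\<^sup>2 - 4 * a\<^sup>2"
    by (simp add: D_def E_def r_def power2_eq_square algebra_simps)
  then have DE: "D * E \<le> r\<^sup>2" by simp
  have "4 * a / r\<^sup>2 \<le> 4 * a / (D * E)" using assms pos DE by (intro divide_left_mono) auto
  also have eq: "4 * a / (D * E) = 1 / D - 1 / E"
    using pos ED by (simp add: diff_frac_eq)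
  finally show "4 * a / (a\<^sup>2 + b\<^sup>2 - c)\<^sup>2 \<le> 1 / ((a - 1)\<^sup>2 + b\<^sup>2 - 1 - c) - 1 / ((a + 1)\<^sup>2 + b\<^sup>2 - 1 - c)"
    by (simp add: D_def E_def r_def)
  have "8 * a / r ^ 3 = (4 * a / r\<^sup>2) * (2 * r / r\<^sup>2)"
    using pos by (simp add: power2_eq_square power3_eq_cube)
  also have "\<dots> \<le> (4 * a / (D * E)) * (2 * r / (D * E))"
    using assms pos DE by (intro mult_mono divide_left_mono) auto
  also have "2 * r / (D * E) = 1 / D + 1 / E"
    using pos unfolding sum[symmetric] by (simp add: field_simps)
  also have "4 * a / (D * E) * (1 / D + 1 / E) = 1 / D\<^sup>2 - 1 / E\<^sup>2"
    unfolding eq by (simp add: power2_eq_square algebra_simps)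
  finally show "8 * a / (a\<^sup>2 + b\<^sup>2 - c) ^ 3 \<le> 1 / ((a - 1)\<^sup>2 + b\<^sup>2 - 1 - c)\<^sup>2 - 1 / ((a + 1)\<^sup>2 + b\<^sup>2 - 1 - c)\<^sup>2"
    by (simp add: D_def E_def r_def)
qed

lemma sum_telescope_ge:
  fixes f G :: "nat \<Rightarrow> real"
  assumes "\<And>i. i < n \<Longrightarrow> G i - G (Suc i) \<le> f i"
  shows "G 0 - G n \<le> (\<Sum>i<n. f i)"
  using sum_mono[of "{..<n}" "\<lambda>i. G i - G (Suc i)" f] assms sum_lessThan_telescope'[of G n] by simp

lemma sum_telescope_le:
  fixes f G :: "nat \<Rightarrow> real"
  assumes "\<And>i. i < n \<Longrightarrow> f i \<le> G i - G (Suc i)"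
  shows "(\<Sum>i<n. f i) \<le> G 0 - G n"
  using sum_mono[of "{..<n}" f "\<lambda>i. G i - G (Suc i)"] assms sum_lessThan_telescope'[of G n] by simp

text \<open>The bound for the cut-off tail is crude, but it depends neither on \<open>m\<close> nor
  on \<open>b\<close> and can be summed over many columns.\<close>

lemma column_lower:
  assumes "m > 0"
  shows "1 / ((real m - 1)\<^sup>2 + b\<^sup>2 + 1) - 1 / (4 * (real n)\<^sup>2 + 1)
    \<le> (\<Sum>i<n. 4 * real (m + 2 * i) / ((real (m + 2 * i))\<^sup>2 + b\<^sup>2)\<^sup>2)"
proof -
  define G where "G i = 1 / ((real (m + 2 * i) - 1)\<^sup>2 + b\<^sup>2 + 1)" for i
  have "G 0 - G n \<le> (\<Sum>i<n. 4 * real (m + 2 * i) / ((real (m + 2 * i))\<^sup>2 + b\<^sup>2)\<^sup>2)"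
  proof (rule sum_telescope_ge)
    fix i
    have "real (m + 2 * Suc i) - 1 = real (m + 2 * i) + 1" by simp
    then show "G i - G (Suc i) \<le> 4 * real (m + 2 * i) / ((real (m + 2 * i))\<^sup>2 + b\<^sup>2)\<^sup>2"
      using telescope_lower[of "real (m + 2 * i)" b] assms by (simp only: G_def)
  qed
  moreover have "G n \<le> 1 / (4 * (real n)\<^sup>2 + 1)"
  proof -
    have "(2 * real n)\<^sup>2 = 4 * (real n)\<^sup>2" by (simp add: power_mult_distrib)
    moreover have "(2 * real n)\<^sup>2 \<le> (real (m + 2 * n) - 1)\<^sup>2" using assms by (intro power_mono) auto
    ultimately have "4 * (real n)\<^sup>2 + 1 \<le> (real (m + 2 * n) - 1)\<^sup>2 + b\<^sup>2 + 1"
      using zero_le_power2[of b] by linarith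
    then show ?thesis unfolding G_def by (intro divide_left_mono) (auto intro!: mult_pos_pos add_nonneg_pos)
  qed
  moreover have "G 0 = 1 / ((real m - 1)\<^sup>2 + b\<^sup>2 + 1)" by (simp add: G_def)
  ultimately show ?thesis by linarith
qed

lemma column_upper:
  assumes "m > 0" "(real m - 1)\<^sup>2 + b\<^sup>2 - 1 - c > 0"
  shows "(\<Sum>i<n. 4 * real (m + 2 * i) / ((real (m + 2 * i))\<^sup>2 + b\<^sup>2 - c)\<^sup>2) \<le> 1 / ((real m - 1)\<^sup>2 + b\<^sup>2 - 1 - c)"
    and "(\<Sum>i<n. 8 * real (m + 2 * i) / ((real (m + 2 * i))\<^sup>2 + b\<^sup>2 - c) ^ 3) \<le> 1 / ((real m - 1)\<^sup>2 + b\<^sup>2 - 1 - c)\<^sup>2"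
proof -
  define D where "D i = (real (m + 2 * i) - 1)\<^sup>2 + b\<^sup>2 - 1 - c" for i
  have D: "D i > 0" for i
  proof -
    have "(real m - 1)\<^sup>2 \<le> (real (m + 2 * i) - 1)\<^sup>2" using assms(1) by (intro power_mono) auto
    then show ?thesis using assms(2) unfolding D_def by linarith
  qed
  have DS: "D (Suc i) = (real (m + 2 * i) + 1)\<^sup>2 + b\<^sup>2 - 1 - c" for i by (simp add: D_def)
  have tel: "4 * real (m + 2 * i) / ((real (m + 2 * i))\<^sup>2 + b\<^sup>2 - c)\<^sup>2 \<le> 1 / D i - 1 / D (Suc i)"
    "8 * real (m + 2 * i) / ((real (m + 2 * i))\<^sup>2 + b\<^sup>2 - c) ^ 3 \<le> 1 / (D i)\<^sup>2 - 1 / (D (Suc i))\<^sup>2" for i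
    using telescope_upper[of "real (m + 2 * i)" b c] D[of i] assms(1) unfolding DS unfolding D_def by auto
  have "(\<Sum>i<n. 4 * real (m + 2 * i) / ((real (m + 2 * i))\<^sup>2 + b\<^sup>2 - c)\<^sup>2) \<le> 1 / D 0 - 1 / D n"
    by (rule sum_telescope_le) (rule tel(1))
  also have "\<dots> \<le> 1 / D 0" using D[of n] by simp
  finally show "(\<Sum>i<n. 4 * real (m + 2 * i) / ((real (m + 2 * i))\<^sup>2 + b\<^sup>2 - c)\<^sup>2) \<le> 1 / ((real m - 1)\<^sup>2 + b\<^sup>2 - 1 - c)"
    by (simp add: D_def)
  have "(\<Sum>i<n. 8 * real (m + 2 * i) / ((real (m + 2 * i))\<^sup>2 + b\<^sup>2 - c) ^ 3) \<le> 1 / (D 0)\<^sup>2 - 1 / (D n)\<^sup>2"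
    by (rule sum_telescope_le) (rule tel(2))
  also have "\<dots> \<le> 1 / (D 0)\<^sup>2" by simp
  finally show "(\<Sum>i<n. 8 * real (m + 2 * i) / ((real (m + 2 * i))\<^sup>2 + b\<^sup>2 - c) ^ 3) \<le> 1 / ((real m - 1)\<^sup>2 + b\<^sup>2 - 1 - c)\<^sup>2"
    by (simp add: D_def)
qed

lemma sum_le_progression:
  fixes f :: "nat \<Rightarrow> real"
  assumes "A \<subseteq> (\<lambda>i. m + 2 * i) ` {..<n}" "\<And>a. f a \<ge> 0"
  shows "(\<Sum>a\<in>A. f a) \<le> (\<Sum>i<n. f (m + 2 * i))"
proof -
  have "(\<Sum>a\<in>A. f a) \<le> (\<Sum>a\<in>(\<lambda>i. m + 2 * i) ` {..<n}. f a)"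
    by (rule sum_mono2) (use assms in auto)
  also have "\<dots> = (\<Sum>i<n. f (m + 2 * i))" by (subst sum.reindex) (auto simp: inj_on_def)
  finally show ?thesis .
qed

lemma column_first_half:
  fixes f :: "nat \<Rightarrow> real"
  shows "(\<Sum>i<Suc n. (if i = 0 then 1 / 2 else 1) * f i) = f 0 / 2 + (\<Sum>i<n. f (Suc i))"
  by (simp only: sum.lessThan_Suc_shift) simp

section \<open>Columns and rows outside a square\<close>

definition far_cells :: "nat \<Rightarrow> nat \<Rightarrow> (nat \<times> nat) set" where
  "far_cells R n = {(a, b) \<in> cells n. R < a}"

lemma finite_far_cells [simp]: "finite (far_cells R n)"
  by (rule finite_subset[OF _ finite_cells[of n]]) (auto simp: far_cells_def)

definition column :: "nat \<Rightarrow> nat \<Rightarrow> nat \<Rightarrow> nat set" where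
  "column R n b = {a. R < a \<and> a \<le> n \<and> b \<le> a \<and> even (a + b)}"

lemma sum_far_cells_columns:
  fixes f :: "nat \<Rightarrow> nat \<Rightarrow> real"
  shows "(\<Sum>(a, b)\<in>far_cells R n. f a b) = (\<Sum>b\<le>n. \<Sum>a\<in>column R n b. f a b)"
proof -
  have "(\<Sum>b\<le>n. \<Sum>a\<in>column R n b. f a b) = (\<Sum>(b, a)\<in>Sigma {..n} (column R n). f a b)"
    by (rule sum.Sigma) (auto simp: column_def)
  also have "\<dots> = (\<Sum>(a, b)\<in>far_cells R n. f a b)"
    by (rule sum.reindex_bij_witness[of _ "\<lambda>(a, b). (b, a)" "\<lambda>(b, a). (a, b)"])
      (auto simp: far_cells_def cells_def column_def)
  finally show ?thesis ..
qed

lemma sum_far_cells_rows: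
  fixes f :: "nat \<Rightarrow> nat \<Rightarrow> real"
  shows "(\<Sum>(a, b)\<in>far_cells R n. f a b) = (\<Sum>a\<in>{R<..n}. \<Sum>b\<in>{b. b \<le> a \<and> even (a + b)}. f a b)"
proof -
  have "(\<Sum>a\<in>{R<..n}. \<Sum>b\<in>{b. b \<le> a \<and> even (a + b)}. f a b)
      = (\<Sum>(a, b)\<in>Sigma {R<..n} (\<lambda>a. {b. b \<le> a \<and> even (a + b)}). f a b)"
    by (rule sum.Sigma) auto
  also have "Sigma {R<..n} (\<lambda>a. {b. b \<le> a \<and> even (a + b)}) = far_cells R n"
    by (auto simp: far_cells_def cells_def)
  finally show ?thesis ..
qed

lemma column_subset:
  assumes "b \<le> R \<Longrightarrow> R < m \<and> m \<le> R + 2 \<and> even (m + b)" "R < b \<Longrightarrow> m = b"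
  shows "column R n b \<subseteq> (\<lambda>i. m + 2 * i) ` {..<Suc n}"
proof
  fix a assume a: "a \<in> column R n b"
  have "m \<le> a"
  proof (cases "b \<le> R")
    case True
    have "\<not> a < m"
    proof
      assume "a < m"
      then have "a = R + 1" "m = R + 2" using a assms(1)[OF True] by (auto simp: column_def)
      then show False using a assms(1)[OF True] by (auto simp: column_def)
    qed
    then show ?thesis by simp
  qed (use a assms(2) in \<open>auto simp: column_def\<close>)
  moreover have "even (a - m)"
    using a assms \<open>m \<le> a\<close> by (cases "b \<le> R") (auto simp: column_def)
  ultimately obtain i where "a = m + 2 * i" by (metis dvdE le_add_diff_inverse)
  moreover have "i < Suc n" using a \<open>a = m + 2 * i\<close> by (auto simp: column_def)
  ultimately show "a \<in> (\<lambda>i. m + 2 * i) ` {..<Suc n}" by blast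
qed

text \<open>Beyond the cutoff a column starts on the diagonal, and the diagonal cell has weight one
  half.\<close>

lemma weighted_column_le:
  fixes f :: "nat \<Rightarrow> real"
  assumes "R < b" "\<And>a. f a \<ge> 0"
  shows "(\<Sum>a\<in>column R n b. weight a b * f a) \<le> f b / 2 + (\<Sum>i<n. f (b + 2 + 2 * i))"
proof -
  have "(\<Sum>a\<in>column R n b. weight a b * f a) \<le> (\<Sum>i<Suc n. weight (b + 2 * i) b * f (b + 2 * i))"
    by (rule sum_le_progression[OF column_subset]) (use assms mult_nonneg_nonneg[OF less_imp_le[OF weight_pos]] in auto)
  also have "\<dots> = (\<Sum>i<Suc n. (if i = 0 then 1 / 2 else 1) * f (b + 2 * i))"
    using assms(1) by (intro sum.cong) (auto simp: weight_def)
  also have "\<dots> = f b / 2 + (\<Sum>i<n. f (b + 2 + 2 * i))"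
    unfolding column_first_half by simp
  finally show ?thesis .
qed

lemma column_le:
  fixes f :: "nat \<Rightarrow> real"
  assumes "b \<le> R" "R < m" "m \<le> R + 2" "even (m + b)" "\<And>a. f a \<ge> 0"
  shows "(\<Sum>a\<in>column R n b. weight a b * f a) \<le> (if b = 0 then 1 / 2 else 1) * (\<Sum>i<Suc n. f (m + 2 * i))"
proof -
  have w: "weight a b = (if b = 0 then 1 / 2 else 1)" if "a \<in> column R n b" for a
    using that assms(1) by (auto simp: weight_def column_def)
  have "(\<Sum>a\<in>column R n b. weight a b * f a) = (if b = 0 then 1 / 2 else 1) * (\<Sum>a\<in>column R n b. f a)"
    by (simp add: w sum_distrib_left)
  also have "\<dots> \<le> (if b = 0 then 1 / 2 else 1) * (\<Sum>i<Suc n. f (m + 2 * i))"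
    by (intro mult_left_mono sum_le_progression column_subset) (use assms in auto)
  finally show ?thesis .
qed

text \<open>The bounds of \<open>gval_upper\<close> for the two moments without the constants
  \<open>K2\<close> and \<open>K3\<close>.\<close>

definition far_g :: "nat \<Rightarrow> nat \<Rightarrow> real" where
  "far_g a b = 1 / ((real a)\<^sup>2 + (real b)\<^sup>2 - 38 / 9)\<^sup>2"

definition far_h :: "nat \<Rightarrow> nat \<Rightarrow> real" where
  "far_h a b = 1 / ((real a)\<^sup>2 + (real b)\<^sup>2 - 58 / 9) ^ 3"

definition start :: "nat \<Rightarrow> nat \<Rightarrow> nat" where
  "start R b = (if even (R + b) then R + 2 else R + 1)"

lemma start_props: "R < start R b" "start R b \<le> R + 2" "even (start R b + b)"
  by (auto simp: start_def)

lemma sum_inverse_telescope: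
  fixes g G :: "nat \<Rightarrow> real"
  assumes "\<And>b. R < b \<Longrightarrow> g b \<le> G b - G (Suc b)" "\<And>b. G b \<ge> 0"
  shows "(\<Sum>b\<in>{R<..n}. g b) \<le> G (Suc R)"
proof (cases "R \<le> n")
  case True
  have "(\<Sum>b\<in>{R<..n}. g b) \<le> (\<Sum>b\<in>{R<..n}. G b - G (Suc b))" by (intro sum_mono assms) auto
  also have "\<dots> = (\<Sum>b=Suc R..<Suc n. - G (Suc b) - - G b)"
    by (intro sum.cong) auto
  also have "\<dots> = - G (Suc n) - - G (Suc R)"
    by (rule sum_Suc_diff') (use True in simp)
  finally show ?thesis using assms(2)[of "Suc n"] by linarith
qed (use assms(2) in simp)

lemma sum_half_first:
  fixes F :: "nat \<Rightarrow> real"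
  shows "(\<Sum>b\<le>n. (if b = 0 then 1 / 2 else 1) * F b) = F 0 / 2 + (\<Sum>b=1..n. F b)"
proof -
  have "{..n} = insert 0 {1..n}" by auto
  then show ?thesis by simp
qed

text \<open>With b^2 >= 81 the shifts 38/9 and 58/9 are at most 6/100 and 8/100 of b^2.\<close>

lemma quadratic_bounds:
  fixes b :: real
  assumes "b \<ge> 9"
  shows "194 / 100 * b\<^sup>2 \<le> b\<^sup>2 + b\<^sup>2 - 38 / 9" "192 / 100 * b\<^sup>2 \<le> b\<^sup>2 + b\<^sup>2 - 58 / 9"
proof -
  have "9\<^sup>2 \<le> b\<^sup>2" using assms by (intro power_mono) auto
  then have "81 \<le> b\<^sup>2" by simp
  then show "194 / 100 * b\<^sup>2 \<le> b\<^sup>2 + b\<^sup>2 - 38 / 9" "192 / 100 * b\<^sup>2 \<le> b\<^sup>2 + b\<^sup>2 - 58 / 9" by linarith+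
qed

lemma quadratic_pos:
  fixes b :: real
  assumes "b \<ge> 9"
  shows "0 < b\<^sup>2 + b\<^sup>2 - 38 / 9" "0 < b\<^sup>2 + b\<^sup>2 - 58 / 9"
proof -
  have "0 < b\<^sup>2" using assms by simp
  then show "0 < b\<^sup>2 + b\<^sup>2 - 38 / 9" "0 < b\<^sup>2 + b\<^sup>2 - 58 / 9"
    using quadratic_bounds[OF assms] by linarith+
qed

lemma corner_g:
  fixes b :: real
  assumes "b \<ge> 9"
  shows "4 * b / (b\<^sup>2 + b\<^sup>2 - 38 / 9)\<^sup>2 / 2 \<le> 54 / 100 / b ^ 3"
proof -
  have "(194 / 100 * b\<^sup>2)\<^sup>2 \<le> (b\<^sup>2 + b\<^sup>2 - 38 / 9)\<^sup>2"
    using quadratic_bounds(1)[OF assms] assms by (intro power_mono) auto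
  then have "2 * b / (b\<^sup>2 + b\<^sup>2 - 38 / 9)\<^sup>2 \<le> 2 * b / (194 / 100 * b\<^sup>2)\<^sup>2"
    using assms quadratic_pos(1)[OF assms] by (intro divide_left_mono) auto
  also have "\<dots> \<le> 54 / 100 / b ^ 3"
    using assms by (simp add: field_simps power2_eq_square power3_eq_cube)
  finally show ?thesis by simp
qed

text \<open>A whole column from the diagonal upwards weighs about 1 / (2 b^2). It is bounded by a
  difference that telescopes once more, now in \<open>b\<close>.\<close>

lemma corner_column_g:
  fixes b :: real
  assumes "b \<ge> 9"
  shows "54 / 100 / b ^ 3 + 1 / ((b + 1)\<^sup>2 + b\<^sup>2 - 1 - 38 / 9) \<le> 1 / 2 * (1 / (b - 1) - 1 / b)"
proof -
  \<comment> \<open>The left-over 2 b - 38/9 exceeds 3/2 b as soon as b >= 9.\<close>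
  have "2 * (b * (b + 3 / 4)) \<le> (b + 1)\<^sup>2 + b\<^sup>2 - 1 - 38 / 9"
    using assms by (simp add: power2_eq_square algebra_simps)
  then have 1: "1 / ((b + 1)\<^sup>2 + b\<^sup>2 - 1 - 38 / 9) \<le> 1 / (2 * (b * (b + 3 / 4)))"
    using assms by (intro divide_left_mono) (auto intro!: mult_pos_pos elim: order.strict_trans2[rotated])
  have "(b - 1) * (b + 3 / 4) \<le> b\<^sup>2" using assms by (simp add: power2_eq_square algebra_simps)
  then have "7 / 4 / b\<^sup>2 \<le> 7 / 4 / ((b - 1) * (b + 3 / 4))"
    using assms by (intro divide_left_mono) auto
  also have "\<dots> = 1 / (b - 1) - 1 / (b + 3 / 4)" using assms by (simp add: diff_frac_eq)
  finally have "1 / (2 * b) * (7 / 4 / b\<^sup>2) \<le> 1 / (2 * b) * (1 / (b - 1) - 1 / (b + 3 / 4))"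
    using assms by (intro mult_left_mono) auto
  also have "\<dots> = 1 / (2 * b * (b - 1)) - 1 / (2 * (b * (b + 3 / 4)))"
    by (simp add: right_diff_distrib mult.assoc)
  also have "1 / (2 * b * (b - 1)) = 1 / 2 * (1 / (b - 1) - 1 / b)" using assms by (simp add: diff_frac_eq)
  also have "1 / (2 * b) * (7 / 4 / b\<^sup>2) = 7 / 8 / b ^ 3" by (simp add: power2_eq_square power3_eq_cube)
  finally have "7 / 8 / b ^ 3 + 1 / (2 * (b * (b + 3 / 4))) \<le> 1 / 2 * (1 / (b - 1) - 1 / b)" by linarith
  moreover have "54 / 100 / b ^ 3 \<le> 7 / 8 / b ^ 3" using assms by (intro divide_right_mono) auto
  ultimately show ?thesis using 1 by linarith
qed

text \<open>The diagonal cell gives at most 64/1000 and the rest of the column 250/1000 of b^(-4).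
  After the factor b this is 157/1000 times 2 / b^3, and 2 / b^3 is below the telescoping
  difference.\<close>

lemma corner_column_h:
  fixes b :: real
  assumes "b \<ge> 9"
  shows "b * (8 * b / (b\<^sup>2 + b\<^sup>2 - 58 / 9) ^ 3 / 2 + 1 / ((b + 1)\<^sup>2 + b\<^sup>2 - 1 - 58 / 9)\<^sup>2)
    \<le> 157 / 1000 * (1 / (b - 1)\<^sup>2 - 1 / b\<^sup>2)"
proof -
  have "(192 / 100 * b\<^sup>2) ^ 3 \<le> (b\<^sup>2 + b\<^sup>2 - 58 / 9) ^ 3"
    using quadratic_bounds(2)[OF assms] assms by (intro power_mono) auto
  then have "4 * b / (b\<^sup>2 + b\<^sup>2 - 58 / 9) ^ 3 \<le> 4 * b / (192 / 100 * b\<^sup>2) ^ 3"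
    using assms quadratic_pos(2)[OF assms] by (intro divide_left_mono) auto
  also have "\<dots> \<le> 57 / 100 / b ^ 5"
    using assms by (simp add: field_simps power_numeral_reduce)
  also have "\<dots> \<le> 64 / 1000 / b ^ 4"
    using assms by (simp add: field_simps power_numeral_reduce)
  finally have 1: "8 * b / (b\<^sup>2 + b\<^sup>2 - 58 / 9) ^ 3 / 2 \<le> 64 / 1000 / b ^ 4" by simp
  have "2 * b\<^sup>2 \<le> (b + 1)\<^sup>2 + b\<^sup>2 - 1 - 58 / 9" using assms by (simp add: power2_eq_square algebra_simps)
  then have "(2 * b\<^sup>2)\<^sup>2 \<le> ((b + 1)\<^sup>2 + b\<^sup>2 - 1 - 58 / 9)\<^sup>2" by (intro power_mono) auto
  moreover have "0 < (2 * b\<^sup>2)\<^sup>2" using assms by simp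
  ultimately have "1 / ((b + 1)\<^sup>2 + b\<^sup>2 - 1 - 58 / 9)\<^sup>2 \<le> 1 / (2 * b\<^sup>2)\<^sup>2"
    by (intro divide_left_mono) (auto intro!: mult_pos_pos elim: order.strict_trans2[rotated])
  also have "\<dots> = 250 / 1000 / b ^ 4" by (simp add: power_mult_distrib)
  finally have "b * (8 * b / (b\<^sup>2 + b\<^sup>2 - 58 / 9) ^ 3 / 2 + 1 / ((b + 1)\<^sup>2 + b\<^sup>2 - 1 - 58 / 9)\<^sup>2) \<le> b * (64 / 1000 / b ^ 4 + 250 / 1000 / b ^ 4)"
    using 1 assms by (intro mult_left_mono add_mono) auto
  also have "\<dots> = 157 / 1000 * (2 / b ^ 3)" using assms by (simp add: field_simps power_numeral_reduce)
  also have "2 / b ^ 3 \<le> 1 / (b - 1)\<^sup>2 - 1 / b\<^sup>2"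
  proof -
    have "1 / (b - 1)\<^sup>2 - 1 / b\<^sup>2 - 2 / b ^ 3 = (3 * b - 2) / (b ^ 3 * (b - 1)\<^sup>2)"
      using assms by (simp add: divide_simps) (simp add: power2_eq_square power3_eq_cube algebra_simps)
    moreover have "0 \<le> (3 * b - 2) / (b ^ 3 * (b - 1)\<^sup>2)" using assms by simp
    ultimately show ?thesis by linarith
  qed
  finally show ?thesis by simp
qed

text \<open>Columns with b <= 8 start at a = 9 or 10 and telescope in a. Those with b > 8 start on
  the diagonal, and their bounds telescope in b down to 1/16 = 1/2 / 8. The number 47/9 is 38/9 +
  1.\<close>

lemma far_g_sum:
  "(\<Sum>(a, b)\<in>far_cells 8 n. weight a b * (4 * real a * far_g a b)) \<le>
    1 / 2 / (81 - 47 / 9) + (\<Sum>b=1..8. 1 / ((real (start 8 b) - 1)\<^sup>2 + (real b)\<^sup>2 - 47 / 9)) + 1 / 16"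
proof -
  define f where "f b a = 4 * real a * far_g a b" for a b
  define C where "C b = (\<Sum>a\<in>column 8 n b. weight a b * f b a)" for b
  have f: "f b a = 4 * real a / ((real a)\<^sup>2 + (real b)\<^sup>2 - 38 / 9)\<^sup>2" for a b by (simp add: f_def far_g_def)
  have f0: "f b a \<ge> 0" for a b by (simp add: f)
  have small: "C b \<le> (if b = 0 then 1 / 2 else 1) * (1 / ((real (start 8 b) - 1)\<^sup>2 + (real b)\<^sup>2 - 47 / 9))" if "b \<le> 8" for b
  proof -
    have "8\<^sup>2 \<le> (real (start 8 b) - 1)\<^sup>2" using start_props(1)[of 8 b] by (intro power_mono) auto
    then have "64 \<le> (real (start 8 b) - 1)\<^sup>2" by simp
    then have pos: "(real (start 8 b) - 1)\<^sup>2 + (real b)\<^sup>2 - 1 - 38 / 9 > 0"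
      using zero_le_power2[of "real b"] by linarith
    have "C b \<le> (if b = 0 then 1 / 2 else 1) * (\<Sum>i<Suc n. f b (start 8 b + 2 * i))"
      unfolding C_def by (intro column_le start_props f0 that)
    also have "\<dots> \<le> (if b = 0 then 1 / 2 else 1) * (1 / ((real (start 8 b) - 1)\<^sup>2 + (real b)\<^sup>2 - 1 - 38 / 9))"
      unfolding f using start_props(1)[of 8 b] pos by (intro mult_left_mono column_upper) auto
    finally show ?thesis by simp
  qed
  have large: "C b \<le> 1 / 2 / (real b - 1) - 1 / 2 / (real (Suc b) - 1)" if "8 < b" for b
  proof -
    have b: "real b \<ge> 9" using that by simp
    have "C b \<le> f b b / 2 + (\<Sum>i<n. f b (b + 2 + 2 * i))"
      unfolding C_def by (rule weighted_column_le) (use that f0 in auto)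
    also have "(\<Sum>i<n. f b (b + 2 + 2 * i)) \<le> 1 / ((real (b + 2) - 1)\<^sup>2 + (real b)\<^sup>2 - 1 - 38 / 9)"
      unfolding f
    proof (rule column_upper)
      have "0 < real b * real b" using b by simp
      moreover have "(real (b + 2) - 1)\<^sup>2 + (real b)\<^sup>2 - 1 - 38 / 9 = 2 * (real b * real b) + 2 * real b - 38 / 9"
        by (simp add: power2_eq_square algebra_simps)
      ultimately show "0 < (real (b + 2) - 1)\<^sup>2 + (real b)\<^sup>2 - 1 - 38 / 9" using b by linarith
    qed simp
    also have "real (b + 2) - 1 = real b + 1" by simp
    also have "f b b / 2 \<le> 54 / 100 / (real b) ^ 3" using corner_g[OF b] by (simp add: f)
    finally show ?thesis using corner_column_g[OF b] by (simp add: right_diff_distrib)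
  qed
  have "(\<Sum>(a, b)\<in>far_cells 8 n. weight a b * (4 * real a * far_g a b)) = (\<Sum>b\<le>n. C b)"
    unfolding sum_far_cells_columns C_def f_def ..
  also have "\<dots> \<le> (\<Sum>b\<in>{..8} \<union> {8<..n}. C b)"
  proof (rule sum_mono2)
    show "0 \<le> C b" for b unfolding C_def
      by (intro sum_nonneg mult_nonneg_nonneg f0 less_imp_le[OF weight_pos])
  qed auto
  also have "\<dots> = (\<Sum>b\<le>8. C b) + (\<Sum>b\<in>{8<..n}. C b)"
    by (rule sum.union_disjoint) auto
  \<comment> \<open>The case \<open>b = 0\<close> in \<open>G\<close> only keeps it nonnegative
    everywhere, as the telescoping lemma asks.\<close>
  also have "(\<Sum>b\<in>{8<..n}. C b) \<le> 1 / 2 / (real (Suc 8) - 1)"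
    using sum_inverse_telescope[where g = C and R = 8 and n = n and G = "\<lambda>b. if b = 0 then 0 else 1 / 2 / (real b - 1)"] large
    by simp
  also have "(\<Sum>b\<le>8. C b) \<le> (\<Sum>b\<le>8. (if b = 0 then 1 / 2 else 1) * (1 / ((real (start 8 b) - 1)\<^sup>2 + (real b)\<^sup>2 - 47 / 9)))"
    by (intro sum_mono small) auto
  also have "\<dots> = 1 / 2 / (81 - 47 / 9) + (\<Sum>b=1..8. 1 / ((real (start 8 b) - 1)\<^sup>2 + (real b)\<^sup>2 - 47 / 9))"
    unfolding sum_half_first by (simp add: start_def)
  finally show ?thesis by simp
qed

text \<open>As for \<open>far_g\<close>, with squared reciprocals: 67/9 = 58/9 + 1, and the columns
  with b > 8 leave 157/1000 / 8^2.\<close>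

lemma far_h_sum:
  "(\<Sum>(a, b)\<in>far_cells 8 n. weight a b * (8 * (real a * real b) * far_h a b)) \<le>
    (\<Sum>b=1..8. real b / ((real (start 8 b) - 1)\<^sup>2 + (real b)\<^sup>2 - 67 / 9)\<^sup>2) + 157 / 64000"
proof -
  define f where "f b a = 8 * (real a * real b) * far_h a b" for a b
  define C where "C b = (\<Sum>a\<in>column 8 n b. weight a b * f b a)" for b
  have f: "f b a = real b * (8 * real a / ((real a)\<^sup>2 + (real b)\<^sup>2 - 58 / 9) ^ 3)" for a b by (simp add: f_def far_h_def)
  have f0: "f b a \<ge> 0" if "a \<in> column 8 n b" for a b
  proof -
    have "(9 :: real)\<^sup>2 \<le> (real a)\<^sup>2" using that by (intro power_mono) (auto simp: column_def)
    then have "81 \<le> (real a)\<^sup>2" by simp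
    then have "0 \<le> (real a)\<^sup>2 + (real b)\<^sup>2 - 58 / 9" using zero_le_power2[of "real b"] by linarith
    then show ?thesis by (simp add: f)
  qed
  \<comment> \<open>The odd power makes \<open>far_h\<close> negative close to the origin. Cutting
    it off below 9 gives the nonnegativity that the column lemmas demand and alters no
    summand.\<close>
  define f' where "f' b a = (if 9 \<le> a then f b a else 0)" for a b
  have f'0: "f' b a \<ge> 0" for a b
  proof (cases "9 \<le> a")
    case True
    then have "(9 :: real)\<^sup>2 \<le> (real a)\<^sup>2" by (intro power_mono) auto
    then have "81 \<le> (real a)\<^sup>2" by simp
    then have "0 \<le> (real a)\<^sup>2 + (real b)\<^sup>2 - 58 / 9" using zero_le_power2[of "real b"] by linarith
    then show ?thesis by (simp add: f'_def f)
  qed (simp add: f'_def)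
  have C': "C b = (\<Sum>a\<in>column 8 n b. weight a b * f' b a)" for b
    unfolding C_def by (intro sum.cong) (auto simp: f'_def column_def)
  have small: "C b \<le> (if b = 0 then 1 / 2 else 1) * (real b / ((real (start 8 b) - 1)\<^sup>2 + (real b)\<^sup>2 - 67 / 9)\<^sup>2)" if "b \<le> 8" for b
  proof -
    have "8\<^sup>2 \<le> (real (start 8 b) - 1)\<^sup>2" using start_props(1)[of 8 b] by (intro power_mono) auto
    then have "64 \<le> (real (start 8 b) - 1)\<^sup>2" by simp
    then have pos: "(real (start 8 b) - 1)\<^sup>2 + (real b)\<^sup>2 - 1 - 58 / 9 > 0"
      using zero_le_power2[of "real b"] by linarith
    have "C b \<le> (if b = 0 then 1 / 2 else 1) * (\<Sum>i<Suc n. f' b (start 8 b + 2 * i))"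
      unfolding C' by (intro column_le start_props f'0 that)
    also have "(\<Sum>i<Suc n. f' b (start 8 b + 2 * i)) = (\<Sum>i<Suc n. f b (start 8 b + 2 * i))"
      using start_props(1)[of 8 b] by (intro sum.cong) (auto simp: f'_def)
    also have "\<dots> = real b * (\<Sum>i<Suc n. 8 * real (start 8 b + 2 * i) / ((real (start 8 b + 2 * i))\<^sup>2 + (real b)\<^sup>2 - 58 / 9) ^ 3)"
      unfolding f sum_distrib_left ..
    also have "(if b = 0 then 1 / 2 else 1) * \<dots> \<le> (if b = 0 then 1 / 2 else 1) * (real b * (1 / ((real (start 8 b) - 1)\<^sup>2 + (real b)\<^sup>2 - 1 - 58 / 9)\<^sup>2))"
      using start_props(1)[of 8 b] pos by (intro mult_left_mono column_upper) auto
    finally show ?thesis by simp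
  qed
  have large: "C b \<le> 157 / 1000 / (real b - 1)\<^sup>2 - 157 / 1000 / (real (Suc b) - 1)\<^sup>2" if "8 < b" for b
  proof -
    have b: "real b \<ge> 9" using that by simp
    have "C b \<le> f' b b / 2 + (\<Sum>i<n. f' b (b + 2 + 2 * i))"
      unfolding C' by (rule weighted_column_le) (use that f'0 in auto)
    also have "(\<Sum>i<n. f' b (b + 2 + 2 * i)) = (\<Sum>i<n. f b (b + 2 + 2 * i))"
      using that by (intro sum.cong) (auto simp: f'_def)
    also have "\<dots> = real b * (\<Sum>i<n. 8 * real (b + 2 + 2 * i) / ((real (b + 2 + 2 * i))\<^sup>2 + (real b)\<^sup>2 - 58 / 9) ^ 3)"
      unfolding f sum_distrib_left ..
    also have "\<dots> \<le> real b * (1 / ((real (b + 2) - 1)\<^sup>2 + (real b)\<^sup>2 - 1 - 58 / 9)\<^sup>2)"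
    proof (intro mult_left_mono column_upper)
      have "0 < real b * real b" using b by simp
      moreover have "(real (b + 2) - 1)\<^sup>2 + (real b)\<^sup>2 - 1 - 58 / 9 = 2 * (real b * real b) + 2 * real b - 58 / 9"
        by (simp add: power2_eq_square algebra_simps)
      ultimately show "0 < (real (b + 2) - 1)\<^sup>2 + (real b)\<^sup>2 - 1 - 58 / 9" using b by linarith
    qed simp_all
    also have "real (b + 2) - 1 = real b + 1" by simp
    also have "f' b b / 2 = real b * (8 * real b / ((real b)\<^sup>2 + (real b)\<^sup>2 - 58 / 9) ^ 3 / 2)"
      using that by (simp add: f'_def f)
    finally show ?thesis using corner_column_h[OF b] by (simp add: distrib_left right_diff_distrib)
  qed
  have "(\<Sum>(a, b)\<in>far_cells 8 n. weight a b * (8 * (real a * real b) * far_h a b)) = (\<Sum>b\<le>n. C b)"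
    unfolding sum_far_cells_columns C_def f_def ..
  also have "\<dots> \<le> (\<Sum>b\<in>{..8} \<union> {8<..n}. C b)"
  proof (rule sum_mono2)
    show "0 \<le> C b" for b unfolding C'
      by (intro sum_nonneg mult_nonneg_nonneg f'0 less_imp_le[OF weight_pos])
  qed auto
  also have "\<dots> = (\<Sum>b\<le>8. C b) + (\<Sum>b\<in>{8<..n}. C b)"
    by (rule sum.union_disjoint) auto
  also have "(\<Sum>b\<in>{8<..n}. C b) \<le> 157 / 1000 / (real (Suc 8) - 1)\<^sup>2"
    using sum_inverse_telescope[where g = C and R = 8 and n = n and G = "\<lambda>b. 157 / 1000 / (real b - 1)\<^sup>2"] large
    by simp
  also have "(\<Sum>b\<le>8. C b) \<le> (\<Sum>b\<le>8. (if b = 0 then 1 / 2 else 1) * (real b / ((real (start 8 b) - 1)\<^sup>2 + (real b)\<^sup>2 - 67 / 9)\<^sup>2))"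
    by (intro sum_mono small) auto
  also have "\<dots> = (\<Sum>b=1..8. real b / ((real (start 8 b) - 1)\<^sup>2 + (real b)\<^sup>2 - 67 / 9)\<^sup>2)"
    unfolding sum_half_first by simp
  finally show ?thesis by simp
qed

lemma row_set:
  fixes a :: nat
  shows "{b. b \<le> a \<and> even (a + b)} - {0} = (\<lambda>i. (if even a then 2 else 1) + 2 * i) ` {..<(a + 1) div 2}"
proof (intro set_eqI iffI)
  fix b assume "b \<in> {b. b \<le> a \<and> even (a + b)} - {0}"
  then have b: "b \<le> a" "even (a + b)" "0 < b" by auto
  then have "b = (if even a then 2 else 1) + 2 * ((b - 1) div 2)"
    by (cases "even a"; simp; presburger)
  moreover have "(b - 1) div 2 < (a + 1) div 2" using b by presburger
  ultimately show "b \<in> (\<lambda>i. (if even a then 2 else 1) + 2 * i) ` {..<(a + 1) div 2}" by blast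
next
  fix b assume "b \<in> (\<lambda>i. (if even a then 2 else 1) + 2 * i) ` {..<(a + 1) div 2}"
  then obtain i where i: "b = (if even a then 2 else 1) + 2 * i" "i < (a + 1) div 2" by blast
  then show "b \<in> {b. b \<le> a \<and> even (a + b)} - {0}"
    by (cases "even a"; simp; presburger)
qed

text \<open>Since \<open>f 0 = 0\<close>, a row effectively runs from 1 or 2 to the diagonal, where
  alone the weight is one half.\<close>

lemma sum_row:
  fixes f :: "nat \<Rightarrow> real"
  assumes "0 < a" "f 0 = 0"
  shows "\<exists>k. (if even a then 2 else 1) + 2 * k = a \<and>
    (\<Sum>b\<in>{b. b \<le> a \<and> even (a + b)}. weight a b * f b) = (\<Sum>i<k. f ((if even a then 2 else 1) + 2 * i)) + f a / 2"
proof -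
  define s :: nat where "s = (if even a then 2 else 1)"
  define k where "k = (a - s) div 2"
  have k: "s + 2 * k = a" using assms(1) by (auto simp: k_def s_def elim!: evenE oddE)
  then have half: "(a + 1) div 2 = Suc k" by (auto simp: s_def split: if_splits)
  have "(\<Sum>b\<in>{b. b \<le> a \<and> even (a + b)}. weight a b * f b) = (\<Sum>b\<in>{b. b \<le> a \<and> even (a + b)} - {0}. weight a b * f b)"
    by (rule sum.mono_neutral_right) (auto simp: assms(2))
  also have "\<dots> = (\<Sum>i<Suc k. weight a (s + 2 * i) * f (s + 2 * i))"
    unfolding row_set half s_def[symmetric] by (subst sum.reindex) (auto simp: inj_on_def)
  also have "\<dots> = (\<Sum>i<k. weight a (s + 2 * i) * f (s + 2 * i)) + f a / 2"
    using k by (simp add: weight_def)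
  also have "(\<Sum>i<k. weight a (s + 2 * i) * f (s + 2 * i)) = (\<Sum>i<k. f (s + 2 * i))"
    by (intro sum.cong) (use k in \<open>auto simp: weight_def s_def split: if_splits\<close>)
  finally show ?thesis using k unfolding s_def by blast
qed

text \<open>The non-circular totals contain \<open>b\<close> in place of \<open>a\<close>, so the
  telescoping runs along rows. One row is at most 1/2 (1 / (a - 2) - 1 / (a - 1)), and the rows from
  9 on leave 1/14.\<close>

lemma far_g_sum_rows:
  "(\<Sum>(a, b)\<in>far_cells 8 n. weight a b * (4 * real b * far_g a b)) \<le> 1 / 14"
proof -
  have row: "(\<Sum>b\<in>{b. b \<le> a \<and> even (a + b)}. weight a b * (4 * real b * far_g a b))
      \<le> 1 / 2 / (real a - 2) - 1 / 2 / (real (Suc a) - 2)" if "8 < a" for a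
  proof -
    have a: "real a \<ge> 9" using that by simp
    have "9\<^sup>2 \<le> (real a)\<^sup>2" using a by (intro power_mono) auto
    then have aa: "81 \<le> (real a)\<^sup>2" by simp
    define s :: nat where "s = (if even a then 2 else 1)"
    have "0 < a" "4 * real 0 * far_g a 0 = 0" using that by simp_all
    obtain k where k: "s + 2 * k = a" and
      sum: "(\<Sum>b\<in>{b. b \<le> a \<and> even (a + b)}. weight a b * (4 * real b * far_g a b)) =
        (\<Sum>i<k. 4 * real (s + 2 * i) * far_g a (s + 2 * i)) + 4 * real a * far_g a a / 2"
      using sum_row[of a "\<lambda>b. 4 * real b * far_g a b", folded s_def, OF \<open>0 < a\<close> \<open>4 * real 0 * far_g a 0 = 0\<close>] by blast
    define G where "G i = 1 / ((real (s + 2 * i) - 1)\<^sup>2 + (real a)\<^sup>2 - 1 - 38 / 9)" for i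
    have "(\<Sum>i<k. 4 * real (s + 2 * i) * far_g a (s + 2 * i)) \<le> G 0 - G k"
    proof (rule sum_telescope_le)
      fix i
      have "0 < (real (s + 2 * i) - 1)\<^sup>2 + (real a)\<^sup>2 - 1 - 38 / 9"
        using aa zero_le_power2[of "real (s + 2 * i) - 1"] by linarith
      moreover have "0 < real (s + 2 * i)" by (simp add: s_def)
      moreover have "real (s + 2 * Suc i) - 1 = real (s + 2 * i) + 1" by simp
      ultimately show "4 * real (s + 2 * i) * far_g a (s + 2 * i) \<le> G i - G (Suc i)"
        using telescope_upper(1)[of "real (s + 2 * i)" "real a" "38 / 9"]
        by (simp only: G_def far_g_def) (simp add: add.commute)
    qed
    moreover have "G 0 \<le> 1 / ((real a)\<^sup>2 - 47 / 9)"
    proof -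
      have "(real a)\<^sup>2 - 47 / 9 \<le> (real (s + 2 * 0) - 1)\<^sup>2 + (real a)\<^sup>2 - 1 - 38 / 9"
        using zero_le_power2[of "real (s + 2 * 0) - 1"] by linarith
      moreover have "0 < (real a)\<^sup>2 - 47 / 9" using aa by linarith
      ultimately show ?thesis unfolding G_def by (intro divide_left_mono mult_pos_pos) linarith+
    qed
    moreover have "1 / (2 * (real a * (real a - 1))) \<le> G k"
    proof -
      have eq: "G k = 1 / ((real a - 1)\<^sup>2 + (real a)\<^sup>2 - 1 - 38 / 9)" unfolding G_def k ..
      have "0 < (real a - 1)\<^sup>2 + (real a)\<^sup>2 - 1 - 38 / 9"
        using aa zero_le_power2[of "real a - 1"] by linarith
      moreover have "(real a - 1)\<^sup>2 + (real a)\<^sup>2 - 1 - 38 / 9 \<le> 2 * (real a * (real a - 1))"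
        by (simp add: power2_eq_square algebra_simps)
      ultimately show ?thesis unfolding eq using a by (intro divide_left_mono) auto
    qed
    moreover have "4 * real a * far_g a a / 2 \<le> 54 / 100 / (real a) ^ 3"
      using corner_g[OF a] by (simp add: far_g_def)
    moreover have "1 / ((real a)\<^sup>2 - 47 / 9) + 54 / 100 / (real a) ^ 3 \<le> 1 / (real a * (real a - 2))"
    proof -
      have pos: "0 < real a * (real a - 2)" "0 < (real a)\<^sup>2 - 47 / 9" using a aa by auto
      have "1 / (real a * (real a - 2)) - 1 / ((real a)\<^sup>2 - 47 / 9) =
          (2 * real a - 47 / 9) / (real a * (real a - 2) * ((real a)\<^sup>2 - 47 / 9))"
      proof -
        have "1 / p - 1 / q = (q - p) / (p * q)" if "0 < p" "0 < q" for p q :: real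
          using that by (simp add: diff_frac_eq)
        from this[OF pos] show ?thesis by (simp add: power2_eq_square algebra_simps)
      qed
      also have "\<dots> \<ge> (54 / 100 * real a) / (real a * (real a) * (real a)\<^sup>2)"
        using a pos by (intro frac_le mult_mono mult_pos_pos) auto
      finally have "(54 / 100 * real a) / (real a * (real a) * (real a)\<^sup>2) \<le> 1 / (real a * (real a - 2)) - 1 / ((real a)\<^sup>2 - 47 / 9)" .
      moreover have "(54 / 100 * real a) / (real a * (real a) * (real a)\<^sup>2) = 54 / 100 / (real a) ^ 3"
        using a by (simp add: power2_eq_square power3_eq_cube)
      ultimately show ?thesis by linarith
    qed
    moreover have "1 / (real a * (real a - 2)) - 1 / (2 * (real a * (real a - 1))) = 1 / 2 / (real a - 2) - 1 / 2 / (real (Suc a) - 2)"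
    proof -
      define x y z where "x = real a" and "y = real a - 1" and "z = real a - 2"
      have "x > 0" "y > 0" "z > 0" "x = z + 2" "y = z + 1" "real (Suc a) - 2 = y"
        using a by (auto simp: x_def y_def z_def)
      then show ?thesis unfolding x_def[symmetric] y_def[symmetric] z_def[symmetric]
        by (simp add: divide_simps)
    qed
    ultimately show ?thesis unfolding sum by linarith
  qed
  have "(\<Sum>(a, b)\<in>far_cells 8 n. weight a b * (4 * real b * far_g a b)) \<le> 1 / 2 / (real (Suc 8) - 2)"
    unfolding sum_far_cells_rows
    using sum_inverse_telescope[where g = "\<lambda>a. \<Sum>b\<in>{b. b \<le> a \<and> even (a + b)}. weight a b * (4 * real b * far_g a b)"
      and R = 8 and n = n and G = "\<lambda>a. if a < 2 then 0 else 1 / 2 / (real a - 2)"] row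
    by simp
  then show ?thesis by simp
qed

section \<open>Lower bounds for distant orbits\<close>

definition low_g :: "nat \<Rightarrow> nat \<Rightarrow> real" where
  "low_g a b = 1 / ((real a)\<^sup>2 + (real b)\<^sup>2)\<^sup>2"

text \<open>A row is at least 1/2 (1 / a - 1 / (a + 1)); the rows from 25 on start the telescope at
  1/50.\<close>

lemma low_g_sum_rows:
  assumes "24 \<le> n"
  shows "1 / 50 - 1 / 2 / (real n + 1) \<le> (\<Sum>(a, b)\<in>far_cells 24 n. weight a b * (4 * real b * low_g a b))"
proof -
  have row: "1 / 2 / real a - 1 / 2 / real (Suc a) \<le>
      (\<Sum>b\<in>{b. b \<le> a \<and> even (a + b)}. weight a b * (4 * real b * low_g a b))" if "24 < a" for a
  proof -
    have a: "real a \<ge> 25" using that by simp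
    define s :: nat where "s = (if even a then 2 else 1)"
    have "0 < a" "4 * real 0 * low_g a 0 = 0" using that by simp_all
    obtain k where k: "s + 2 * k = a" and
      sum: "(\<Sum>b\<in>{b. b \<le> a \<and> even (a + b)}. weight a b * (4 * real b * low_g a b)) =
        (\<Sum>i<k. 4 * real (s + 2 * i) * low_g a (s + 2 * i)) + 4 * real a * low_g a a / 2"
      using sum_row[of a "\<lambda>b. 4 * real b * low_g a b", folded s_def, OF \<open>0 < a\<close> \<open>4 * real 0 * low_g a 0 = 0\<close>] by blast
    define G where "G i = 1 / ((real (s + 2 * i) - 1)\<^sup>2 + (real a)\<^sup>2 + 1)" for i
    have "G 0 - G k \<le> (\<Sum>i<k. 4 * real (s + 2 * i) * low_g a (s + 2 * i))"
    proof (rule sum_telescope_ge)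
      fix i
      have "0 < real (s + 2 * i)" by (simp add: s_def)
      moreover have "real (s + 2 * Suc i) - 1 = real (s + 2 * i) + 1" by simp
      ultimately show "G i - G (Suc i) \<le> 4 * real (s + 2 * i) * low_g a (s + 2 * i)"
        using telescope_lower[of "real (s + 2 * i)" "real a"]
        by (simp only: G_def low_g_def) (simp add: add.commute)
    qed
    moreover have "1 / ((real a)\<^sup>2 + 2) \<le> G 0"
    proof -
      have "(real (s + 2 * 0) - 1)\<^sup>2 \<le> 1" by (simp add: s_def)
      then have "(real (s + 2 * 0) - 1)\<^sup>2 + (real a)\<^sup>2 + 1 \<le> (real a)\<^sup>2 + 2" by linarith
      then show ?thesis unfolding G_def by (intro divide_left_mono) (auto intro!: mult_pos_pos add_nonneg_pos)
    qed
    moreover have "G k \<le> 1 / (2 * (real a)\<^sup>2) + 1 / (2 * (real a) ^ 3)"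
    proof -
      have eq: "G k = 1 / ((real a - 1)\<^sup>2 + (real a)\<^sup>2 + 1)" unfolding G_def k ..
      have "((real a - 1)\<^sup>2 + (real a)\<^sup>2 + 1) * (real a + 1) \<ge> 2 * (real a) ^ 3"
        by (simp add: power2_eq_square power3_eq_cube algebra_simps)
      then have "1 / ((real a - 1)\<^sup>2 + (real a)\<^sup>2 + 1) \<le> (real a + 1) / (2 * (real a) ^ 3)"
        using a by (simp add: divide_simps mult.commute add_nonneg_pos split: if_splits)
      also have "\<dots> = 1 / (2 * (real a)\<^sup>2) + 1 / (2 * (real a) ^ 3)"
        using a by (simp add: field_simps power2_eq_square power3_eq_cube)
      finally show ?thesis unfolding eq .
    qed
    moreover have "4 * real a * low_g a a / 2 = 1 / (2 * (real a) ^ 3)"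
      using a by (simp add: low_g_def field_simps power2_eq_square power3_eq_cube)
    moreover have "1 / 2 / real a - 1 / 2 / real (Suc a) \<le> 1 / ((real a)\<^sup>2 + 2) - 1 / (2 * (real a)\<^sup>2)"
    proof -
      define x where "x = real a"
      have x: "x \<ge> 25" using a by (simp add: x_def)
      have "25 * x \<le> x\<^sup>2" using x by (simp add: power2_eq_square)
      moreover have "(x\<^sup>2 - 2) * (x + 1) - x * (x\<^sup>2 + 2) = x\<^sup>2 - 4 * x - 2"
        by (simp add: power2_eq_square algebra_simps)
      ultimately have "x * (x\<^sup>2 + 2) \<le> (x\<^sup>2 - 2) * (x + 1)" using x by linarith
      then have "x * (x\<^sup>2 + 2) / (2 * x\<^sup>2 * (x + 1) * (x\<^sup>2 + 2)) \<le> (x\<^sup>2 - 2) * (x + 1) / (2 * x\<^sup>2 * (x + 1) * (x\<^sup>2 + 2))"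
        using x by (intro divide_right_mono) auto
      moreover have "x * (x\<^sup>2 + 2) / (2 * x\<^sup>2 * (x + 1) * (x\<^sup>2 + 2)) = 1 / 2 / x - 1 / 2 / (x + 1)"
      proof -
        have "x\<^sup>2 + 2 \<noteq> 0" "x \<noteq> 0" "x + 1 \<noteq> 0" using x zero_le_power2[of x] by linarith+
        then have "1 / 2 / x - 1 / 2 / (x + 1) = 1 / (2 * x * (x + 1))" by (simp add: diff_frac_eq field_simps)
        also have "\<dots> = x * (x\<^sup>2 + 2) / (2 * x\<^sup>2 * (x + 1) * (x\<^sup>2 + 2))"
          using \<open>x\<^sup>2 + 2 \<noteq> 0\<close> \<open>x \<noteq> 0\<close> by (simp add: power2_eq_square)
        finally show ?thesis ..
      qed
      moreover have "(x\<^sup>2 - 2) * (x + 1) / (2 * x\<^sup>2 * (x + 1) * (x\<^sup>2 + 2)) = 1 / (x\<^sup>2 + 2) - 1 / (2 * x\<^sup>2)"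
      proof -
        have "x\<^sup>2 + 2 \<noteq> 0" using zero_le_power2[of x] by linarith
        moreover have "x\<^sup>2 \<noteq> 0" "x + 1 \<noteq> 0" using x by auto
        ultimately show ?thesis by (simp add: diff_frac_eq)
      qed
      ultimately show ?thesis by (simp add: x_def add.commute)
    qed
    ultimately show ?thesis unfolding sum by linarith
  qed
  have "(\<Sum>a\<in>{24<..n}. 1 / 2 / real a - 1 / 2 / real (Suc a)) = (\<Sum>a=Suc 24..<Suc n. - (1 / 2 / real (Suc a)) - - (1 / 2 / real a))"
    by (intro sum.cong) auto
  also have "\<dots> = - (1 / 2 / real (Suc n)) - - (1 / 2 / real (Suc 24))"
    by (rule sum_Suc_diff') (use assms in simp)
  finally have "1 / 50 - 1 / 2 / (real n + 1) = (\<Sum>a\<in>{24<..n}. 1 / 2 / real a - 1 / 2 / real (Suc a))"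
    by (simp add: add.commute)
  also have "\<dots> \<le> (\<Sum>(a, b)\<in>far_cells 24 n. weight a b * (4 * real b * low_g a b))"
    unfolding sum_far_cells_rows by (intro sum_mono row) auto
  finally show ?thesis .
qed

text \<open>Only \<open>B\<close> columns beyond the axis with \<open>N\<close> cells each are
  counted. Stopping at column \<open>B\<close> costs 1 / (2 B + 1), cutting the columns costs
  \<open>e\<close> for each. The first terms are those of the columns with b <= 24, with 626 = 25^2
  + 1, and 100/4901 opens the telescope in b at 25.\<close>

lemma low_g_sum:
  assumes "24 \<le> B" "B + 26 + 2 * N \<le> n"
  shows "1 / 2 / 626 + (\<Sum>b=1..24. 1 / ((real (start 24 b) - 1)\<^sup>2 + (real b)\<^sup>2 + 1))
      + 100 / 4901 - 1 / (2 * real B + 1) - (real B + 1) / (4 * (real N)\<^sup>2 + 1)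
    \<le> (\<Sum>(a, b)\<in>far_cells 24 n. weight a b * (4 * real a * low_g a b))"
proof -
  define f where "f b a = 4 * real a * low_g a b" for a b
  define C where "C b = (\<Sum>a\<in>column 24 n b. weight a b * f b a)" for b
  define e where "e = 1 / (4 * (real N)\<^sup>2 + 1)"
  have f: "f b a = 4 * real a / ((real a)\<^sup>2 + (real b)\<^sup>2)\<^sup>2" for a b by (simp add: f_def low_g_def)
  have f0: "f b a \<ge> 0" for a b by (simp add: f)
  have fin: "finite (column 24 n b)" for b by (rule finite_subset[of _ "{..n}"]) (auto simp: column_def)
  have prog: "(\<Sum>i<N. f b (m + 2 * i)) \<le> (\<Sum>a\<in>A. f b a)"
    if "finite A" "\<And>i. i < N \<Longrightarrow> m + 2 * i \<in> A" for m b A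
  proof -
    have "(\<Sum>i<N. f b (m + 2 * i)) = (\<Sum>a\<in>(\<lambda>i. m + 2 * i) ` {..<N}. f b a)"
      by (subst sum.reindex) (auto simp: inj_on_def)
    also have "\<dots> \<le> (\<Sum>a\<in>A. f b a)" by (rule sum_mono2) (use that f0 in auto)
    finally show ?thesis .
  qed
  have small: "(if b = 0 then 1 / 2 else 1) * (1 / ((real (start 24 b) - 1)\<^sup>2 + (real b)\<^sup>2 + 1)) - e \<le> C b" if "b \<le> 24" for b
  proof -
    have w: "weight a b = (if b = 0 then 1 / 2 else 1)" if "a \<in> column 24 n b" for a
      using that \<open>b \<le> 24\<close> by (auto simp: weight_def column_def)
    have "1 / ((real (start 24 b) - 1)\<^sup>2 + (real b)\<^sup>2 + 1) - e \<le> (\<Sum>i<N. f b (start 24 b + 2 * i))"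
      unfolding e_def f by (rule column_lower) (use start_props(1)[of 24 b] in simp)
    also have "\<dots> \<le> (\<Sum>a\<in>column 24 n b. f b a)"
    proof (rule prog[OF fin])
      fix i assume "i < N"
      then show "start 24 b + 2 * i \<in> column 24 n b"
        using start_props[of 24 b] assms that by (auto simp: column_def)
    qed
    finally have "(if b = 0 then 1 / 2 else 1) * (1 / ((real (start 24 b) - 1)\<^sup>2 + (real b)\<^sup>2 + 1) - e)
        \<le> (if b = 0 then 1 / 2 else 1) * (\<Sum>a\<in>column 24 n b. f b a)"
      by (intro mult_left_mono) auto
    moreover have "C b = (if b = 0 then 1 / 2 else 1) * (\<Sum>a\<in>column 24 n b. f b a)"
      by (simp add: C_def w sum_distrib_left)
    moreover have "e \<ge> 0" by (simp add: e_def)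
    ultimately show ?thesis by (auto simp: right_diff_distrib split: if_splits)
  qed
  \<comment> \<open>A column is at least 1 / (2 b^2), which dominates a difference of reciprocals of
    x - 1 and x + 1 if x^2 - 1 >= 4 b^2. For x = 2 b + 1/100 this begins to hold just at b =
    25.\<close>
  have large: "1 / (2 * real b - 1 + 1 / 100) - 1 / (2 * real (Suc b) - 1 + 1 / 100) - e \<le> C b" if "24 < b" "b \<le> B" for b
  proof -
    have b: "real b \<ge> 25" using that by simp
    have bcol: "b \<in> column 24 n b" using that assms by (auto simp: column_def)
    have "1 / ((real (b + 2) - 1)\<^sup>2 + (real b)\<^sup>2 + 1) - e \<le> (\<Sum>i<N. f b (b + 2 + 2 * i))"
      unfolding e_def f by (rule column_lower) simp
    also have "\<dots> \<le> (\<Sum>a\<in>column 24 n b - {b}. f b a)"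
      by (rule prog) (use fin that assms in \<open>auto simp: column_def\<close>)
    also have "\<dots> = (\<Sum>a\<in>column 24 n b - {b}. weight a b * f b a)"
      using that by (intro sum.cong) (auto simp: weight_def)
    finally have "f b b / 2 + 1 / ((real (b + 2) - 1)\<^sup>2 + (real b)\<^sup>2 + 1) - e \<le> C b"
      unfolding C_def using sum.remove[OF fin bcol, of "\<lambda>a. weight a b * f b a"] by (simp add: weight_def)
    moreover have "f b b / 2 = 1 / (2 * (real b) ^ 3)"
      using b by (simp add: f field_simps power2_eq_square power3_eq_cube)
    moreover have "1 / (2 * (real b)\<^sup>2) \<le> 1 / (2 * (real b) ^ 3) + 1 / ((real (b + 2) - 1)\<^sup>2 + (real b)\<^sup>2 + 1)"
    proof -
      have eq: "(real (b + 2) - 1)\<^sup>2 + (real b)\<^sup>2 + 1 = 2 * (real b)\<^sup>2 + 2 * real b + 2"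
        by (simp add: power2_eq_square algebra_simps)
      have "(real b - 1) * (2 * (real b)\<^sup>2 + 2 * real b + 2) \<le> 2 * (real b) ^ 3"
        by (simp add: power2_eq_square power3_eq_cube algebra_simps)
      then have "(real b - 1) / (2 * (real b) ^ 3) \<le> 1 / (2 * (real b)\<^sup>2 + 2 * real b + 2)"
        using b by (simp add: divide_simps add_nonneg_pos mult.commute split: if_splits)
      moreover have "(real b - 1) / (2 * (real b) ^ 3) = 1 / (2 * (real b)\<^sup>2) - 1 / (2 * (real b) ^ 3)"
        using b by (simp add: field_simps power2_eq_square power3_eq_cube)
      ultimately show ?thesis unfolding eq by linarith
    qed
    moreover have "1 / (2 * real b - 1 + 1 / 100) - 1 / (2 * real (Suc b) - 1 + 1 / 100) \<le> 1 / (2 * (real b)\<^sup>2)"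
    proof -
      define x where "x = 2 * real b + 1 / 100"
      have x: "x > 50" "2 * real b - 1 + 1 / 100 = x - 1" "2 * real (Suc b) - 1 + 1 / 100 = x + 1"
        using b by (auto simp: x_def)
      have "4 * (real b)\<^sup>2 \<le> (x - 1) * (x + 1)" using b by (simp add: x_def power2_eq_square algebra_simps)
      moreover have "0 < (x - 1) * (x + 1)" using x(1) by (intro mult_pos_pos) linarith+
      moreover have "0 < 4 * (real b)\<^sup>2" using b by simp
      ultimately have "2 / ((x - 1) * (x + 1)) \<le> 2 / (4 * (real b)\<^sup>2)"
        by (intro divide_left_mono[OF _ _ mult_pos_pos]) (assumption | simp)+
      moreover have "1 / (x - 1) - 1 / (x + 1) = 2 / ((x - 1) * (x + 1))" using x by (simp add: diff_frac_eq)
      ultimately show ?thesis unfolding x by simp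
    qed
    ultimately show ?thesis by linarith
  qed
  define S where "S = (\<Sum>b=1..24. 1 / ((real (start 24 b) - 1)\<^sup>2 + (real b)\<^sup>2 + 1))"
  define t where "t = 1 / (2 * real (Suc B) - 1 + 1 / 100)"
  have "(\<Sum>b\<le>24. (if b = 0 then 1 / 2 else 1) * (1 / ((real (start 24 b) - 1)\<^sup>2 + (real b)\<^sup>2 + 1)) - e) \<le> (\<Sum>b\<le>24. C b)"
    by (intro sum_mono small) auto
  then have 1: "1 / 2 / 626 + S - 25 * e \<le> (\<Sum>b\<le>24. C b)"
    unfolding sum_subtractf sum_half_first S_def[symmetric] by (simp add: start_def)
  have "(\<Sum>b\<in>{24<..B}. 1 / (2 * real b - 1 + 1 / 100) - 1 / (2 * real (Suc b) - 1 + 1 / 100)) =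
      (\<Sum>b=Suc 24..<Suc B. - (1 / (2 * real (Suc b) - 1 + 1 / 100)) - - (1 / (2 * real b - 1 + 1 / 100)))"
    by (intro sum.cong) auto
  also have "\<dots> = - (1 / (2 * real (Suc B) - 1 + 1 / 100)) - - (1 / (2 * real (Suc 24) - 1 + 1 / 100))"
    by (rule sum_Suc_diff') (use assms in simp)
  also have "\<dots> = 100 / 4901 - t" by (simp add: t_def)
  finally have tel: "(\<Sum>b\<in>{24<..B}. 1 / (2 * real b - 1 + 1 / 100) - 1 / (2 * real (Suc b) - 1 + 1 / 100)) = 100 / 4901 - t" .
  have "(\<Sum>b\<in>{24<..B}. 1 / (2 * real b - 1 + 1 / 100) - 1 / (2 * real (Suc b) - 1 + 1 / 100) - e) \<le> (\<Sum>b\<in>{24<..B}. C b)"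
    by (intro sum_mono large) auto
  then have 2: "100 / 4901 - t - (real B - 24) * e \<le> (\<Sum>b\<in>{24<..B}. C b)"
    unfolding sum_subtractf[of _ "\<lambda>_. e"] tel using assms(1) by (simp add: of_nat_diff)
  have 3: "(\<Sum>b\<le>24. C b) + (\<Sum>b\<in>{24<..B}. C b) = (\<Sum>b\<le>B. C b)"
  proof -
    have "{..B} = {..24} \<union> {24<..B}" using assms(1) by auto
    moreover have "sum C ({..24} \<union> {24<..B}) = sum C {..24} + sum C {24<..B}"
      by (rule sum.union_disjoint) auto
    ultimately show ?thesis by simp
  qed
  have 4: "(\<Sum>b\<le>B. C b) \<le> (\<Sum>b\<le>n. C b)"
  proof (rule sum_mono2)
    show "0 \<le> C b" for b unfolding C_def
      by (intro sum_nonneg mult_nonneg_nonneg f0 less_imp_le[OF weight_pos])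
  qed (use assms in auto)
  have 5: "(\<Sum>(a, b)\<in>far_cells 24 n. weight a b * (4 * real a * low_g a b)) = (\<Sum>b\<le>n. C b)"
    unfolding sum_far_cells_columns C_def f_def ..
  have 6: "t \<le> 1 / (2 * real B + 1)"
    unfolding t_def by (intro divide_left_mono) auto
  have 7: "(real B + 1) / (4 * (real N)\<^sup>2 + 1) = 25 * e + (real B - 24) * e"
    by (simp add: e_def add_divide_distrib diff_divide_distrib)
  have "p + S + r - u - (c + y) \<le> (p + S - c) + (r - t - y)" if "t \<le> u" for p r u c y :: real
    using that by simp
  from this[OF 6] have "1 / 2 / 626 + S + 100 / 4901 - 1 / (2 * real B + 1) - (25 * e + (real B - 24) * e) \<le>
      (1 / 2 / 626 + S - 25 * e) + (100 / 4901 - t - (real B - 24) * e)" .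
  also have "\<dots> \<le> (\<Sum>b\<le>24. C b) + (\<Sum>b\<in>{24<..B}. C b)" by (rule add_mono[OF 1 2])
  also have "\<dots> \<le> (\<Sum>b\<le>n. C b)" unfolding 3 by (rule 4)
  finally show ?thesis unfolding 5 7 S_def[symmetric] .
qed

section \<open>Fixed-point evaluation of path lengths\<close>

definition scale :: int where "scale = 2 ^ 40"

definition approx :: "real \<Rightarrow> int \<Rightarrow> real \<Rightarrow> bool" where
  "approx e p v \<longleftrightarrow> 0 \<le> p \<and> of_int p \<le> of_int scale * v \<and> of_int scale * v \<le> of_int p + e"

lemma approx_mono: "approx e p v \<Longrightarrow> e \<le> e' \<Longrightarrow> approx e' p v"
  by (simp add: approx_def)

lemma div_bounds:
  fixes m d :: int
  assumes "0 < d"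
  shows "real_of_int (m div d) \<le> of_int m / of_int d" "of_int m / of_int d \<le> real_of_int (m div d) + 1"
proof -
  have 1: "real_of_int m = of_int d * of_int (m div d) + of_int (m mod d)"
    by (metis mult_div_mod_eq of_int_add of_int_mult)
  have 2: "0 \<le> m mod d" "m mod d < d" using assms by auto
  then have 3: "0 \<le> real_of_int (m mod d)" "real_of_int (m mod d) \<le> of_int d" by simp_all
  show "real_of_int (m div d) \<le> of_int m / of_int d" "of_int m / of_int d \<le> real_of_int (m div d) + 1"
    using assms 1 3 by (simp_all add: field_simps)
qed

text \<open>A factor of at most 1 does not enlarge the error, and rounding down adds one unit; the
  error stays one-sided.\<close>

lemma approx_div:
  assumes "approx e p v" "0 \<le> m" "m \<le> d" "0 < d" "0 \<le> e"
  shows "approx (e + 1) (p * m div d) (v * (of_int m / of_int d))"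
proof -
  define r where "r = real_of_int m / of_int d"
  have r: "0 \<le> r" "r \<le> 1" using assms by (auto simp: r_def)
  have "0 \<le> p * m div d" using assms by (simp add: approx_def pos_imp_zdiv_nonneg_iff)
  moreover have "real_of_int (p * m div d) \<le> of_int p * r" "of_int p * r \<le> real_of_int (p * m div d) + 1"
    using div_bounds[OF assms(4), of "p * m"] by (simp_all add: r_def)
  moreover have "of_int p * r \<le> (of_int scale * v) * r" "(of_int scale * v) * r \<le> (of_int p + e) * r"
    using assms(1) r by (auto simp: approx_def intro!: mult_right_mono)
  moreover have "e * r \<le> e" using r assms(5) mult_left_mono[of r 1 e] by simp
  ultimately show ?thesis by (simp add: approx_def r_def[symmetric] algebra_simps)
qed

text \<open>Products in steps of 2 with an accumulator. Whole products are formed before dividing,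
  so that a jump over many steps costs a single rounding.\<close>

fun rising :: "nat \<Rightarrow> int \<Rightarrow> int \<Rightarrow> int" where
  "rising 0 y p = p"
| "rising (Suc n) y p = rising n (y + 2) (p * y)"

fun falling :: "nat \<Rightarrow> int \<Rightarrow> int \<Rightarrow> int" where
  "falling 0 y p = p"
| "falling (Suc n) y p = falling n (y - 2) (p * y)"

lemma rising_eq: "rising n y p = p * rising n y 1"
proof (induction n arbitrary: y p)
  case (Suc n)
  show ?case using Suc[of "y + 2" "p * y"] Suc[of "y + 2" y] by simp
qed simp

lemma falling_eq: "falling n y p = p * falling n y 1"
proof (induction n arbitrary: y p)
  case (Suc n)
  show ?case using Suc[of "y - 2" "p * y"] Suc[of "y - 2" y] by simp
qed simp

lemma rising_Suc: "rising (Suc n) y 1 = y * rising n (y + 2) 1"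
  using rising_eq[of n "y + 2" y] by simp

lemma falling_Suc: "falling (Suc n) y 1 = y * falling n (y - 2) 1"
  using falling_eq[of n "y - 2" y] by simp

lemma rising_pos: "0 < y \<Longrightarrow> 0 < rising n y 1"
proof (induction n arbitrary: y)
  case (Suc n)
  then show ?case by (simp add: rising_Suc del: rising.simps)
qed simp

lemma rising_mono: "0 \<le> y \<Longrightarrow> y \<le> y' \<Longrightarrow> 0 \<le> rising n y 1 \<and> rising n y 1 \<le> rising n y' 1"
proof (induction n arbitrary: y y')
  case (Suc n)
  then show ?case using Suc.IH[of "y + 2" "y' + 2"] by (simp add: rising_Suc mult_mono del: rising.simps)
qed simp

lemma falling_le_rising:
  "2 * int n \<le> y + 2 \<Longrightarrow> 0 \<le> y \<Longrightarrow> y \<le> y' \<Longrightarrow> 0 \<le> falling n y 1 \<and> falling n y 1 \<le> rising n y' 1"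
proof (induction n arbitrary: y y')
  case (Suc n)
  show ?case
  proof (cases n)
    case 0
    then show ?thesis using Suc.prems by simp
  next
    case (Suc m)
    then show ?thesis using Suc.IH[of "y - 2" "y' + 2"] Suc.prems
      by (simp add: rising_Suc falling_Suc mult_mono del: rising.simps falling.simps)
  qed
qed simp

lemma central_rising: "central m * of_int (rising n (2 * int m + 1) 1) = central (m + n) * of_int (rising n (2 * int m + 2) 1)"
proof (induction n arbitrary: m)
  case (Suc n)
  have "central m * (2 * real m + 1) = central (Suc m) * (2 * real m + 2)"
    by (simp add: central_Suc field_simps)
  moreover have "central (Suc m) * of_int (rising n (2 * int m + 3) 1) = central (m + Suc n) * of_int (rising n (2 * int m + 4) 1)"
    using Suc[of "Suc m"] by (simp add: algebra_simps)
  ultimately have "central m * ((2 * real m + 1) * of_int (rising n (2 * int m + 3) 1)) =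
      central (m + Suc n) * ((2 * real m + 2) * of_int (rising n (2 * int m + 4) 1))"
    by algebra
  then show ?case by (simp add: rising_Suc add.assoc del: rising.simps)
qed simp

text \<open>One division costs one unit, but the recorded error is the index itself. It then does
  not depend on which indices the table visits.\<close>

lemma approx_central_step:
  assumes "approx (real m) c (central m)" "0 < n"
  shows "approx (real (m + n)) (rising n (2 * int m + 1) c div rising n (2 * int m + 2) 1) (central (m + n))"
proof (rule approx_mono)
  have "0 \<le> rising n (2 * int m + 1) 1" "rising n (2 * int m + 1) 1 \<le> rising n (2 * int m + 2) 1"
    using rising_mono[of "2 * int m + 1" "2 * int m + 2"] by auto
  moreover have pos: "0 < rising n (2 * int m + 2) 1" by (rule rising_pos) simp
  ultimately show "approx (real m + 1) (rising n (2 * int m + 1) c div rising n (2 * int m + 2) 1) (central (m + n))"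
    using approx_div[OF assms(1), of "rising n (2 * int m + 1) 1" "rising n (2 * int m + 2) 1"] central_rising[of m n]
    by (simp add: rising_eq[of n _ c] eq_divide_eq)
qed (use assms in auto)

lemma bin_prob_falling:
  assumes "x + 2 * n \<le> t"
  shows "bin_prob t (int x) * of_int (falling n (int t - int x) 1) =
    bin_prob t (int (x + 2 * n)) * of_int (rising n (int t + int x + 2) 1)"
  using assms
proof (induction n arbitrary: x)
  case (Suc n)
  have "bin_prob t (int x) * (real t - real x) = bin_prob t (int (x + 2)) * (real t + real x + 2)"
    using bin_prob_step[of t x] by (simp add: mult.commute add.commute)
  moreover have "bin_prob t (int (x + 2)) * of_int (falling n (int t - int x - 2) 1) =
      bin_prob t (int (x + 2 * Suc n)) * of_int (rising n (int t + int x + 2 + 2) 1)"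
    using Suc.IH[of "x + 2"] Suc.prems by (simp add: algebra_simps)
  ultimately have "bin_prob t (int x) * ((real t - real x) * of_int (falling n (int t - int x - 2) 1)) =
      bin_prob t (int (x + 2 * Suc n)) * ((real t + real x + 2) * of_int (rising n (int t + int x + 2 + 2) 1))"
    by algebra
  then show ?case
    by (simp add: rising_Suc falling_Suc del: rising.simps falling.simps of_nat_add)
qed simp

lemma approx_offset:
  assumes "approx e p (bin_prob t (int x))" "x + 2 * n \<le> t" "0 \<le> e"
  shows "approx (e + 1) (falling n (int t - int x) p div rising n (int t + int x + 2) 1) (bin_prob t (int (x + 2 * n)))"
proof -
  have "0 \<le> falling n (int t - int x) 1" "falling n (int t - int x) 1 \<le> rising n (int t + int x + 2) 1"
    using falling_le_rising[of n "int t - int x" "int t + int x + 2"] assms(2) by auto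
  moreover have pos: "0 < rising n (int t + int x + 2) 1" by (rule rising_pos) simp
  ultimately show ?thesis
    using approx_div[OF assms(1), of "falling n (int t - int x) 1" "rising n (int t + int x + 2) 1"]
      bin_prob_falling[OF assms(2)] assms(3)
    by (simp add: falling_eq[of n _ p] eq_divide_eq del: of_nat_add)
qed

text \<open>Starting from the central value \<open>c\<close>, \<open>i\<close> ratios lead to the
  probability at \<open>b\<close> and \<open>j\<close> further ones to that at
  \<open>a = b + 2 * j\<close>, so the first result is reused for the second.\<close>

definition sample :: "int \<Rightarrow> int \<Rightarrow> nat \<Rightarrow> nat \<Rightarrow> int \<Rightarrow> int \<times> int" where
  "sample t e i j c = (let b = e + 2 * int i; q = falling i (t - e) c div rising i (t + e + 2) 1;
     p = falling j (t - b) q div rising j (t + b + 2) 1; g = p * q div (scale * t) in (g, g div t))"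

lemma bin_prob_le_1: "bin_prob t k \<le> 1"
proof (induction t arbitrary: k)
  case (Suc t)
  show ?case using Suc[of "k - 1"] Suc[of "k + 1"] by (simp add: bin_prob_Suc)
qed (simp add: bin_prob_zero)

definition close :: "int \<Rightarrow> real \<Rightarrow> bool" where
  "close p v \<longleftrightarrow> \<bar>of_int p - of_int scale * v\<bar> \<le> 9"

text \<open>The errors of the two factors grow with \<open>n\<close>, but \<open>gval\<close>
  divides by \<open>t\<close>: in total they contribute at most 7 units. Rounding \<open>g\<close>
  makes 8 and rounding \<open>h\<close> makes 9.\<close>

lemma sample_close:
  assumes "approx (real n) c (central n)" "e < 2" "t + e = 2 * n" "0 < n" "n \<le> 300" "e + 2 * i + 2 * j \<le> t"
  shows "close (fst (sample (int t) (int e) i j c)) (gval (e + 2 * i + 2 * j) (e + 2 * i) t)"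
    and "close (snd (sample (int t) (int e) i j c)) (hval (e + 2 * i + 2 * j) (e + 2 * i) t)"
proof -
  define b a where "b = e + 2 * i" and "a = b + 2 * j"
  have t: "t > 0" using assms by (cases "e = 0") auto
  have base: "bin_prob t (int e) = central n"
  proof (cases "e = 0")
    case True
    then show ?thesis using assms(3) by (simp add: central_def)
  next
    case False
    then have "e = 1" "t = 2 * (n - 1) + 1" using assms(2-4) by auto
    then show ?thesis using central_odd[of "n - 1"] assms(4) by simp
  qed
  define q where "q = falling i (int t - int e) c div rising i (int t + int e + 2) 1"
  define p where "p = falling j (int t - int b) q div rising j (int t + int b + 2) 1"
  have q: "approx (real n + 1) q (bin_prob t (int b))"
    unfolding q_def b_def by (rule approx_offset) (use assms base in auto)
  have p: "approx (real n + 1 + 1) p (bin_prob t (int a))"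
    unfolding p_def a_def by (rule approx_offset[OF q]) (use assms(6) b_def in auto)
  define S where "S = real_of_int scale"
  have S: "S \<ge> 6000" "S > 0" by (simp_all add: S_def scale_def)
  define T where "T = real t"
  have T: "1 \<le> T" "T \<le> 600" "real n + 2 \<le> 3 * T" "real n + 1 \<le> 3 * T" using assms t by (auto simp: T_def)
  define P Q where "P = S * bin_prob t (int a)" and "Q = S * bin_prob t (int b)"
  have PQ: "0 \<le> real_of_int p" "of_int p \<le> P" "P \<le> of_int p + 3 * T" "P \<le> S"
    "0 \<le> real_of_int q" "of_int q \<le> Q" "Q \<le> of_int q + 3 * T" "Q \<le> S"
    using p q S T bin_prob_le_1 by (auto simp: approx_def P_def Q_def S_def)
  have low: "real_of_int p * real_of_int q \<le> P * Q" using PQ by (intro mult_mono) auto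
  have "P * Q \<le> (of_int p + 3 * T) * (of_int q + 3 * T)" using PQ T by (intro mult_mono) auto
  also have "\<dots> = of_int p * of_int q + T * (3 * of_int p + 3 * of_int q + 9 * T)" by (simp add: algebra_simps)
  also have "\<dots> \<le> of_int p * of_int q + T * (7 * S)"
    using PQ S T by (intro add_left_mono mult_left_mono) auto
  finally have up: "P * Q \<le> of_int p * of_int q + 7 * (S * t)" by (simp add: T_def mult_ac)
  define g where "g = p * q div (scale * int t)"
  have d: "0 < scale * int t" using t by (simp add: scale_def)
  have g: "real_of_int g \<le> of_int p * of_int q / (S * t)" "of_int p * of_int q / (S * t) \<le> real_of_int g + 1"
    using div_bounds[OF d, of "p * q"] by (simp_all add: g_def S_def)
  have eq: "S * gval a b t = P * Q / (S * t)" using S by (simp add: gval_def P_def Q_def)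
  have "of_int p * of_int q / (S * t) \<le> P * Q / (S * t)"
    using low S t by (intro divide_right_mono) auto
  moreover have "P * Q / (S * t) \<le> (of_int p * of_int q + 7 * (S * t)) / (S * t)"
    using up S t by (intro divide_right_mono) auto
  moreover have "(of_int p * of_int q + 7 * (S * t)) / (S * t) = of_int p * of_int q / (S * t) + 7"
    using S t by (simp add: add_divide_distrib)
  ultimately have G: "real_of_int g \<le> S * gval a b t" "S * gval a b t \<le> real_of_int g + 8"
    unfolding eq using g by linarith+
  have h: "real_of_int (g div int t) \<le> of_int g / t" "of_int g / t \<le> real_of_int (g div int t) + 1"
    using div_bounds[of "int t" g] t by simp_all
  have heq: "S * hval a b t = S * gval a b t / t" by (simp add: hval_eq)
  have "of_int g / real t \<le> S * gval a b t / t" using G(1) by (intro divide_right_mono) auto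
  moreover have "S * gval a b t / t \<le> (of_int g + 8) / t" using G(2) by (intro divide_right_mono) auto
  moreover have "8 / real t \<le> 8" using t by (simp add: divide_le_eq)
  ultimately have H: "\<bar>real_of_int (g div int t) - S * hval a b t\<bar> \<le> 9"
    unfolding heq add_divide_distrib using h by linarith
  have s: "sample (int t) (int e) i j c = (g, g div int t)"
    by (simp add: sample_def Let_def g_def p_def q_def b_def)
  show "close (fst (sample (int t) (int e) i j c)) (gval (e + 2 * i + 2 * j) (e + 2 * i) t)"
    using G unfolding s by (simp add: close_def S_def a_def b_def)
  show "close (snd (sample (int t) (int e) i j c)) (hval (e + 2 * i + 2 * j) (e + 2 * i) t)"
    using H unfolding s by (simp add: close_def S_def a_def b_def)
qed

text \<open>Twice the six support functions, to stay within the integers.\<close>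

definition supports :: "int \<Rightarrow> int \<Rightarrow> int \<Rightarrow> int list" where
  "supports x y z = [max (2 * \<bar>x\<bar> - z) (2 * \<bar>y\<bar> + z), max (2 * \<bar>x\<bar> + z) (2 * \<bar>y\<bar> - z),
     2 * max \<bar>x\<bar> (\<bar>z\<bar> - y), 2 * max \<bar>x\<bar> (\<bar>z\<bar> + y), 2 * max \<bar>y\<bar> (\<bar>z\<bar> - x), 2 * max \<bar>y\<bar> (\<bar>z\<bar> + x)]"

lemma length_supports [simp]: "length (supports x y z) = 6"
  by (simp add: supports_def)

lemma supports_nth: "k < 6 \<Longrightarrow> real_of_int (supports x y z ! k) = 2 * support k (of_int x, of_int y, of_int z)"
  unfolding less_6_iff
  by (elim insertE emptyE) (simp_all add: supports_def support_simps of_int_max max_mult_distrib_left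
      distrib_left right_diff_distrib)

fun lengths :: "int \<Rightarrow> int \<Rightarrow> int \<Rightarrow> int \<Rightarrow> (int \<times> int) list \<Rightarrow> int list" where
  "lengths a b g h [] = supports (- (a * g)) (- (b * g)) (- (a * b * h))"
| "lengths a b g h ((g', h') # r) =
     map2 (+) (supports (a * (g' - g)) (b * (g' - g)) (a * b * (h' - h))) (lengths a b g' h' r)"

lemma length_lengths [simp]: "length (lengths a b g h l) = 6"
  by (induction a b g h l rule: lengths.induct) auto

text \<open>A sublinear function bounded by the 1-norm is 1-Lipschitz for that norm.\<close>

lemma support_lipschitz:
  assumes "k < 6" "\<bar>x - x'\<bar> \<le> dx" "\<bar>y - y'\<bar> \<le> dy" "\<bar>z - z'\<bar> \<le> dz"
  shows "\<bar>support k (x, y, z) - support k (x', y', z')\<bar> \<le> dx + dy + dz"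
proof -
  have bound: "support k (u, v, w) \<le> \<bar>u\<bar> + \<bar>v\<bar> + \<bar>w\<bar>" for u v w
    using assms(1) unfolding less_6_iff by (elim insertE emptyE) (simp_all add: support_simps, simp_all add: abs_if)
  have "support k ((x', y', z') + (x - x', y - y', z - z')) \<le> support k (x', y', z') + support k (x - x', y - y', z - z')"
    "support k ((x, y, z) + (x' - x, y' - y, z' - z)) \<le> support k (x, y, z) + support k (x' - x, y' - y, z' - z)"
    by (rule support_add[OF assms(1)])+
  moreover have "support k (x - x', y - y', z - z') \<le> dx + dy + dz"
    by (rule order_trans[OF bound]) (use assms(2-4) in linarith)
  moreover have "support k (x' - x, y' - y, z' - z) \<le> dx + dy + dz"
    by (rule order_trans[OF bound]) (use assms(2-4) abs_minus_commute[of x x'] abs_minus_commute[of y y']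
      abs_minus_commute[of z z'] in linarith)
  ultimately show ?thesis by (intro abs_leI) simp_all
qed

text \<open>Each increment is a difference of two values with error 9, and lengths are doubled: 36 =
  2 * 18 per unit of the coefficients a, b and a b.\<close>

definition slack :: "nat \<Rightarrow> nat \<Rightarrow> real" where
  "slack a b = 36 * (real a + real b + real a * real b)"

lemma support_scale: "k < 6 \<Longrightarrow> c \<ge> 0 \<Longrightarrow> support k (c * x, c * y, c * z) = c * support k (x, y, z)"
  unfolding less_6_iff
  by (elim insertE emptyE) (simp_all add: support_simps abs_mult max_mult_distrib_left distrib_left right_diff_distrib)

lemma lengths_close:
  assumes "k < 6" "close g (gval a b s)" "close h (hval a b s)"
    and "list_all2 (\<lambda>(g, h) t. close g (gval a b t) \<and> close h (hval a b t)) l ts"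
  shows "\<bar>of_int (lengths (int a) (int b) g h l ! k) -
      2 * of_int scale * chain_length k (influence_vec (int a, int b)) (influence_vec (int a, int b) s) ts\<bar>
    \<le> slack a b * (real (length ts) + 1)"
  using assms(2-4)
proof (induction l arbitrary: g h s ts)
  define A B S where "A = real a" and "B = real b" and "S = real_of_int scale"
  have AB: "A \<ge> 0" "B \<ge> 0" "A * B \<ge> 0" "S \<ge> 0" by (simp_all add: A_def B_def S_def scale_def)
  have gen: "\<bar>2 * support k (A * u, B * u, A * B * w) - 2 * S * support k (A * u', B * u', A * B * w')\<bar> \<le> slack a b"
    if "\<bar>u - S * u'\<bar> \<le> 18" "\<bar>w - S * w'\<bar> \<le> 18" for u w u' w'
  proof -
    have "\<bar>A * u - A * (S * u')\<bar> = A * \<bar>u - S * u'\<bar>" "\<bar>B * u - B * (S * u')\<bar> = B * \<bar>u - S * u'\<bar>"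
      "\<bar>A * B * w - A * B * (S * w')\<bar> = A * B * \<bar>w - S * w'\<bar>"
      using AB by (simp_all add: abs_mult flip: right_diff_distrib)
    then have "\<bar>support k (A * u, B * u, A * B * w) - support k (A * (S * u'), B * (S * u'), A * B * (S * w'))\<bar>
        \<le> A * 18 + B * 18 + A * B * 18"
      using that AB by (intro support_lipschitz[OF assms(1)]) (auto intro!: mult_left_mono)
    moreover have "support k (A * (S * u'), B * (S * u'), A * B * (S * w')) = S * support k (A * u', B * u', A * B * w')"
      using support_scale[OF assms(1) AB(4), of "A * u'" "B * u'" "A * B * w'"] by (simp add: mult_ac)
    ultimately show ?thesis by (simp add: slack_def A_def B_def algebra_simps abs_le_iff)
  qed
  {
    case Nil
    have "\<bar>- of_int g - S * (- gval a b s)\<bar> \<le> 18" "\<bar>- of_int h - S * (- hval a b s)\<bar> \<le> 18"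
      using Nil by (auto simp: close_def S_def)
    from gen[OF this] show ?case using Nil
      by (simp add: supports_nth[OF assms(1)] influence_vec_nat A_def B_def S_def)
  next
    case (Cons gh l)
    obtain g' h' where gh: "gh = (g', h')" by (cases gh)
    obtain t ts' where ts: "ts = t # ts'" using Cons.prems(3) by (cases ts) auto
    have t: "close g' (gval a b t)" "close h' (hval a b t)"
      "list_all2 (\<lambda>(g, h) t. close g (gval a b t) \<and> close h (hval a b t)) l ts'"
      using Cons.prems(3) by (auto simp: gh ts)
    note IH = Cons.IH[OF t]
    have "\<bar>of_int (g' - g) - S * (gval a b t - gval a b s)\<bar> \<le> 18" "\<bar>of_int (h' - h) - S * (hval a b t - hval a b s)\<bar> \<le> 18"
      using t Cons.prems(1,2) by (auto simp: close_def S_def algebra_simps abs_le_iff)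
    from gen[OF this] have "\<bar>of_int (supports (int a * (g' - g)) (int b * (g' - g)) (int a * int b * (h' - h)) ! k) -
        2 * S * support k (influence_vec (int a, int b) t - influence_vec (int a, int b) s)\<bar> \<le> slack a b"
      by (simp add: supports_nth[OF assms(1)] influence_vec_nat A_def B_def right_diff_distrib mult.assoc)
    then show ?case using IH assms(1)
      by (simp add: gh ts S_def algebra_simps abs_le_iff)
  }
qed

text \<open>The values \<open>2 ^ 40 * central n\<close> for the \<open>n\<close> at which the path lengths below are sampled,
  rounded down step by step.\<close>

definition central_value :: "int \<Rightarrow> int" where
  "central_value n = (if n < 35 then (if n < 18 then (if n < 9 then (if n < 5 then (if n < 3 then (if n < 2 then (if n = 1 then 549755813888 else 0)
    else (if n = 2 then 412316860416 else 0))
    else (if n < 4 then (if n = 3 then 343597383680 else 0)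
    else (if n = 4 then 300647710720 else 0)))
    else (if n < 7 then (if n < 6 then (if n = 5 then 270582939648 else 0)
    else (if n = 6 then 248034361344 else 0))
    else (if n < 8 then (if n = 7 then 230317621248 else 0)
    else (if n = 8 then 215922769920 else 0))))
    else (if n < 13 then (if n < 11 then (if n < 10 then (if n = 9 then 203927060480 else 0)
    else (if n = 10 then 193730707456 else 0))
    else (if n < 12 then (if n = 11 then 184924766208 else 0)
    else (if n = 12 then 177219567616 else 0)))
    else (if n < 15 then (if n < 14 then (if n = 13 then 170403430400 else 0)
    else (if n = 14 then 164317593600 else 0))
    else (if n < 16 then (if n = 15 then 158840340480 else 0)
    else (if n < 17 then (if n = 16 then 153876579840 else 0)
    else (if n = 17 then 149350798080 else 0))))))
    else (if n < 26 then (if n < 22 then (if n < 20 then (if n < 19 then (if n = 18 then 145202164800 else 0)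
    else (if n = 19 then 141381055200 else 0))
    else (if n < 21 then (if n = 20 then 137846528820 else 0)
    else (if n = 21 then 134564468610 else 0)))
    else (if n < 24 then (if n < 23 then (if n = 22 then 131506185232 else 0)
    else (if n = 23 then 128647355118 else 0))
    else (if n < 25 then (if n = 24 then 125967201886 else 0)
    else (if n = 25 then 123447857848 else 0))))
    else (if n < 30 then (if n < 28 then (if n < 27 then (if n = 26 then 121073860581 else 0)
    else (if n = 27 then 118831752051 else 0))
    else (if n < 29 then (if n = 28 then 116709756478 else 0)
    else (if n = 29 then 114697519297 else 0)))
    else (if n < 32 then (if n < 31 then (if n = 30 then 112785893975 else 0)
    else (if n = 31 then 110966766652 else 0))
    else (if n < 33 then (if n = 32 then 109232910923 else 0)
    else (if n < 34 then (if n = 33 then 107577866818 else 0)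
    else (if n = 34 then 105995839364 else 0)))))))
    else (if n < 78 then (if n < 50 then (if n < 42 then (if n < 38 then (if n < 36 then (if n = 35 then 104481613087 else 0)
    else (if n = 36 then 103030479571 else 0))
    else (if n < 40 then (if n = 38 then 100300831374 else 0)
    else (if n = 40 then 97777236738 else 0)))
    else (if n < 46 then (if n < 44 then (if n = 42 then 95435011990 else 0)
    else (if n = 44 then 93253424110 else 0))
    else (if n < 48 then (if n = 46 then 91214913268 else 0)
    else (if n = 48 then 89304494539 else 0))))
    else (if n < 61 then (if n < 55 then (if n < 52 then (if n = 50 then 87509291944 else 0)
    else (if n = 52 then 85818171577 else 0))
    else (if n < 58 then (if n = 55 then 83455800287 else 0)
    else (if n = 58 then 81278358777 else 0)))
    else (if n < 67 then (if n < 64 then (if n = 61 then 79262914061 else 0)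
    else (if n = 64 then 77390326765 else 0))
    else (if n < 70 then (if n = 67 then 75644480637 else 0)
    else (if n < 74 then (if n = 70 then 74011695075 else 0)
    else (if n = 74 then 71990539853 else 0))))))
    else (if n < 120 then (if n < 94 then (if n < 86 then (if n < 82 then (if n = 78 then 70126410373 else 0)
    else (if n = 82 then 68399973551 else 0))
    else (if n < 90 then (if n = 86 then 66795072581 else 0)
    else (if n = 90 then 65298086031 else 0)))
    else (if n < 104 then (if n < 99 then (if n = 94 then 63897438228 else 0)
    else (if n = 99 then 62267143585 else 0))
    else (if n < 109 then (if n = 104 then 60755588777 else 0)
    else (if n < 114 then (if n = 109 then 59349026382 else 0)
    else (if n = 114 then 58035838820 else 0)))))
    else (if n < 146 then (if n < 132 then (if n < 126 then (if n = 120 then 56569439842 else 0)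
    else (if n = 126 then 55208858912 else 0))
    else (if n < 139 then (if n = 132 then 53941952440 else 0)
    else (if n = 139 then 52568663806 else 0)))
    else (if n < 161 then (if n < 153 then (if n = 146 then 51295189134 else 0)
    else (if n = 153 then 50109995019 else 0))
    else (if n < 169 then (if n = 161 then 48851147257 else 0)
    else (if n < 177 then (if n = 169 then 47682642411 else 0)
    else (if n = 177 then 46594167028 else 0))))))))"

text \<open>A certificate check: each tabulated value is recomputed from its predecessor by one
  jump. The limit 300 is the one in \<open>sample_close\<close>.\<close>

fun central_chain :: "int \<Rightarrow> int \<Rightarrow> int list \<Rightarrow> bool" where
  "central_chain m c [] = True"
| "central_chain m c (n # ns) = (m < n \<and> n \<le> 300 \<and>
     central_value n = rising (nat (n - m)) (2 * m + 1) c div rising (nat (n - m)) (2 * m + 2) 1 \<and>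
     central_chain n (central_value n) ns)"

lemma central_chain_sound:
  assumes "central_chain m c ns" "0 \<le> m" "approx (real (nat m)) c (central (nat m))" "n \<in> set ns"
  shows "0 < n \<and> n \<le> 300 \<and> approx (real (nat n)) (central_value n) (central (nat n))"
  using assms
proof (induction m c ns rule: central_chain.induct)
  case (2 m c k ns)
  have k: "m < k" "k \<le> 300" "central_chain k (central_value k) ns"
    "central_value k = rising (nat (k - m)) (2 * m + 1) c div rising (nat (k - m)) (2 * m + 2) 1"
    using 2(2) by auto
  have "nat m + nat (k - m) = nat k" using k(1) 2(3) by simp
  then have ap: "approx (real (nat k)) (central_value k) (central (nat k))"
    using approx_central_step[OF 2(4), of "nat (k - m)"] k 2(3) by simp
  show ?case
  proof (cases "n = k")
    case True
    then show ?thesis using ap k(1,2) 2(3) by simp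
  next
    case False
    then have "n \<in> set ns" using 2(5) by simp
    show ?thesis by (rule 2(1)[OF k(3) _ ap \<open>n \<in> set ns\<close>]) (use k(1) 2(3) in simp)
  qed
qed simp

lemma central_chain_values: "central_chain 0 (2 ^ 40) [1, 2, 3, 4, 5, 6, 7, 8, 9, 10, 11, 12, 13, 14, 15, 16, 17, 18, 19, 20, 21, 22, 23, 24, 25, 26, 27, 28, 29, 30, 31, 32, 33, 34, 35, 36, 38, 40, 42, 44, 46, 48, 50, 52, 55, 58, 61, 64, 67, 70, 74, 78, 82, 86, 90, 94, 99, 104, 109, 114, 120, 126, 132, 139, 146, 153, 161, 169, 177]"
  by code_simp

text \<open>A positive value doubles as the test that \<open>n\<close> is tabulated.\<close>

lemma central_value_support: "0 < central_value n \<Longrightarrow> n \<in> set [1, 2, 3, 4, 5, 6, 7, 8, 9, 10, 11, 12, 13, 14, 15, 16, 17, 18, 19, 20, 21, 22, 23, 24, 25, 26, 27, 28, 29, 30, 31, 32, 33, 34, 35, 36, 38, 40, 42, 44, 46, 48, 50, 52, 55, 58, 61, 64, 67, 70, 74, 78, 82, 86, 90, 94, 99, 104, 109, 114, 120, 126, 132, 139, 146, 153, 161, 169, 177]"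
  unfolding central_value_def by (simp split: if_split_asm)

lemma central_value_approx:
  assumes "0 < central_value n"
  shows "0 < n" "n \<le> 300" "approx (real (nat n)) (central_value n) (central (nat n))"
proof -
  have "approx (real (nat 0)) (2 ^ 40) (central (nat 0))"
    by (simp add: approx_def scale_def central_0)
  from central_chain_sound[OF central_chain_values _ this central_value_support[OF assms]]
  show "0 < n" "n \<le> 300" "approx (real (nat n)) (central_value n) (central (nat n))" by auto
qed

definition cell_lengths :: "int \<Rightarrow> nat \<Rightarrow> nat \<Rightarrow> int list \<Rightarrow> int list" where
  "cell_lengths e i j ns = (let b = e + 2 * int i; a = b + 2 * int j in
     lengths a b 0 0 (map (\<lambda>n. sample (2 * n - e) e i j (central_value n)) ns))"

text \<open>The extra unit makes the resulting lower bounds strict, as needed where optimal rotor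
  sequences are compared.\<close>

definition cell_slack :: "int \<Rightarrow> nat \<Rightarrow> nat \<Rightarrow> int list \<Rightarrow> int" where
  "cell_slack e i j ns = (let b = e + 2 * int i; a = b + 2 * int j in
     36 * (a + b + a * b) * (int (length ns) + 1) + 1)"

text \<open>The first condition says that the time \<open>2 * n - e\<close> is at least
  \<open>a\<close>; the second that its central value is in the table.\<close>

definition valid_times :: "int \<Rightarrow> nat \<Rightarrow> nat \<Rightarrow> int list \<Rightarrow> bool" where
  "valid_times e i j ns \<longleftrightarrow> list_all (\<lambda>n. e + int i + int j \<le> n \<and> 0 < central_value n) ns"

lemma cell_lengths_close:
  assumes "k < 6" "e < 2" "valid_times (int e) i j ns" and b: "b = e + 2 * i" and a: "a = e + 2 * i + 2 * j"
  shows "\<bar>of_int (cell_lengths (int e) i j ns ! k) - 2 * of_int scale *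
      chain_length k (influence_vec (int a, int b)) 0 (map (\<lambda>n. nat (2 * n - int e)) ns)\<bar>
    \<le> of_int (cell_slack (int e) i j ns) - 1"
proof -
  have 0: "gval a b 0 = 0" "hval a b 0 = 0" by (simp_all add: gval_def hval_def)
  then have c0: "close 0 (gval a b 0)" "close 0 (hval a b 0)" by (simp_all add: close_def)
  have v0: "influence_vec (int a, int b) 0 = 0" using 0 by (simp add: influence_vec_nat zero_prod_def)
  have "close (fst (sample (2 * n - int e) (int e) i j (central_value n))) (gval a b (nat (2 * n - int e))) \<and>
      close (snd (sample (2 * n - int e) (int e) i j (central_value n))) (hval a b (nat (2 * n - int e)))"
    if "n \<in> set ns" for n
  proof -
    have n: "int e + int i + int j \<le> n" "0 < central_value n"
      using assms(3) that by (auto simp: valid_times_def list_all_iff)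
    note ap = central_value_approx[OF n(2)]
    have t: "int (nat (2 * n - int e)) = 2 * n - int e" using n(1) by simp
    have h: "nat (2 * n - int e) + e = 2 * nat n" "0 < nat n" "nat n \<le> 300" "e + 2 * i + 2 * j \<le> nat (2 * n - int e)"
      using n(1) ap(1,2) by auto
    show ?thesis using sample_close[OF ap(3) assms(2) h] unfolding t a b by simp
  qed
  then have "list_all2 (\<lambda>(g, h) t. close g (gval a b t) \<and> close h (hval a b t))
      (map (\<lambda>n. sample (2 * n - int e) (int e) i j (central_value n)) ns) (map (\<lambda>n. nat (2 * n - int e)) ns)"
    by (simp add: list_all2_map1 list_all2_map2 list_all2_same case_prod_beta)
  from lengths_close[OF assms(1) c0 this, unfolded v0]
  show ?thesis by (simp add: cell_lengths_def cell_slack_def slack_def Let_def a b algebra_simps)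
qed

section \<open>Tables of orbit bounds\<close>

definition cell_weight :: "int \<Rightarrow> nat \<Rightarrow> nat \<Rightarrow> int" where
  "cell_weight e i j = (if e = 0 \<and> i = 0 \<or> j = 0 then 1 else 2)"

lemma cell_weight: "weight (e + 2 * i + 2 * j) (e + 2 * i) = of_int (cell_weight (int e) i j) / 2"
  by (auto simp: weight_def cell_weight_def)

text \<open>Each entry lists scaled bounds for the contributions of one orbit of vertices to the three
  suprema; the list is empty if the data are invalid.\<close>

definition lower_values :: "int \<Rightarrow> nat \<Rightarrow> nat \<Rightarrow> int list \<Rightarrow> int list" where
  "lower_values e i j ns = (if sorted_wrt (<) ns \<and> valid_times e i j ns then
     let z = cell_lengths e i j ns; d = cell_slack e i j ns; w = cell_weight e i j in
     [w * (2 * (z ! 0 + z ! 1 - 2 * d)), w * (z ! 2 + z ! 3 + z ! 4 + z ! 5 - 4 * d), w * (4 * (Max (set z) - d))]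
   else [])"

text \<open>Skipping samples would shorten the path, so an upper bound takes all times from
  \<open>a\<close> on, up to one that \<open>late_time\<close> accepts.\<close>

definition upper_values :: "int \<Rightarrow> nat \<Rightarrow> nat \<Rightarrow> int \<Rightarrow> int list" where
  "upper_values e i j n = (let ns = [e + int i + int j..n]; b = e + 2 * int i in
     if e + int i + int j \<le> n \<and> valid_times e i j ns \<and> late_time (b + 2 * int j) b (2 * n - e) then
     let z = cell_lengths e i j ns; d = cell_slack e i j ns; w = cell_weight e i j in
     [w * (2 * (z ! 0 + z ! 1 + 2 * d)), w * (z ! 2 + z ! 3 + z ! 4 + z ! 5 + 4 * d), w * (4 * (Max (set z) + d))]
   else [])"

text \<open>An empty list annihilates every \<open>map2\<close> above it. One invalid entry or one
  row of the wrong length empties the whole total, so a result with three entries certifies all the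
  data.\<close>

fun row_sum :: "(int \<Rightarrow> nat \<Rightarrow> nat \<Rightarrow> 'x \<Rightarrow> int list) \<Rightarrow> int \<Rightarrow> nat \<Rightarrow> nat \<Rightarrow> 'x list \<Rightarrow> int list" where
  "row_sum f e i j [] = []"
| "row_sum f e i 0 (x # r) = (if r = [] then f e i 0 x else [])"
| "row_sum f e i (Suc j) (x # r) = map2 (+) (f e i (Suc j) x) (row_sum f e (Suc i) j r)"

fun table_sum :: "(int \<Rightarrow> nat \<Rightarrow> nat \<Rightarrow> 'x \<Rightarrow> int list) \<Rightarrow> int \<Rightarrow> nat \<Rightarrow> 'x list list \<Rightarrow> int list" where
  "table_sum f e j [] = [0, 0, 0]"
| "table_sum f e j (r # rs) =
     map2 (+) (row_sum f e 0 j r) (table_sum f (1 - e) (if e = 0 then j else Suc j) rs)"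

lemma cell_lengths_length: "length (cell_lengths e i j ns) = 6"
  by (simp add: cell_lengths_def Let_def)

text \<open>The index \<open>q\<close> is 0 for circular, 1 for non-circular and 2 for freely chosen
  rotor sequences. For 2 the inequality is strict because optimality only transfers strict
  bounds.\<close>

definition lower_goal :: "nat \<Rightarrow> nat \<Rightarrow> nat \<Rightarrow> real \<Rightarrow> bool" where
  "lower_goal q a b v \<longleftrightarrow> (if q = 2 then \<exists>k<6. \<exists>T. v < 8 * support_length k (int a, int b) T
     else \<exists>T. v \<le> orbit_length (q = 0) a b T)"

definition upper_goal :: "nat \<Rightarrow> nat \<Rightarrow> nat \<Rightarrow> real \<Rightarrow> bool" where
  "upper_goal q a b v \<longleftrightarrow> (if q = 2 then \<forall>k<6. \<forall>T. 8 * support_length k (int a, int b) T \<le> v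
     else \<forall>T. orbit_length (q = 0) a b T \<le> v)"

text \<open>What the table sums need from their entries, in common for lower and upper bounds; it is
  vacuous for the empty list. The denominator stems from the doubled lengths and the doubled
  weights.\<close>

definition values_sound :: "(nat \<Rightarrow> nat \<Rightarrow> real \<Rightarrow> bool) \<Rightarrow> (int \<Rightarrow> nat \<Rightarrow> nat \<Rightarrow> 'x \<Rightarrow> int list) \<Rightarrow> nat \<Rightarrow> bool" where
  "values_sound G f q \<longleftrightarrow> (\<forall>e i j x. e < 2 \<longrightarrow> 0 < e + i + j \<longrightarrow> q < length (f (int e) i j x) \<longrightarrow>
     (\<exists>v. G (e + 2 * i + 2 * j) (e + 2 * i) v \<and>
        weight (e + 2 * i + 2 * j) (e + 2 * i) * v = of_int (f (int e) i j x ! q) / (2 * of_int scale)))"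

lemma scale_pos: "0 < real_of_int scale"
  by (simp add: scale_def)

lemma sum_2_4: "(\<Sum>k<2. f k) = f 0 + f 1" "(\<Sum>k=2..<6. f k) = f 2 + f 3 + f 4 + f (5::nat)" for f :: "nat \<Rightarrow> real"
  by (simp_all add: eval_nat_numeral)

lemma lower_values_sound:
  assumes "q < 3"
  shows "values_sound (lower_goal q) lower_values q"
  unfolding values_sound_def
proof (intro allI impI)
  fix e i j ns assume e: "e < 2" "0 < e + i + j" and "q < length (lower_values (int e) i j ns)"
  then have ns: "sorted_wrt (<) ns" "valid_times (int e) i j ns"
    by (auto simp: lower_values_def split: if_splits)
  define a b where "a = e + 2 * i + 2 * j" and "b = e + 2 * i"
  define z d where "z = cell_lengths (int e) i j ns" and "d = cell_slack (int e) i j ns"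
  define ts where "ts = map (\<lambda>n. nat (2 * n - int e)) ns"
  define T where "T = sum_list ts"
  define Z D S where "Z k = real_of_int (z ! k)" and "D = real_of_int d" and "S = real_of_int scale" for k
  have mem: "int e + int i + int j \<le> n" if "n \<in> set ns" for n
    using ns(2) that by (auto simp: valid_times_def list_all_iff)
  have srt: "sorted_wrt (<) ts"
    unfolding ts_def sorted_wrt_map
    by (rule sorted_wrt_mono_rel[OF _ ns(1)]) (use mem e in force)
  have ok: "\<forall>t\<in>set ts. 0 < t \<and> t \<le> T \<and> same_parity (int a, int b) (int t)"
  proof
    fix t assume t: "t \<in> set ts"
    then obtain n where n: "n \<in> set ns" "t = nat (2 * n - int e)" by (auto simp: ts_def)
    have it: "int t = 2 * n - int e" using mem[OF n(1)] n(2) by simp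
    then have "same_parity (int a, int b) (int t)"
      by (simp add: same_parity_def a_def b_def cong_iff_dvd_diff)
    moreover have "0 < t" using mem[OF n(1)] it e by linarith
    moreover have "t \<le> T" using t unfolding T_def by (intro member_le_sum_list) auto
    ultimately show "0 < t \<and> t \<le> T \<and> same_parity (int a, int b) (int t)" by simp
  qed
  define L where "L k = support_length k (int a, int b) T" for k
  have main: "Z k - D < 2 * S * L k" if "k < 6" for k
  proof -
    have "2 * S * chain_length k (influence_vec (int a, int b)) 0 ts \<le> 2 * S * L k"
      unfolding L_def using chain_length_le_support_length[OF that srt ok] scale_pos by (simp add: S_def)
    moreover have "Z k - D + 1 \<le> 2 * S * chain_length k (influence_vec (int a, int b)) 0 ts"
      using cell_lengths_close[OF that e(1) ns(2) b_def a_def]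
      by (simp add: Z_def D_def S_def z_def d_def ts_def abs_le_iff)
    ultimately show ?thesis by simp
  qed
  have S: "S > 0" using scale_pos by (simp add: S_def)
  define w where "w = real_of_int (cell_weight (int e) i j)"
  have w: "weight a b = w / 2" using cell_weight[of e i j] by (simp add: w_def a_def b_def)
  obtain m where m: "m < 6" "Max (set z) = z ! m"
  proof -
    have "Max (set z) \<in> set z" using cell_lengths_length[of "int e" i j ns] by (intro Max_in) (auto simp: z_def)
    then show ?thesis using that cell_lengths_length[of "int e" i j ns] by (auto simp: z_def in_set_conv_nth)
  qed
  have val: "lower_values (int e) i j ns = [cell_weight (int e) i j * (2 * (z ! 0 + z ! 1 - 2 * d)),
      cell_weight (int e) i j * (z ! 2 + z ! 3 + z ! 4 + z ! 5 - 4 * d), cell_weight (int e) i j * (4 * (z ! m - d))]"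
    using ns by (simp add: lower_values_def Let_def z_def[symmetric] d_def[symmetric] m(2))
  have "\<exists>v. lower_goal q a b v \<and> weight a b * v = of_int (lower_values (int e) i j ns ! q) / (2 * S)"
  proof -
    consider "q = 0" | "q = 1" | "q = 2" using assms by linarith
    then show ?thesis
    proof cases
      case 1
      have "2 * (Z 0 + Z 1 - 2 * D) / S \<le> orbit_length True a b T"
        using main[of 0] main[of 1] S
        by (simp add: orbit_length_def sum_2_4 L_def divide_le_eq algebra_simps)
      moreover have "weight a b * (2 * (Z 0 + Z 1 - 2 * D) / S) = of_int (lower_values (int e) i j ns ! 0) / (2 * S)"
        by (simp add: w val Z_def D_def w_def)
      ultimately show ?thesis unfolding 1 lower_goal_def by auto
    next
      case 2
      have "(Z 2 + Z 3 + Z 4 + Z 5 - 4 * D) / S \<le> orbit_length False a b T"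
        using main[of 2] main[of 3] main[of 4] main[of 5] S
        by (simp add: orbit_length_def sum_2_4 L_def divide_le_eq algebra_simps)
      moreover have "weight a b * ((Z 2 + Z 3 + Z 4 + Z 5 - 4 * D) / S) = of_int (lower_values (int e) i j ns ! 1) / (2 * S)"
        by (simp add: w val Z_def D_def w_def)
      ultimately show ?thesis unfolding 2 lower_goal_def by auto
    next
      case 3
      have "4 * (Z m - D) / S < 8 * support_length m (int a, int b) T"
        using main[OF m(1)] S by (simp add: L_def divide_less_eq algebra_simps)
      moreover have "weight a b * (4 * (Z m - D) / S) = of_int (lower_values (int e) i j ns ! 2) / (2 * S)"
        by (simp add: w val Z_def D_def w_def)
      ultimately show ?thesis unfolding 3 lower_goal_def
        by (intro exI[of _ "4 * (Z m - D) / S"]) (use m(1) in auto)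
    qed
  qed
  then show "\<exists>v. lower_goal q (e + 2 * i + 2 * j) (e + 2 * i) v \<and>
      weight (e + 2 * i + 2 * j) (e + 2 * i) * v = of_int (lower_values (int e) i j ns ! q) / (2 * of_int scale)"
    by (simp add: a_def b_def S_def)
qed

lemma map_upto_times:
  assumes "n\<^sub>0 \<le> n" "2 * n\<^sub>0 - e = int a"
  shows "map (\<lambda>n. nat (2 * n - e)) [n\<^sub>0..n] = map (\<lambda>m. a + 2 * m) [0..<Suc (nat (n - n\<^sub>0))]"
proof (rule nth_equalityI)
  fix m assume "m < length (map (\<lambda>n. nat (2 * n - e)) [n\<^sub>0..n])"
  then have m: "int m \<le> n - n\<^sub>0" using assms(1) by simp
  then show "map (\<lambda>n. nat (2 * n - e)) [n\<^sub>0..n] ! m = map (\<lambda>m. a + 2 * m) [0..<Suc (nat (n - n\<^sub>0))] ! m"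
    using assms by (simp add: nth_upto del: upt_Suc)
qed (use assms in simp)

lemma upper_values_sound:
  assumes "q < 3"
  shows "values_sound (upper_goal q) upper_values q"
  unfolding values_sound_def
proof (intro allI impI)
  fix e i j n assume e: "e < 2" "0 < e + i + j" and "q < length (upper_values (int e) i j n)"
  define a b where "a = e + 2 * i + 2 * j" and "b = e + 2 * i"
  define ns where "ns = [int e + int i + int j..n]"
  from \<open>q < length _\<close> have n: "int e + int i + int j \<le> n" "valid_times (int e) i j ns"
    "late_time (int e + 2 * int i + 2 * int j) (int e + 2 * int i) (2 * n - int e)"
    by (auto simp: upper_values_def ns_def Let_def split: if_splits)
  define z d where "z = cell_lengths (int e) i j ns" and "d = cell_slack (int e) i j ns"
  define Z D S where "Z k = real_of_int (z ! k)" and "D = real_of_int d" and "S = real_of_int scale" for k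
  define M where "M = nat (n - (int e + int i + int j))"
  have S: "S > 0" using scale_pos by (simp add: S_def)
  have late: "late_time (int a) (int b) (int (a + 2 * M))"
    using n(1,3) by (simp add: a_def b_def M_def algebra_simps)
  have ts: "map (\<lambda>n. nat (2 * n - int e)) ns = map (\<lambda>m. a + 2 * m) [0..<Suc M]"
    unfolding ns_def M_def by (rule map_upto_times) (use n(1) in \<open>auto simp: a_def\<close>)
  have main: "2 * S * support_length k (int a, int b) T \<le> Z k + D" if "k < 6" for k T
  proof -
    have "support_length k (int a, int b) T \<le>
        chain_length k (influence_vec (int a, int b)) 0 (map (\<lambda>m. a + 2 * m) [0..<Suc M])"
      by (rule support_length_late[OF _ _ _ that late]) (use e in \<open>auto simp: a_def b_def\<close>)
    then have "2 * S * support_length k (int a, int b) T \<le>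
        2 * S * chain_length k (influence_vec (int a, int b)) 0 (map (\<lambda>m. a + 2 * m) [0..<Suc M])"
      using S by (intro mult_left_mono) auto
    moreover have "2 * S * chain_length k (influence_vec (int a, int b)) 0 (map (\<lambda>m. a + 2 * m) [0..<Suc M]) \<le> Z k + D"
      using cell_lengths_close[OF that e(1) n(2) b_def a_def] unfolding ts
      by (simp add: Z_def D_def S_def z_def d_def abs_le_iff)
    ultimately show ?thesis by simp
  qed
  define w where "w = real_of_int (cell_weight (int e) i j)"
  have w: "weight a b = w / 2" using cell_weight[of e i j] by (simp add: w_def a_def b_def)
  have val: "upper_values (int e) i j n = [cell_weight (int e) i j * (2 * (z ! 0 + z ! 1 + 2 * d)),
      cell_weight (int e) i j * (z ! 2 + z ! 3 + z ! 4 + z ! 5 + 4 * d), cell_weight (int e) i j * (4 * (Max (set z) + d))]"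
    using n by (simp add: upper_values_def Let_def ns_def z_def d_def)
  have "\<exists>v. upper_goal q a b v \<and> weight a b * v = of_int (upper_values (int e) i j n ! q) / (2 * S)"
  proof -
    consider "q = 0" | "q = 1" | "q = 2" using assms by linarith
    then show ?thesis
    proof cases
      case 1
      have "orbit_length True a b T \<le> 2 * (Z 0 + Z 1 + 2 * D) / S" for T
        using main[of 0 T] main[of 1 T] S
        by (simp add: orbit_length_def sum_2_4 le_divide_eq algebra_simps)
      moreover have "weight a b * (2 * (Z 0 + Z 1 + 2 * D) / S) = of_int (upper_values (int e) i j n ! 0) / (2 * S)"
        by (simp add: w val Z_def D_def w_def)
      ultimately show ?thesis unfolding 1 upper_goal_def
        by (intro exI[of _ "2 * (Z 0 + Z 1 + 2 * D) / S"]) auto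
    next
      case 2
      have "orbit_length False a b T \<le> (Z 2 + Z 3 + Z 4 + Z 5 + 4 * D) / S" for T
        using main[of 2 T] main[of 3 T] main[of 4 T] main[of 5 T] S
        by (simp add: orbit_length_def sum_2_4 le_divide_eq algebra_simps)
      moreover have "weight a b * ((Z 2 + Z 3 + Z 4 + Z 5 + 4 * D) / S) = of_int (upper_values (int e) i j n ! 1) / (2 * S)"
        by (simp add: w val Z_def D_def w_def)
      ultimately show ?thesis unfolding 2 upper_goal_def
        by (intro exI[of _ "(Z 2 + Z 3 + Z 4 + Z 5 + 4 * D) / S"]) auto
    next
      case 3
      have "8 * support_length k (int a, int b) T \<le> 4 * (of_int (Max (set z)) + D) / S" if "k < 6" for k T
      proof -
        have "z ! k \<in> set z" using that cell_lengths_length[of "int e" i j ns] by (simp add: z_def)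
        then have "Z k \<le> of_int (Max (set z))" unfolding Z_def by (intro of_int_le_iff[THEN iffD2] Max_ge) auto
        then show ?thesis using main[OF that, of T] S by (simp add: le_divide_eq algebra_simps)
      qed
      moreover have "weight a b * (4 * (of_int (Max (set z)) + D) / S) = of_int (upper_values (int e) i j n ! 2) / (2 * S)"
        by (simp add: w val D_def w_def)
      ultimately show ?thesis unfolding 3 upper_goal_def
        by (intro exI[of _ "4 * (of_int (Max (set z)) + D) / S"]) auto
    qed
  qed
  then show "\<exists>v. upper_goal q (e + 2 * i + 2 * j) (e + 2 * i) v \<and>
      weight (e + 2 * i + 2 * j) (e + 2 * i) * v = of_int (upper_values (int e) i j n ! q) / (2 * of_int scale)"
    by (simp add: a_def b_def S_def)
qed

section \<open>Joining tables\<close>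

definition region :: "(nat \<Rightarrow> nat \<Rightarrow> real \<Rightarrow> bool) \<Rightarrow> (nat \<times> nat) set \<Rightarrow> real \<Rightarrow> bool" where
  "region G A x \<longleftrightarrow> finite A \<and>
     (\<exists>v. (\<forall>(a, b)\<in>A. G a b (v a b)) \<and> (\<Sum>(a, b)\<in>A. weight a b * v a b) = x)"

lemma region_empty: "region G {} 0"
  by (simp add: region_def)

lemma region_single: "G a b v \<Longrightarrow> weight a b * v = x \<Longrightarrow> region G {(a, b)} x"
  by (auto simp: region_def intro!: exI[of _ "\<lambda>_ _. v"])

text \<open>The values on two disjoint sets of cells glue to one function, so tables evaluated
  separately and the estimate for the distant cells can be added.\<close>

lemma region_union:
  assumes "region G A x" "region G B y" "A \<inter> B = {}"
  shows "region G (A \<union> B) (x + y)"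
proof -
  obtain u where u: "finite A" "\<forall>(a, b)\<in>A. G a b (u a b)" "(\<Sum>(a, b)\<in>A. weight a b * u a b) = x"
    using assms(1) by (auto simp: region_def)
  obtain v where v: "finite B" "\<forall>(a, b)\<in>B. G a b (v a b)" "(\<Sum>(a, b)\<in>B. weight a b * v a b) = y"
    using assms(2) by (auto simp: region_def)
  define w where "w a b = (if (a, b) \<in> A then u a b else v a b)" for a b
  have "(\<Sum>(a, b)\<in>A. weight a b * w a b) = x"
    using u(3) by (simp add: w_def split_def)
  moreover have "(\<Sum>(a, b)\<in>B. weight a b * w a b) = (\<Sum>(a, b)\<in>B. weight a b * v a b)"
    by (rule sum.cong) (use assms(3) in \<open>auto simp: w_def\<close>)
  ultimately have "(\<Sum>(a, b)\<in>A \<union> B. weight a b * w a b) = x + y"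
    using u(1) v(1,3) assms(3) by (simp add: sum.union_disjoint)
  moreover have "\<forall>(a, b)\<in>A \<union> B. G a b (w a b)"
    using u(2) v(2) by (auto simp: w_def)
  ultimately show ?thesis using u(1) v(1) by (auto simp: region_def)
qed

definition row_part :: "nat \<Rightarrow> nat \<Rightarrow> (nat \<times> nat) set" where
  "row_part a b\<^sub>0 = {(a', b). a' = a \<and> b\<^sub>0 \<le> b \<and> b \<le> a \<and> even (a + b)}"

lemma row_part_step: "b < a \<Longrightarrow> even (a + b) \<Longrightarrow> row_part a b = {(a, b)} \<union> row_part a (b + 2)"
proof -
  assume "b < a" "even (a + b)"
  moreover have eq: "b \<le> c \<and> even (a + c) \<longleftrightarrow> c = b \<or> b + 2 \<le> c \<and> even (a + c)" for c
    using \<open>even (a + b)\<close> by presburger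
  moreover have "(a', c) \<in> row_part a b \<longleftrightarrow> (a', c) \<in> {(a, b)} \<union> row_part a (b + 2)" for a' c
    using eq[of c] \<open>b < a\<close> unfolding row_part_def by fastforce
  ultimately show ?thesis by (intro set_eqI) (simp only: split_paired_all)
qed

lemma row_sum_region:
  assumes "values_sound G f q" "e < 2" "0 < e + i + j" "q < length (row_sum f (int e) i j xs)"
  shows "region G (row_part (e + 2 * i + 2 * j) (e + 2 * i)) (of_int (row_sum f (int e) i j xs ! q) / (2 * of_int scale))"
  using assms(3,4)
proof (induction xs arbitrary: i j)
  case (Cons x r)
  define a b where "a = e + 2 * i + 2 * j" and "b = e + 2 * i"
  have head: "region G {(a, b)} (of_int (f (int e) i j x ! q) / (2 * of_int scale))" if len: "q < length (f (int e) i j x)"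
  proof -
    obtain v where "G a b v" "weight a b * v = of_int (f (int e) i j x ! q) / (2 * of_int scale)"
      using assms(1)[unfolded values_sound_def, rule_format, OF assms(2) Cons.prems(1) len]
      unfolding a_def b_def by (elim exE conjE)
    then show ?thesis by (rule region_single)
  qed
  show ?case
  proof (cases j)
    case 0
    then have r: "r = []" using Cons.prems(2) by (cases "r = []") auto
    have "row_part a b = {(a, b)}" by (auto simp: row_part_def a_def b_def 0)
    then show ?thesis using head Cons.prems(2) by (simp add: 0 r a_def b_def)
  next
    case (Suc j')
    have len: "q < length (f (int e) i j x)" "q < length (row_sum f (int e) (Suc i) j' r)"
      using Cons.prems(2) by (auto simp: Suc)
    have tail: "region G (row_part a (b + 2)) (of_int (row_sum f (int e) (Suc i) j' r ! q) / (2 * of_int scale))"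
      using Cons.IH[OF _ len(2)] by (simp add: a_def b_def Suc)
    have "row_part a b = {(a, b)} \<union> row_part a (b + 2)"
      by (rule row_part_step) (auto simp: a_def b_def Suc)
    moreover have "{(a, b)} \<inter> row_part a (b + 2) = {}" by (auto simp: row_part_def)
    ultimately show ?thesis
      using region_union[OF head[OF len(1)] tail] len by (simp add: a_def b_def Suc add_divide_distrib)
  qed
qed simp

definition band :: "nat \<Rightarrow> nat \<Rightarrow> (nat \<times> nat) set" where
  "band m n = {(a, b). m \<le> a \<and> a < n \<and> b \<le> a \<and> even (a + b)}"

lemma band_split: "l \<le> m \<Longrightarrow> m \<le> n \<Longrightarrow> band l n = band l m \<union> band m n"
  by (auto simp: band_def)

lemma band_disjoint: "band l m \<inter> band m n = {}"
  by (auto simp: band_def)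

lemma band_row: "e < 2 \<Longrightarrow> band (e + 2 * j) (Suc (e + 2 * j)) = row_part (e + 2 * j) e"
proof -
  assume "e < 2"
  then have e: "e \<le> b" if "even (e + 2 * j + b)" for b
    using that by presburger
  then have "(a, b) \<in> band (e + 2 * j) (Suc (e + 2 * j)) \<longleftrightarrow> (a, b) \<in> row_part (e + 2 * j) e" for a b
  proof (cases "a = e + 2 * j")
    case True
    show ?thesis unfolding True band_def row_part_def using e[of b] by (auto simp del: even_add)
  next
    case False
    then show ?thesis by (simp add: band_def row_part_def)
  qed
  then show ?thesis by (intro set_eqI) (simp only: split_paired_all)
qed

lemma table_sum_region:
  assumes "values_sound G f q" "e < 2" "0 < e + j" "q < 3" "q < length (table_sum f (int e) j rs)"
  shows "region G (band (e + 2 * j) (e + 2 * j + length rs)) (of_int (table_sum f (int e) j rs ! q) / (2 * of_int scale))"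
  using assms(2,3,5)
proof (induction rs arbitrary: e j)
  case Nil
  have "band (e + 2 * j) (e + 2 * j) = {}" by (auto simp: band_def)
  moreover have "[0, 0, 0] ! q = (0::int)" using assms(4) by (auto simp: less_Suc_eq numeral_3_eq_3)
  ultimately show ?case by (simp add: region_empty)
next
  case (Cons r rs)
  define e' j' where "e' = 1 - e" and "j' = (if e = 0 then j else Suc j)"
  have e': "e' < 2" "0 < e' + j'" "e' + 2 * j' = Suc (e + 2 * j)" "int e' = 1 - int e"
    "j' = (if int e = 0 then j else Suc j)"
    using Cons.prems(1,2) by (auto simp: e'_def j'_def less_2_cases_iff)
  have len: "q < length (row_sum f (int e) 0 j r)" "q < length (table_sum f (int e') j' rs)"
    using Cons.prems(3) by (simp_all add: e'(4,5))
  have head: "region G (band (e + 2 * j) (Suc (e + 2 * j))) (of_int (row_sum f (int e) 0 j r ! q) / (2 * of_int scale))"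
    using row_sum_region[OF assms(1) Cons.prems(1) _ len(1)] Cons.prems(2) by (simp add: band_row[OF Cons.prems(1)])
  have tail: "region G (band (Suc (e + 2 * j)) (Suc (e + 2 * j) + length rs))
      (of_int (table_sum f (int e') j' rs ! q) / (2 * of_int scale))"
    using Cons.IH[OF e'(1,2) len(2)] unfolding e'(3) .
  have "table_sum f (int e) j (r # rs) ! q = row_sum f (int e) 0 j r ! q + table_sum f (int e') j' rs ! q"
    using len by (simp add: e'(4,5))
  moreover have "band (e + 2 * j) (e + 2 * j + length (r # rs)) =
      band (e + 2 * j) (Suc (e + 2 * j)) \<union> band (Suc (e + 2 * j)) (Suc (e + 2 * j) + length rs)"
    by (subst band_split[symmetric]) auto
  ultimately show ?case using region_union[OF head tail band_disjoint] by (simp add: add_divide_distrib del: table_sum.simps)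
qed

text \<open>Row \<open>a\<close> lists the orbits \<open>(a, b)\<close>, \<open>b \<le> a\<close>, with \<open>b \<equiv> e (mod 2)\<close>; an entry \<open>n\<close> stands for the time
  \<open>2 * n - e\<close>. The times were chosen by a greedy search.\<close>

lemma lower_1: "table_sum lower_values 1 0
     [[[1]], [[1], [1]], [[2], [2, 3]], [[2], [2, 3, 4], [3, 4]], [[3, 4], [3, 4, 5, 8], [4, 6, 7]], [[5], [4, 5,
     6], [3, 4, 5, 6, 7, 12], [6, 8, 9]]] =
     [14783581154276, 13908817815584, 14879207158460]"
  by code_simp

lemma lower_7: "table_sum lower_values 1 3
     [[[5, 7], [6, 7, 8, 9], [5, 7, 8, 9, 10, 18], [9, 12, 13]], [[8], [6, 8, 9], [7, 8, 9, 10, 13], [6, 7, 9,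
     12, 13, 24], [11, 15, 16]], [[8, 11], [8, 11, 12, 13], [5, 9, 12, 14, 18], [9, 13, 16, 18, 32], [14, 20]],
     [[13], [9, 13], [10, 13, 14, 16], [6, 11, 14, 17, 22], [11, 16, 20, 21, 40], [17, 25]]] =
     [946340533520, 838719825228, 954137405872]"
  by code_simp

lemma lower_11: "table_sum lower_values 1 5
     [[[16], [12, 16, 17], [13, 17, 19, 21], [8, 15, 18, 21, 29], [14, 20, 25, 50], [20, 30]], [[18], [18, 19],
     [14, 19, 20, 22], [15, 20, 22, 26], [9, 22, 26, 35], [16, 23, 30, 61], [24, 36]], [[22], [22, 23], [23, 25,
     27], [24, 28, 32], [12, 26, 31, 42], [19, 28, 36, 74], [29, 42]]] =
     [335503345096, 292889430844, 336691490824]"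
  by code_simp

lemma lower_14: "table_sum lower_values 0 7
     [[[25], [25], [26], [26, 29], [28, 32, 38], [13, 36, 50], [22, 32, 42, 86], [32, 48]], [[29], [30], [32],
     [32, 35], [38, 46], [16, 36, 44, 58], [26, 38, 50, 99], [38, 55]], [[32], [33], [34], [36], [40], [44, 52],
     [18, 42, 50], [30, 55, 114], [42, 64]]] =
     [212028493348, 183597030804, 212432937468]"
  by code_simp

lemma lower_17: "table_sum lower_values 1 8
     [[[36], [38], [40], [42], [46], [46, 52], [21, 48, 58], [34, 64, 126], [48, 74]], [[40], [42], [42], [44],
     [48], [52], [58], [64, 90], [38, 74, 146], [55, 82]], [[46], [46], [48], [52], [55], [61], [67], [27, 74],
     [44, 82, 161], [61, 90]]] =
     [146192528328, 126183646432, 146346096880]"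
  by code_simp

lemma lower_20: "table_sum lower_values 0 10
     [[[50], [50], [52], [55], [58], [61], [67], [74], [29, 82], [48, 90, 177], [99]], [[55], [58], [58], [61],
     [67], [70], [78], [82], [90], [52, 99], [109]], [[61], [61], [64], [64], [67], [74], [78], [86], [94], [99],
     [58, 109], [120]]] =
     [106955401356, 92050025412, 107009276508]"
  by code_simp

lemma lower_23: "table_sum lower_values 1 11
     [[[67], [67], [70], [74], [78], [82], [86], [94], [104], [109], [64, 120], [132]], [[74], [74], [74], [78],
     [78], [86], [90], [94], [104], [114], [120], [132], [146]]] =
     [56679853980, 48709773480, 56693421396]"
  by code_simp

text \<open>Here an entry is the last \<open>n\<close> to be sampled; the first is the one of time \<open>a\<close>.\<close>

lemma upper_1: "table_sum upper_values 1 0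
     [[1], [1, 2], [3, 3], [2, 5, 5], [5, 9, 8]] =
     [14319941354708, 13495991825544, 14409908118652]"
  by code_simp

lemma upper_6: "table_sum upper_values 0 3
     [[5, 8, 13, 10], [8, 13, 19, 14]] =
     [798231636444, 712085746892, 807450497628]"
  by code_simp

lemma upper_8: "table_sum upper_values 0 4
     [[8, 12, 18, 25, 17]] =
     [253232006496, 223933568400, 255485392800]"
  by code_simp

section \<open>The numerical bounds\<close>

lemma K_bounds: "1378 / 1000 < K2" "K2 \<le> 138 / 100" "K3 \<le> 686 / 100"
proof -
  define e where "e = exp (1::real)"
  have e: "27182 / 10000 \<le> e" "e \<le> 27183 / 10000" using e_approx_32[unfolded abs_diff_le_iff] by (simp_all add: e_def)
  have p: "31415 / 10000 \<le> pi" "pi \<le> 31416 / 10000" using pi_approx by auto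
  have "exp (- 2 :: real) = 1 / e ^ 2" "exp (- 3 :: real) = 1 / e ^ 3"
    by (simp_all add: e_def exp_minus inverse_eq_divide flip: exp_of_nat_mult)
  then have K: "K2 = 32 / (e ^ 2 * pi)" "K3 = 432 / (e ^ 3 * pi)" by (simp_all add: K2_def K3_def)
  have pos: "0 < e ^ 2 * pi" "0 < e ^ 3 * pi" using e by simp_all
  have "e ^ 2 * pi \<le> (27183 / 10000) ^ 2 * (31416 / 10000)"
    using e p by (intro mult_mono power_mono) auto
  then show "1378 / 1000 < K2" using pos unfolding K by (simp add: less_divide_eq power2_eq_square)
  have "(27182 / 10000) ^ 2 * (31415 / 10000) \<le> e ^ 2 * pi" "(27182 / 10000) ^ 3 * (31415 / 10000) \<le> e ^ 3 * pi"
    using e p by (intro mult_mono power_mono; simp)+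
  then show "K2 \<le> 138 / 100" "K3 \<le> 686 / 100"
    using pos unfolding K by (simp_all add: divide_le_eq power2_eq_square power3_eq_cube)
qed

lemma cells_band: "cells n = band 1 (Suc n)" "far_cells R n = band (Suc R) (Suc n)"
  by (auto simp: cells_def far_cells_def band_def)

lemma region_bands:
  assumes "region G (band l m) x" "region G (band m n) y" "l \<le> m" "m \<le> n"
  shows "region G (band l n) (x + y)"
  using region_union[OF assms(1,2) band_disjoint] by (simp add: band_split[OF assms(3,4)])

lemma table_region:
  assumes "\<And>q. q < 3 \<Longrightarrow> values_sound (G q) f q" "table_sum f e j rs = [x0, x1, x2]"
    and "nat e + 2 * j = m" "m + length rs = n" "0 \<le> e" "e < 2" "0 < nat e + j" "q < 3"
  shows "region (G q) (band m n) (of_int ([x0, x1, x2] ! q) / (2 * of_int scale))"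
  using table_sum_region[OF assms(1)[OF assms(8)], of "nat e" j rs] assms(2-8) by auto

text \<open>The numbers are the column totals of the seven tables divided by 2^41, rounded down. The
  tables reach to a = 24, since \<open>gval_lower\<close> takes over at 25.\<close>

lemma lower_near: "q < 3 \<Longrightarrow> \<exists>x\<ge>[754302223 / 100000000, 704447645 / 100000000, 759087824 / 100000000] ! q. region (lower_goal q) (band 1 25) x"
proof -
  assume q: "q < 3"
  note sound = lower_values_sound
  have r1: "region (lower_goal q) (band 1 7) (of_int ([14783581154276, 13908817815584, 14879207158460] ! q) / (2 * of_int scale))"
    by (rule table_region[OF sound lower_1]) (use q in simp_all)
  have r7: "region (lower_goal q) (band 7 11) (of_int ([946340533520, 838719825228, 954137405872] ! q) / (2 * of_int scale))"
    by (rule table_region[OF sound lower_7]) (use q in simp_all)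
  have r11: "region (lower_goal q) (band 11 14) (of_int ([335503345096, 292889430844, 336691490824] ! q) / (2 * of_int scale))"
    by (rule table_region[OF sound lower_11]) (use q in simp_all)
  have r14: "region (lower_goal q) (band 14 17) (of_int ([212028493348, 183597030804, 212432937468] ! q) / (2 * of_int scale))"
    by (rule table_region[OF sound lower_14]) (use q in simp_all)
  have r17: "region (lower_goal q) (band 17 20) (of_int ([146192528328, 126183646432, 146346096880] ! q) / (2 * of_int scale))"
    by (rule table_region[OF sound lower_17]) (use q in simp_all)
  have r20: "region (lower_goal q) (band 20 23) (of_int ([106955401356, 92050025412, 107009276508] ! q) / (2 * of_int scale))"
    by (rule table_region[OF sound lower_20]) (use q in simp_all)
  have r23: "region (lower_goal q) (band 23 25) (of_int ([56679853980, 48709773480, 56693421396] ! q) / (2 * of_int scale))"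
    by (rule table_region[OF sound lower_23]) (use q in simp_all)
  note r = region_bands[OF region_bands[OF region_bands[OF region_bands[OF region_bands[OF region_bands[OF r1 r7] r11] r14] r17] r20] r23]
  consider "q = 0" | "q = 1" | "q = 2" using q by linarith
  then show ?thesis
    by cases (rule exI, rule conjI[rotated], rule r; simp add: scale_def)+
qed

lemma upper_near: "q < 3 \<Longrightarrow> \<exists>x\<le>[6990106 / 1000000, 6562919 / 1000000, 7036235 / 1000000] ! q. region (upper_goal q) (band 1 9) x"
proof -
  assume q: "q < 3"
  note sound = upper_values_sound
  have r1: "region (upper_goal q) (band 1 6) (of_int ([14319941354708, 13495991825544, 14409908118652] ! q) / (2 * of_int scale))"
    by (rule table_region[OF sound upper_1]) (use q in simp_all)
  have r6: "region (upper_goal q) (band 6 8) (of_int ([798231636444, 712085746892, 807450497628] ! q) / (2 * of_int scale))"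
    by (rule table_region[OF sound upper_6]) (use q in simp_all)
  have r8: "region (upper_goal q) (band 8 9) (of_int ([253232006496, 223933568400, 255485392800] ! q) / (2 * of_int scale))"
    by (rule table_region[OF sound upper_8]) (use q in simp_all)
  note r = region_bands[OF region_bands[OF r1 r6] r8]
  consider "q = 0" | "q = 1" | "q = 2" using q by linarith
  then show ?thesis
    by cases (rule exI, rule conjI[rotated], rule r; simp add: scale_def)+
qed

text \<open>The factor of \<open>K2 * low_g a b\<close> in the total of a distant orbit: 4 (2a + 2a)
  for circular, 2 (2a + 2a + (a + b) + (a + b)) for non-circular and 8 (2a) for free rotor
  sequences.\<close>

definition coefficient :: "nat \<Rightarrow> nat \<Rightarrow> nat \<Rightarrow> real" where
  "coefficient q a b = (if q = 1 then 12 * real a + 4 * real b else 16 * real a)"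

text \<open>The polygon through one sample goes out and back. The third moment can only add to the
  sum of the two lengths, as the lower bounds for out and back contain it with opposite signs or not
  at all.\<close>

lemma support_pair:
  assumes "k < 6" "0 \<le> x"
  shows "(if k < 4 then 2 * x else x + y) \<le> support k (x, y, z) + support k (- x, - y, - z)"
  using assms unfolding less_6_iff by (elim insertE emptyE) (auto simp: support_simps max_def)

lemma support_length_low:
  assumes "25 \<le> a" "b \<le> a" "even (a + b)"
  shows "\<exists>T. \<forall>k<6. (if k < 4 then 2 * real a else real a + real b) * (K2 * low_g a b) \<le> support_length k (int a, int b) T"
proof -
  obtain t where t: "t > 0" "even (t + a)" "K2 / ((real a)\<^sup>2 + (real b)\<^sup>2)\<^sup>2 \<le> gval a b t"
    using gval_lower[OF assms] by blast
  have "(if k < 4 then 2 * real a else real a + real b) * (K2 * low_g a b) \<le> support_length k (int a, int b) t"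
    if k: "k < 6" for k
  proof -
    have "(if k < 4 then 2 * real a else real a + real b) * (K2 * low_g a b)
        \<le> (if k < 4 then 2 * real a else real a + real b) * gval a b t"
      using t(3) by (intro mult_left_mono) (auto simp: low_g_def)
    also have "\<dots> \<le> chain_length k (influence_vec (int a, int b)) 0 [t]"
      using support_pair[OF k, of "real a * gval a b t" "real b * gval a b t" "real a * real b * hval a b t"] gval_nonneg[of a b t]
      by (simp add: influence_vec_nat algebra_simps split: if_splits)
    also have "\<dots> \<le> support_length k (int a, int b) t"
      using t(1,2) assms(3) by (intro chain_length_le_support_length k)
        (auto simp: same_parity_def cong_iff_dvd_diff even_diff_iff even_add)
    finally show ?thesis .
  qed
  then show ?thesis by blast
qed

lemma lower_far_goal:
  assumes "25 \<le> a" "b \<le> a" "even (a + b)" "q < 3"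
  shows "lower_goal q a b (1378 / 1000 * (coefficient q a b * low_g a b))"
proof -
  obtain T where T: "\<And>k. k < 6 \<Longrightarrow>
      (if k < 4 then 2 * real a else real a + real b) * (K2 * low_g a b) \<le> support_length k (int a, int b) T"
    using support_length_low[OF assms(1-3)] by blast
  define c where "c = coefficient q a b * low_g a b"
  have "0 < coefficient q a b" using assms(1) by (auto simp: coefficient_def)
  moreover have "0 < low_g a b" using assms(1) by (simp add: low_g_def add_pos_nonneg)
  \<comment> \<open>The rational number lies strictly below \<open>K2\<close>, which yields the
    strict inequality asked for when \<open>q = 2\<close>.\<close>
  ultimately have c: "1378 / 1000 * c < K2 * c"
    unfolding c_def by (intro mult_strict_right_mono K_bounds mult_pos_pos)
  consider "q = 0" | "q = 1" | "q = 2" using assms(4) by linarith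
  then have "lower_goal q a b (1378 / 1000 * c)"
  proof cases
    case 1
    then have "K2 * c \<le> orbit_length True a b T"
      using T[of 0] T[of 1] by (simp add: orbit_length_def sum_2_4 c_def coefficient_def algebra_simps add_divide_distrib)
    then show ?thesis using c unfolding 1 lower_goal_def by (auto intro!: exI[of _ T])
  next
    case 2
    then have "K2 * c \<le> orbit_length False a b T"
      using T[of 2] T[of 3] T[of 4] T[of 5] by (simp add: orbit_length_def sum_2_4 c_def coefficient_def algebra_simps add_divide_distrib)
    then show ?thesis using c unfolding 2 lower_goal_def by (auto intro!: exI[of _ T])
  next
    case 3
    then have "K2 * c \<le> 8 * support_length 2 (int a, int b) T"
      using T[of 2] by (simp add: c_def coefficient_def algebra_simps add_divide_distrib)
    then have "1378 / 1000 * c < 8 * support_length 2 (int a, int b) T" using c by linarith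
    then have "\<exists>k<6. \<exists>T. 1378 / 1000 * c < 8 * support_length k (int a, int b) T"
      by (rule_tac x = 2 in exI, intro conjI exI[of _ T]) simp_all
    then show ?thesis unfolding 3 lower_goal_def by simp
  qed
  then show ?thesis by (simp add: c_def)
qed

lemma sum_1_8: "(\<Sum>b=1..8. f b) = f 1 + f 2 + f 3 + f 4 + f 5 + f 6 + f 7 + f (8::nat)" for f :: "nat \<Rightarrow> real"
  by (simp add: eval_nat_numeral)

lemma sum_1_24: "(\<Sum>b=1..24. f b) = (\<Sum>b=1..8. f b) + (\<Sum>b=1..8. f (b + 8)) + (\<Sum>b=1..8. f (b + 16))"
  for f :: "nat \<Rightarrow> real"
  by (simp add: eval_nat_numeral)

lemma start_value: "start 8 b = (if even b then 10 else 9)" "start 24 b = (if even b then 26 else 25)"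
  by (simp_all add: start_def)

text \<open>\<open>B + 26 + 2 * N\<close> with the parameters \<open>B = 10 ^ 5\<close> and \<open>N = 10 ^ 6\<close> of \<open>low_g_sum\<close>.\<close>

definition outer :: nat where "outer = 2100026"

lemma sum_split_coefficient:
  "(\<Sum>(a, b)\<in>A. weight a b * (c * (coefficient q a b * g a b))) =
    (if q = 1 then c * (3 * (\<Sum>(a, b)\<in>A. weight a b * (4 * real a * g a b)) + (\<Sum>(a, b)\<in>A. weight a b * (4 * real b * g a b)))
     else c * (4 * (\<Sum>(a, b)\<in>A. weight a b * (4 * real a * g a b))))" for g :: "nat \<Rightarrow> nat \<Rightarrow> real"
  by (auto simp: coefficient_def sum_distrib_left split_def algebra_simps simp flip: sum.distrib intro!: sum.cong)

lemma lower_far_sum: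
  "52431 / 1000000 \<le> (\<Sum>(a, b)\<in>far_cells 24 outer. weight a b * (4 * real a * low_g a b))"
  "19 / 1000 \<le> (\<Sum>(a, b)\<in>far_cells 24 outer. weight a b * (4 * real b * low_g a b))"
proof -
  have "52431 / 1000000 \<le> 1 / 2 / 626 + (\<Sum>b=1..24. 1 / ((real (start 24 b) - 1)\<^sup>2 + (real b)\<^sup>2 + 1))
      + 100 / 4901 - 1 / (2 * real (100000::nat) + 1) - (real (100000::nat) + 1) / (4 * (real (1000000::nat))\<^sup>2 + 1)"
    unfolding sum_1_24 sum_1_8 start_value by simp
  also have "\<dots> \<le> (\<Sum>(a, b)\<in>far_cells 24 outer. weight a b * (4 * real a * low_g a b))"
    by (rule low_g_sum) (simp_all add: outer_def)
  finally show "52431 / 1000000 \<le> (\<Sum>(a, b)\<in>far_cells 24 outer. weight a b * (4 * real a * low_g a b))" .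
  have "19 / 1000 \<le> 1 / 50 - 1 / 2 / (real outer + 1)" by (simp add: outer_def)
  also have "\<dots> \<le> (\<Sum>(a, b)\<in>far_cells 24 outer. weight a b * (4 * real b * low_g a b))"
    by (rule low_g_sum_rows) (simp add: outer_def)
  finally show "19 / 1000 \<le> (\<Sum>(a, b)\<in>far_cells 24 outer. weight a b * (4 * real b * low_g a b))" .
qed

text \<open>The tables and the estimate for distant cells are added. For \<open>q = 0\<close> the
  margin is only about 2/100000, which explains the precision of both summands.\<close>

lemma lower_total:
  assumes "q < 3"
  shows "\<exists>x. ([7832, 7286, 7873] ! q) / 1000 \<le> x \<and> region (lower_goal q) (cells outer) x"
proof -
  obtain x where x: "[754302223 / 100000000, 704447645 / 100000000, 759087824 / 100000000] ! q \<le> x" "region (lower_goal q) (band 1 25) x"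
    using lower_near[OF assms] by blast
  define y where "y = (\<Sum>(a, b)\<in>far_cells 24 outer. weight a b * (1378 / 1000 * (coefficient q a b * low_g a b)))"
  define A B where "A = (\<Sum>(a, b)\<in>far_cells 24 outer. weight a b * (4 * real a * low_g a b))"
    and "B = (\<Sum>(a, b)\<in>far_cells 24 outer. weight a b * (4 * real b * low_g a b))"
  have y_eq: "y = (if q = 1 then 1378 / 1000 * (3 * A + B) else 1378 / 1000 * (4 * A))"
    unfolding y_def A_def B_def by (rule sum_split_coefficient)
  have "region (lower_goal q) (far_cells 24 outer) y"
    unfolding region_def y_def
    by (intro conjI exI[of _ "\<lambda>a b. 1378 / 1000 * (coefficient q a b * low_g a b)"] finite_far_cells refl)
      (use lower_far_goal[OF _ _ _ assms] in \<open>auto simp: far_cells_def cells_def\<close>)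
  then have "region (lower_goal q) (cells outer) (x + y)"
    unfolding cells_band by (intro region_bands[OF x(2)]) (simp_all add: outer_def)
  moreover have "([7832, 7286, 7873] ! q) / 1000 \<le> x + y"
  proof -
    consider "q = 0" | "q = 1" | "q = 2" using assms by linarith
    then show ?thesis
      using x(1) lower_far_sum unfolding y_eq A_def[symmetric] B_def[symmetric] by cases (simp_all add: add_divide_distrib)
  qed
  ultimately show ?thesis by blast
qed

lemma upper_far_goal:
  assumes "9 \<le> a" "b \<le> a" "even (a + b)" "q < 3"
  shows "upper_goal q a b (138 / 100 * (coefficient q a b * far_g a b) + 686 / 100 * (2 * (8 * (real a * real b) * far_h a b)))"
proof -
  have "9\<^sup>2 \<le> (real a)\<^sup>2" using assms(1) by (intro power_mono) auto
  then have r: "81 \<le> (real a)\<^sup>2 + (real b)\<^sup>2" by (simp add: add_increasing2)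
  then have pos: "0 \<le> far_g a b" "0 \<le> real a * real b * far_h a b" by (simp_all add: far_g_def far_h_def)
  define H where "H = 2 * (real a * real b * far_h a b) * (686 / 100)"
  have L: "support_length k (int a, int b) T \<le> (if k < 4 then 2 * real a else real a + real b) * (138 / 100 * far_g a b) + H"
    if k: "k < 6" for k T
  proof -
    have "support_length k (int a, int b) T \<le>
        (if k < 4 then 2 * real a else real a + real b) * (K2 * far_g a b) + 2 * (real a * real b * far_h a b) * K3"
      using support_length_far[OF assms(1-3) k, of T] by (simp add: far_g_def far_h_def mult_ac)
    also have "\<dots> \<le> (if k < 4 then 2 * real a else real a + real b) * (138 / 100 * far_g a b) + H"
      unfolding H_def using pos K_bounds by (intro add_mono mult_left_mono mult_right_mono) auto
    finally show ?thesis .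
  qed
  consider "q = 0" | "q = 1" | "q = 2" using assms(4) by linarith
  then show ?thesis
  proof cases
    case 1
    have "orbit_length True a b T \<le> 138 / 100 * (coefficient 0 a b * far_g a b) + 8 * H" for T
      using L[of 0 T] L[of 1 T] by (simp add: orbit_length_def sum_2_4 coefficient_def algebra_simps add_divide_distrib)
    then show ?thesis by (simp add: 1 upper_goal_def H_def algebra_simps add_divide_distrib)
  next
    case 2
    have "orbit_length False a b T \<le> 138 / 100 * (coefficient 1 a b * far_g a b) + 8 * H" for T
      using L[of 2 T] L[of 3 T] L[of 4 T] L[of 5 T] by (simp add: orbit_length_def sum_2_4 coefficient_def algebra_simps add_divide_distrib)
    then show ?thesis by (simp add: 2 upper_goal_def H_def algebra_simps add_divide_distrib)
  next
    case 3
    have "8 * support_length k (int a, int b) T \<le> 138 / 100 * (coefficient 2 a b * far_g a b) + 8 * H" if "k < 6" for k T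
    proof -
      have "(if k < 4 then 2 * real a else real a + real b) * (138 / 100 * far_g a b) \<le> 2 * real a * (138 / 100 * far_g a b)"
        using assms(2) pos by (intro mult_right_mono) auto
      then have "8 * support_length k (int a, int b) T \<le> 8 * (2 * real a * (138 / 100 * far_g a b)) + 8 * H"
        using L[OF that, of T] by linarith
      then show ?thesis by (simp add: coefficient_def)
    qed
    then show ?thesis by (simp add: 3 upper_goal_def H_def algebra_simps add_divide_distrib)
  qed
qed

lemma upper_far_sum:
  "(\<Sum>(a, b)\<in>far_cells 8 n. weight a b * (4 * real a * far_g a b)) \<le> 1614 / 10000"
  "(\<Sum>(a, b)\<in>far_cells 8 n. weight a b * (8 * (real a * real b) * far_h a b)) \<le> 66 / 10000"
  by (rule order_trans[OF far_g_sum], unfold sum_1_8 start_value, simp add: power_divide)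
    (rule order_trans[OF far_h_sum], unfold sum_1_8 start_value, simp add: power_divide)

lemma upper_goal_nonneg: "upper_goal q a b v \<Longrightarrow> 0 \<le> v"
proof (cases "q = 2")
  case True
  assume "upper_goal q a b v"
  then have "8 * support_length 0 (int a, int b) 0 \<le> v" by (simp add: True upper_goal_def)
  then show ?thesis using support_length_nonneg[of 0 "(int a, int b)" 0] by simp
next
  case False
  assume "upper_goal q a b v"
  then have "orbit_length (q = 0) a b 0 \<le> v" by (simp add: False upper_goal_def)
  then show ?thesis using orbit_length_nonneg[of "q = 0" a b 0] by simp
qed

text \<open>One function \<open>U\<close> has to serve all \<open>n\<close>: table values up to a =
  8, the closed formula from a = 9 on. As upper bounds of lengths its values are nonnegative, so a
  small set of cells may be enlarged to contain the whole table.\<close>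

lemma upper_total:
  assumes "q < 3"
  shows "\<exists>U. (\<forall>a b. 1 \<le> a \<longrightarrow> b \<le> a \<longrightarrow> even (a + b) \<longrightarrow> upper_goal q a b (U a b)) \<and>
    (\<forall>n. (\<Sum>(a, b)\<in>cells n. weight a b * U a b) \<le> ([7985, 7439, 8026] ! q) / 1000)"
proof -
  obtain x where x: "x \<le> [6990106 / 1000000, 6562919 / 1000000, 7036235 / 1000000] ! q" "region (upper_goal q) (band 1 9) x"
    using upper_near[OF assms] by blast
  then obtain v where v: "finite (band 1 9)" "\<forall>(a, b)\<in>band 1 9. upper_goal q a b (v a b)"
    "(\<Sum>(a, b)\<in>band 1 9. weight a b * v a b) = x"
    by (auto simp: region_def)
  define F where "F a b = 138 / 100 * (coefficient q a b * far_g a b) + 686 / 100 * (2 * (8 * (real a * real b) * far_h a b))" for a b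
  define U where "U a b = (if a < 9 then v a b else F a b)" for a b
  have goal: "upper_goal q a b (U a b)" if "1 \<le> a" "b \<le> a" "even (a + b)" for a b
  proof (cases "a < 9")
    case True
    then have "(a, b) \<in> band 1 9" using that by (simp add: band_def)
    then show ?thesis using v(2) True by (auto simp: U_def)
  next
    case False
    then show ?thesis using upper_far_goal[OF _ that(2,3) assms] by (simp add: U_def F_def)
  qed
  have "(\<Sum>(a, b)\<in>cells n. weight a b * U a b) \<le> ([7985, 7439, 8026] ! q) / 1000" for n
  proof -
    define A B H where "A = (\<Sum>(a, b)\<in>far_cells 8 n. weight a b * (4 * real a * far_g a b))"
      and "B = (\<Sum>(a, b)\<in>far_cells 8 n. weight a b * (4 * real b * far_g a b))"
      and "H = (\<Sum>(a, b)\<in>far_cells 8 n. weight a b * (8 * (real a * real b) * far_h a b))"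
    have sub: "cells n \<subseteq> band 1 9 \<union> far_cells 8 n" by (auto simp: cells_def band_def far_cells_def)
    have "(\<Sum>(a, b)\<in>cells n. weight a b * U a b) \<le> (\<Sum>(a, b)\<in>band 1 9 \<union> far_cells 8 n. weight a b * U a b)"
    proof (rule sum_mono2[OF _ sub])
      show "0 \<le> (case c of (a, b) \<Rightarrow> weight a b * U a b)" if "c \<in> band 1 9 \<union> far_cells 8 n - cells n" for c
      proof -
        obtain a b where c: "c = (a, b)" by (cases c)
        have "upper_goal q a b (U a b)"
          using that unfolding c by (intro goal) (auto simp: band_def far_cells_def cells_def)
        then show ?thesis using upper_goal_nonneg weight_pos[of a b] by (simp add: c)
      qed
    qed (use v(1) in simp)
    also have "\<dots> = (\<Sum>(a, b)\<in>band 1 9. weight a b * U a b) + (\<Sum>(a, b)\<in>far_cells 8 n. weight a b * U a b)"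
      by (rule sum.union_disjoint[OF v(1) finite_far_cells]) (auto simp: band_def far_cells_def)
    also have "(\<Sum>(a, b)\<in>band 1 9. weight a b * U a b) = (\<Sum>(a, b)\<in>band 1 9. weight a b * v a b)"
      by (rule sum.cong) (auto simp: U_def band_def)
    also have "\<dots> = x" by (rule v(3))
    also have "(\<Sum>(a, b)\<in>far_cells 8 n. weight a b * U a b) = (\<Sum>(a, b)\<in>far_cells 8 n. weight a b * F a b)"
      by (rule sum.cong) (auto simp: U_def far_cells_def)
    also have "\<dots> = (\<Sum>(a, b)\<in>far_cells 8 n. weight a b * (138 / 100 * (coefficient q a b * far_g a b))) +
        686 / 100 * (2 * (\<Sum>(a, b)\<in>far_cells 8 n. weight a b * (8 * (real a * real b) * far_h a b)))"
      unfolding F_def sum_distrib_left by (simp add: split_def distrib_left mult_ac flip: sum.distrib)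
    finally have le: "(\<Sum>(a, b)\<in>cells n. weight a b * U a b) \<le>
        x + ((\<Sum>(a, b)\<in>far_cells 8 n. weight a b * (138 / 100 * (coefficient q a b * far_g a b))) + 686 / 100 * (2 * H))"
      unfolding H_def .
    consider "q = 0" | "q = 1" | "q = 2" using assms by linarith
    then show ?thesis
      using le x(1) upper_far_sum[of n] far_g_sum_rows[of n]
      unfolding sum_split_coefficient A_def[symmetric] B_def[symmetric] H_def[symmetric]
      by cases (simp_all add: add_divide_distrib)
  qed
  then show ?thesis using goal by blast
qed

theorem theorem15:
  shows "(\<forall>N. rotor_sequence N \<and> circular_rotor N \<longrightarrow>
            ereal 7.832 \<le> sup_discrepancy (\<lambda>_. N) \<and> sup_discrepancy (\<lambda>_. N) \<le> ereal 7.985)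
       \<and> (\<forall>N. rotor_sequence N \<and> \<not> circular_rotor N \<longrightarrow>
            ereal 7.286 \<le> sup_discrepancy (\<lambda>_. N) \<and> sup_discrepancy (\<lambda>_. N) \<le> ereal 7.439)
       \<and> (\<forall>R. maxcon_optimal R \<longrightarrow>
            ereal 7.873 \<le> sup_discrepancy_origin R \<and> sup_discrepancy_origin R \<le> ereal 8.026)"
proof -
  \<comment> \<open>The two cases of a common rotor sequence are treated at once, with
    \<open>q = 0\<close> for circular and \<open>q = 1\<close> for non-circular ones.\<close>
  have same: "ereal (([7832, 7286, 7873] ! q) / 1000) \<le> sup_discrepancy (\<lambda>_. N) \<and>
      sup_discrepancy (\<lambda>_. N) \<le> ereal (([7985, 7439, 8026] ! q) / 1000)"
    if N: "rotor_sequence N" and q: "q < 2" "circular_rotor N \<longleftrightarrow> q = 0" for N q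
  proof
    have q3: "q < 3" "q \<noteq> 2" using q(1) by auto
    obtain x v where x: "([7832, 7286, 7873] ! q) / 1000 \<le> x"
      and v: "\<forall>(a, b)\<in>cells outer. lower_goal q a b (v a b)" "(\<Sum>(a, b)\<in>cells outer. weight a b * v a b) = x"
      using lower_total[OF q3(1)] unfolding region_def by blast
    have "ereal x \<le> sup_discrepancy (\<lambda>_. N)"
      unfolding v(2)[symmetric]
      by (rule sup_discrepancy_ge[OF N subset_refl]) (use v(1) q3(2) q(2) in \<open>auto simp: lower_goal_def\<close>)
    then show "ereal (([7832, 7286, 7873] ! q) / 1000) \<le> sup_discrepancy (\<lambda>_. N)"
      using x by (intro order_trans[OF _ \<open>ereal x \<le> _\<close>]) simp
    obtain U where U: "\<And>a b. 1 \<le> a \<Longrightarrow> b \<le> a \<Longrightarrow> even (a + b) \<Longrightarrow> upper_goal q a b (U a b)"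
      "\<And>n. (\<Sum>(a, b)\<in>cells n. weight a b * U a b) \<le> ([7985, 7439, 8026] ! q) / 1000"
      using upper_total[OF q3(1)] by blast
    show "sup_discrepancy (\<lambda>_. N) \<le> ereal (([7985, 7439, 8026] ! q) / 1000)"
      by (rule sup_discrepancy_le[OF N _ U(2)]) (use U(1) q3(2) q(2) in \<open>auto simp: upper_goal_def\<close>)
  qed
  have free: "ereal 7.873 \<le> sup_discrepancy_origin R \<and> sup_discrepancy_origin R \<le> ereal 8.026" if R: "maxcon_optimal R" for R
  proof
    obtain x v where x: "([7832, 7286, 7873] ! 2) / 1000 \<le> x"
      and v: "\<forall>(a, b)\<in>cells outer. lower_goal 2 a b (v a b)" "(\<Sum>(a, b)\<in>cells outer. weight a b * v a b) = x"
      using lower_total[of 2] unfolding region_def by auto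
    have "ereal x \<le> sup_discrepancy_origin R"
      unfolding v(2)[symmetric]
      by (rule sup_discrepancy_origin_ge[OF R subset_refl]) (use v(1) in \<open>auto simp: lower_goal_def\<close>)
    then show "ereal 7.873 \<le> sup_discrepancy_origin R"
      using x by (intro order_trans[OF _ \<open>ereal x \<le> _\<close>]) simp
    obtain U where U: "\<And>a b. 1 \<le> a \<Longrightarrow> b \<le> a \<Longrightarrow> even (a + b) \<Longrightarrow> upper_goal 2 a b (U a b)"
      "\<And>n. (\<Sum>(a, b)\<in>cells n. weight a b * U a b) \<le> 8.026"
      using upper_total[of 2] by auto
    show "sup_discrepancy_origin R \<le> ereal 8.026"
      by (rule sup_discrepancy_origin_le[OF _ _ U(2)])
        (use U(1) R in \<open>auto simp: upper_goal_def maxcon_optimal_def\<close>)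
  qed
  show ?thesis
    using same[of _ 0] same[of _ 1] free by simp
qed

end
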